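(* For every integer $k\geq 0$ there exist, for every $n\geq 2$, total Boolean functions $f_{k,n}:\{0,1\}^{N_k}\to\{0,1\}$ such that, as $n\to\infty$ with $k$ fixed, $Q(f_{k,n})=\widetilde{\Omega}(n^{1.5k+1})$ and $\mathrm{UC}(f_{k,n})=\widetilde{O}(n^{k+1})$, where the $\widetilde{\Omega},\widetilde{O}$ notation hides factors polylogarithmic in $n$ (and constants depending on $k$). Consequently there is a sequence of total Boolean functions $f$ with $\mathrm{UC}(f)\to\infty$ and $Q(f)\geq \mathrm{UC}(f)^{1.5-o(1)}$.
   Context: $Q(f)$ denotes bounded-error quantum query complexity (minimum worst-case number of oracle queries of a quantum algorithm that outputs $f(x)$ with probability at least $2/3$ on every input $x$). A certificate for input $x$ is a partial assignment consistent with $x$ such that all inputs consistent with it have the same $f$-value as $x$. $\mathrm{UC}_b(f)$, for $b\in\{0,1\}$, is the minimum $w$ such that there is a set of $b$-certificates, each fixing at most $w$ variables, with every input $x$ satisfying $f(x)=b$ consistent with exactly one of them; $\mathrm{UC}(f)=\max\{\mathrm{UC}_0(f),\mathrm{UC}_1(f)\}$. *)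

theory Defs
  imports
    Complex_Main
    "HOL-Library.Landau_Symbols"
    "Jordan_Normal_Form.Schur_Decomposition"
begin

text \<open>
  A total Boolean function on \<open>{0,1}\<^sup>N\<close> is given by its arity \<open>N\<close> and an
  \<open>f :: bool list \<Rightarrow> bool\<close>; every notion below evaluates \<open>f\<close> on lists of length \<open>N\<close> only.
\<close>

definition inputs :: "nat \<Rightarrow> bool list set" where
  "inputs N = {x. length x = N}"


subsection \<open>Certificates and unambiguous certificate complexity\<close>

definition consistent :: "(nat \<rightharpoonup> bool) \<Rightarrow> bool list \<Rightarrow> bool" where
  "consistent p x \<longleftrightarrow> (\<forall>i\<in>dom p. i < length x \<and> p i = Some (x ! i))"

definition certificate :: "nat \<Rightarrow> (bool list \<Rightarrow> bool) \<Rightarrow> bool list \<Rightarrow> (nat \<rightharpoonup> bool) \<Rightarrow> bool" where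
  "certificate N f x p \<longleftrightarrow>
     consistent p x \<and> (\<forall>y\<in>inputs N. consistent p y \<longrightarrow> f y = f x)"

definition b_certificate :: "nat \<Rightarrow> (bool list \<Rightarrow> bool) \<Rightarrow> bool \<Rightarrow> (nat \<rightharpoonup> bool) \<Rightarrow> bool" where
  "b_certificate N f b p \<longleftrightarrow> (\<exists>x\<in>inputs N. f x = b \<and> certificate N f x p)"

definition UC_b :: "nat \<Rightarrow> (bool list \<Rightarrow> bool) \<Rightarrow> bool \<Rightarrow> nat" where
  "UC_b N f b =
     (LEAST w. \<exists>S. (\<forall>p\<in>S. b_certificate N f b p \<and> card (dom p) \<le> w) \<and>
                   (\<forall>x\<in>inputs N. f x = b \<longrightarrow> (\<exists>!p. p \<in> S \<and> consistent p x)))"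

definition UC :: "nat \<Rightarrow> (bool list \<Rightarrow> bool) \<Rightarrow> nat" where
  "UC N f = max (UC_b N f False) (UC_b N f True)"


subsection \<open>Bounded-error quantum query complexity\<close>

text \<open>
  The state space has basis vectors \<open>|i, w, a\<rangle>\<close> with query index \<open>i \<le> N\<close>, workspace content
  \<open>w < m\<close> and answer bit \<open>a\<close>, numbered as \<open>j = 2 * (m * i + w) + a\<close>.  The oracle for \<open>x\<close> maps
  \<open>|i, w, a\<rangle>\<close> to \<open>|i, w, a \<oplus> x\<^sub>i\<rangle>\<close> for \<open>i < N\<close>.  The dummy index \<open>i = N\<close> is answered by \<open>0\<close>:
  this amounts to a controlled query and keeps the space nonzero for \<open>N = 0\<close>.
\<close>

definition qdim :: "nat \<Rightarrow> nat \<Rightarrow> nat" where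
  "qdim N m = 2 * m * (N + 1)"

definition oracle_map :: "nat \<Rightarrow> nat \<Rightarrow> bool list \<Rightarrow> nat \<Rightarrow> nat" where
  "oracle_map N m x j =
     (let i = j div (2 * m)
      in if i < N \<and> x ! i then (if even j then j + 1 else j - 1) else j)"

definition oracle_mat :: "nat \<Rightarrow> nat \<Rightarrow> bool list \<Rightarrow> complex mat" where
  "oracle_mat N m x =
     mat (qdim N m) (qdim N m) (\<lambda>(r, c). if r = oracle_map N m x c then 1 else 0)"

definition unitary :: "nat \<Rightarrow> complex mat \<Rightarrow> bool" where
  "unitary d V \<longleftrightarrow> V \<in> carrier_mat d d \<and> mat_adjoint V * V = 1\<^sub>m d"

text \<open>
  The state after \<open>t\<close> queries, \<open>V\<^sub>t O\<^sub>x V\<^sub>t\<^sub>-\<^sub>1 \<dots> O\<^sub>x V\<^sub>0 |0\<rangle>\<close>.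
\<close>

primrec query_state ::
  "nat \<Rightarrow> nat \<Rightarrow> (nat \<Rightarrow> complex mat) \<Rightarrow> bool list \<Rightarrow> nat \<Rightarrow> complex vec" where
  "query_state N m V x 0 = V 0 *\<^sub>v unit_vec (qdim N m) 0"
| "query_state N m V x (Suc t) = V (Suc t) *\<^sub>v (oracle_mat N m x *\<^sub>v query_state N m V x t)"

text \<open>
  The final state is measured in the computational basis and the output is \<open>1\<close> iff the outcome
  lies in \<open>A\<close>.
\<close>

definition output_prob ::
  "nat \<Rightarrow> nat \<Rightarrow> (nat \<Rightarrow> complex mat) \<Rightarrow> nat set \<Rightarrow> nat \<Rightarrow> bool list \<Rightarrow> bool \<Rightarrow> real" where
  "output_prob N m V A T x b =
     (\<Sum>j | j < qdim N m \<and> (j \<in> A \<longleftrightarrow> b). (cmod (query_state N m V x T $ j))\<^sup>2)"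

definition quantum_computable :: "nat \<Rightarrow> (bool list \<Rightarrow> bool) \<Rightarrow> nat \<Rightarrow> bool" where
  "quantum_computable N f T \<longleftrightarrow>
     (\<exists>m V A. m > 0 \<and> (\<forall>t\<le>T. unitary (qdim N m) (V t)) \<and>
        (\<forall>x\<in>inputs N. output_prob N m V A T x (f x) \<ge> 2 / 3))"

definition Q :: "nat \<Rightarrow> (bool list \<Rightarrow> bool) \<Rightarrow> nat" where
  "Q N f = (LEAST T. quantum_computable N f T)"


subsection \<open>Asymptotics up to polylogarithmic factors\<close>

definition soft_bigo :: "(nat \<Rightarrow> real) \<Rightarrow> (nat \<Rightarrow> real) set" where
  "soft_bigo g = (\<Union>d::nat. O(\<lambda>n. g n * ln (real n) ^ d))"

definition soft_bigomega :: "(nat \<Rightarrow> real) \<Rightarrow> (nat \<Rightarrow> real) set" where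
  "soft_bigomega g = (\<Union>d::nat. \<Omega>(\<lambda>n. g n / ln (real n) ^ d))"

end

theory Submission
  imports Defs "HOL-Analysis.Function_Topology"
begin

text \<open>
  Start with the negation of a DNF \<open>g\<close> of polylogarithmic width on \<open>\<approx> n\<close> variables whose
  negative-weight adversary bound is \<open>\<approx> n\<close> (a \<open>\<kappa>\<close>-sum problem with \<open>\<kappa> \<approx> log n\<close>), and iterate
  \<open>f \<mapsto> AND\<^sub>n \<circ> CS(g \<circ> f)\<close>, where \<open>CS\<close> is the cheat sheet construction.  Up to polylogarithmic
  factors, composing with \<open>g\<close> multiplies the adversary bound by \<open>n\<close>, the cheat sheet preserves
  it, and \<open>AND\<^sub>n\<close> multiplies it by \<open>\<surd>n\<close>: in total \<open>n\<close> to the power 3/2 per round.  Unambiguous certificates grow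
  only by a factor \<open>n\<close> per round: an accepting cell of a cheat sheet is by itself an unambiguous
  1-certificate whose size is the ordinary certificate complexity of \<open>g \<circ> f\<close>, which is
  \<open>\<approx> max (C\<^sub>1 f) (n C\<^sub>0 f)\<close> since \<open>g\<close> has small width; and \<open>AND\<^sub>n\<close> raises \<open>C\<^sub>1\<close> but not \<open>C\<^sub>0\<close>.
\<close>

text \<open>Up to polylogarithmic factors, round \<open>k\<close> ends with C_0 = n^k, C_1 = UC =
  n^(k+1) and adversary bound n^(1.5 k + 1); the ratio (1.5 k + 1) / (k + 1) of the exponents tends
  to 3/2. The factor n between C_1 and C_0 pays for the next round: a false value of g o f may need
  0-certificates of all its n blocks, a true value only a few 1-certificates, and both cost n^(k+1).
  The cheat sheet loses this gap, having both certificate complexities near n^(k+1), and AND_n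
  restores it. The negation of the DNF provides it for k = 0. The induction carries the adversary
  bound and not \<open>Q\<close>, because that bound multiplies under composition without loss of
  constants; the price is that the cheat sheet, too, must be shown to preserve the adversary bound.
  The \<kappa>-sum problem has an adversary bound of order n^(\<kappa>/(\<kappa>+1)), up to a factor
  depending on \<kappa>. Short certificates want a small \<kappa>, while n^(\<kappa>/(\<kappa>+1))
  reaches n / 2 once \<kappa> is at least log n; hence a logarithmic \<kappa>.\<close>

subsection \<open>Gram kernels and the adversary bound\<close>

text \<open>Positive semidefiniteness in the form of an explicit factor \<open>b\<close>: sums,
  Schur products and substitutions then act on the vectors themselves. Passing from a semidefinite
  matrix to a factor is left to \<open>gram_if_psd\<close>.\<close>

definition gram :: "'a set \<Rightarrow> ('a \<Rightarrow> 'a \<Rightarrow> real) \<Rightarrow> bool" where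
  "gram X G \<longleftrightarrow> (\<exists>(d::nat) b. \<forall>x\<in>X. \<forall>y\<in>X. G x y = (\<Sum>t<d. b t x * b t y))"

lemma gramI:
  assumes "finite T" and "\<And>x y. x \<in> X \<Longrightarrow> y \<in> X \<Longrightarrow> G x y = (\<Sum>t\<in>T. b t x * b t y)"
  shows "gram X G"
proof -
  obtain h where h: "bij_betw h {..<card T} T"
    using ex_bij_betw_nat_finite[OF assms(1)] by (auto simp: atLeast0LessThan)
  have "G x y = (\<Sum>t<card T. b (h t) x * b (h t) y)" if "x \<in> X" "y \<in> X" for x y
    using assms(2)[OF that] sum.reindex_bij_betw[OF h, of "\<lambda>t. b t x * b t y"] by simp
  then show ?thesis unfolding gram_def
    by (intro exI[of _ "card T"] exI[of _ "\<lambda>t. b (h t)"]) blast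
qed

lemma gram_cong:
  assumes "gram X G" "\<And>x y. x \<in> X \<Longrightarrow> y \<in> X \<Longrightarrow> H x y = G x y"
  shows "gram X H"
  using assms unfolding gram_def by auto

lemma gram_rank_one: "gram X (\<lambda>x y. s x * s y)"
  by (rule gramI[of "{()}" _ _ "\<lambda>_. s"]) auto

lemma gram_const: "0 \<le> c \<Longrightarrow> gram X (\<lambda>x y. c)"
  using gram_rank_one[of X "\<lambda>_. sqrt c"] by (simp add: real_sqrt_mult_self)

lemma gram_comp:
  assumes "gram Y G" "\<And>x. x \<in> X \<Longrightarrow> h x \<in> Y"
  shows "gram X (\<lambda>x y. G (h x) (h y))"
proof -
  obtain d :: nat and b where b: "\<forall>x\<in>Y. \<forall>y\<in>Y. G x y = (\<Sum>t<d. b t x * b t y)"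
    using assms(1) unfolding gram_def by auto
  then show ?thesis using assms(2)
    by (intro gramI[of "{..<d}" _ _ "\<lambda>t x. b t (h x)"]) auto
qed

lemma gram_add:
  assumes "gram X G" "gram X H"
  shows "gram X (\<lambda>x y. G x y + H x y)"
proof -
  obtain d :: nat and b where b: "\<forall>x\<in>X. \<forall>y\<in>X. G x y = (\<Sum>t<d. b t x * b t y)"
    using assms(1) unfolding gram_def by auto
  obtain e :: nat and c where c: "\<forall>x\<in>X. \<forall>y\<in>X. H x y = (\<Sum>t<e. c t x * c t y)"
    using assms(2) unfolding gram_def by auto
  show ?thesis
  proof (rule gramI[of "{..<d} <+> {..<e}" _ _ "case_sum b c"])
    fix x y assume "x \<in> X" "y \<in> X"
    then show "G x y + H x y = (\<Sum>t\<in>{..<d} <+> {..<e}. case_sum b c t x * case_sum b c t y)"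
      using b c by (simp add: sum.Plus)
  qed auto
qed

text \<open>Schur's product theorem, with the tensor products of the two vector families as
  factor.\<close>

lemma gram_mult:
  assumes "gram X G" "gram X H"
  shows "gram X (\<lambda>x y. G x y * H x y)"
proof -
  obtain d :: nat and b where b: "\<forall>x\<in>X. \<forall>y\<in>X. G x y = (\<Sum>t<d. b t x * b t y)"
    using assms(1) unfolding gram_def by auto
  obtain e :: nat and c where c: "\<forall>x\<in>X. \<forall>y\<in>X. H x y = (\<Sum>t<e. c t x * c t y)"
    using assms(2) unfolding gram_def by auto
  show ?thesis
  proof (rule gramI[of "{..<d} \<times> {..<e}" _ _ "\<lambda>(t, u) x. b t x * c u x"])
    fix x y assume "x \<in> X" "y \<in> X"
    then have "G x y * H x y = (\<Sum>t<d. \<Sum>u<e. (b t x * b t y) * (c u x * c u y))"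
      using b c by (simp add: sum_product)
    also have "\<dots> = (\<Sum>(t, u)\<in>{..<d} \<times> {..<e}. (b t x * b t y) * (c u x * c u y))"
      by (rule sum.cartesian_product)
    finally show "G x y * H x y = (\<Sum>p\<in>{..<d} \<times> {..<e}.
        (case p of (t, u) \<Rightarrow> \<lambda>x. b t x * c u x) x * (case p of (t, u) \<Rightarrow> \<lambda>x. b t x * c u x) y)"
      by (simp add: case_prod_beta mult_ac)
  qed auto
qed

lemma gram_scale: "gram X G \<Longrightarrow> 0 \<le> c \<Longrightarrow> gram X (\<lambda>x y. c * G x y)"
  by (rule gram_mult[OF gram_const])

lemma gram_prod:
  assumes "\<And>i. i \<in> I \<Longrightarrow> gram X (G i)"
  shows "gram X (\<lambda>x y. \<Prod>i\<in>I. G i x y)"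
proof (cases "finite I")
  case True
  then show ?thesis using assms
  proof (induction I rule: finite_induct)
    case empty
    show ?case using gram_const[of 1] by simp
  next
    case (insert i I)
    then show ?case using gram_mult[of X "G i" "\<lambda>x y. \<Prod>i\<in>I. G i x y"] by simp
  qed
qed (use gram_const[of 1] in simp)

lemma gram_delta: "finite X \<Longrightarrow> gram X (\<lambda>x y. if x = y then 1 else 0)"
  by (rule gramI[of X _ _ "\<lambda>t x. if t = x then 1 else 0"]) (auto simp: if_distrib cong: if_cong)

lemma gram_sym: "gram X G \<Longrightarrow> x \<in> X \<Longrightarrow> y \<in> X \<Longrightarrow> G x y = G y x"
  unfolding gram_def by (auto simp: mult.commute)

text \<open>Points outside \<open>X\<close> receive the zero vector.\<close>

lemma gram_ext_zero:
  assumes "gram X G"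
  shows "gram Y (\<lambda>x y. if x \<in> X \<and> y \<in> X then G x y else 0)"
proof -
  obtain d :: nat and b where b: "\<forall>x\<in>X. \<forall>y\<in>X. G x y = (\<Sum>t<d. b t x * b t y)"
    using assms(1) unfolding gram_def by auto
  show ?thesis
    by (rule gramI[of "{..<d}" _ _ "\<lambda>t x. if x \<in> X then b t x else 0"]) (use b in auto)
qed

text \<open>
  A link of a Boolean function \<open>f\<close> on \<open>X\<close> is the Gram kernel of two orthonormal families, one
  for each value of \<open>f\<close>; its off-diagonal block is an arbitrary contraction.
\<close>

definition link :: "'a set \<Rightarrow> ('a \<Rightarrow> bool) \<Rightarrow> ('a \<Rightarrow> 'a \<Rightarrow> real) \<Rightarrow> bool" where
  "link X f G \<longleftrightarrow> gram X G \<and>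
     (\<forall>x\<in>X. \<forall>y\<in>X. f x = f y \<longrightarrow> G x y = (if x = y then 1 else 0))"

definition query_link ::
  "'a set \<Rightarrow> ('a \<Rightarrow> bool) \<Rightarrow> ('a \<Rightarrow> 'a \<Rightarrow> real) \<Rightarrow> real \<Rightarrow> ('a \<Rightarrow> bool) \<Rightarrow> bool" where
  "query_link X f G \<Lambda> \<beta> \<longleftrightarrow> (\<exists>K. link X f K \<and>
     (\<forall>x\<in>X. \<forall>y\<in>X. f x \<noteq> f y \<longrightarrow> K x y = \<Lambda> * G x y * (if \<beta> x \<noteq> \<beta> y then 1 else 0)))"

definition aligned :: "'a set \<Rightarrow> ('a \<Rightarrow> bool) \<Rightarrow> ('a \<Rightarrow> 'a \<Rightarrow> real) \<Rightarrow> ('a \<Rightarrow> real) \<Rightarrow> bool" where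
  "aligned X f G w \<longleftrightarrow> (\<forall>b. (\<Sum>x | x \<in> X \<and> f x = b. (w x)\<^sup>2) = 1) \<and>
     (\<Sum>x | x \<in> X \<and> \<not> f x. \<Sum>y | y \<in> X \<and> f y. w x * w y * G x y) = 1"

text \<open>
  The general (negative-weight) adversary bound with optimal matrix \<open>\<Gamma> = \<Lambda> G\<close>: \<open>aligned\<close> says
  that the norm of \<open>\<Gamma>\<close> is attained, and a query link that \<open>\<Gamma> \<circ> D\<^sub>\<beta>\<close> is a contraction.  Phrasing
  contractions as Gram kernels makes all compositions below purely algebraic.
\<close>

definition adversary :: "'a set \<Rightarrow> ('a \<Rightarrow> bool) \<Rightarrow> ('a \<Rightarrow> bool) set \<Rightarrow> real \<Rightarrow> bool" where
  "adversary X f B \<Lambda> \<longleftrightarrow>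
     (\<exists>G w. link X f G \<and> aligned X f G w \<and> (\<forall>\<beta>\<in>B. query_link X f G \<Lambda> \<beta>))"

definition input_bits :: "nat \<Rightarrow> (bool list \<Rightarrow> bool) set" where
  "input_bits N = (\<lambda>i x. x ! i) ` {..<N}"

lemma finite_inputs [simp]: "finite (inputs N)"
  using finite_lists_length_eq[of "UNIV :: bool set" N] by (simp add: inputs_def)

lemma card_inputs: "card (inputs N) = 2 ^ N"
  using card_lists_length_eq[of "UNIV :: bool set" N] by (simp add: inputs_def)

lemma link_gram: "link X f G \<Longrightarrow> gram X G"
  by (simp add: link_def)

lemma link_same:
  "link X f G \<Longrightarrow> x \<in> X \<Longrightarrow> y \<in> X \<Longrightarrow> f x = f y \<Longrightarrow> G x y = (if x = y then 1 else 0)"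
  by (simp add: link_def)

lemma link_delta: "finite X \<Longrightarrow> link X f (\<lambda>x y. if x = y then 1 else 0)"
  by (simp add: link_def gram_delta)

text \<open>A convex combination with the identity kernel shrinks the cross block by
  \<open>\<mu>\<close> and keeps both families orthonormal. This is how
  \<open>query_link_mono\<close> lowers \<open>\<Lambda>\<close>.\<close>

lemma link_scale:
  assumes "finite X" "link X f K" "0 \<le> \<mu>" "\<mu> \<le> 1"
  shows "link X f (\<lambda>x y. \<mu> * K x y + (1 - \<mu>) * (if x = y then 1 else 0))"
  unfolding link_def
proof (intro conjI ballI impI)
  show "gram X (\<lambda>x y. \<mu> * K x y + (1 - \<mu>) * (if x = y then 1 else 0))"
    using assms by (intro gram_add gram_scale gram_delta) (auto simp: link_def)
  fix x y assume "x \<in> X" "y \<in> X" "f x = f y"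
  then show "\<mu> * K x y + (1 - \<mu>) * (if x = y then 1 else 0) = (if x = y then 1 else 0)"
    using assms(2) by (simp add: link_def)
qed

lemma query_linkI:
  assumes "link X f K"
    and "\<And>x y. x \<in> X \<Longrightarrow> y \<in> X \<Longrightarrow> \<not> f x \<Longrightarrow> f y \<Longrightarrow>
           K x y = \<Lambda> * G x y * (if \<beta> x \<noteq> \<beta> y then 1 else 0)"
    and "gram X G"
  shows "query_link X f G \<Lambda> \<beta>"
  unfolding query_link_def
proof (intro exI[of _ K] conjI ballI impI)
  show "link X f K" by fact
  fix x y assume xy: "x \<in> X" "y \<in> X" "f x \<noteq> f y"
  show "K x y = \<Lambda> * G x y * (if \<beta> x \<noteq> \<beta> y then 1 else 0)"
  proof (cases "f x")
    case True
    then have "K y x = \<Lambda> * G y x * (if \<beta> y \<noteq> \<beta> x then 1 else 0)"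
      using assms(2)[of y x] xy by auto
    then show ?thesis
      using gram_sym[OF link_gram[OF assms(1)], of x y] gram_sym[OF assms(3), of x y] xy
      by auto
  qed (use xy assms(2) in auto)
qed

lemma query_link_mono:
  assumes "finite X" "query_link X f G \<Lambda> \<beta>" "0 \<le> \<Lambda>'" "\<Lambda>' \<le> \<Lambda>"
  shows "query_link X f G \<Lambda>' \<beta>"
proof (cases "\<Lambda> = 0")
  case True
  then show ?thesis using assms by auto
next
  case False
  with assms have pos: "\<Lambda> > 0" by auto
  obtain K where K: "link X f K"
    "\<And>x y. x \<in> X \<Longrightarrow> y \<in> X \<Longrightarrow> f x \<noteq> f y \<Longrightarrow>
       K x y = \<Lambda> * G x y * (if \<beta> x \<noteq> \<beta> y then 1 else 0)"
    using assms(2) unfolding query_link_def by auto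
  show ?thesis unfolding query_link_def
    by (intro exI conjI ballI impI, rule link_scale[OF assms(1) K(1), of "\<Lambda>' / \<Lambda>"])
       (use pos assms K(2) in auto)
qed

lemma adversary_mono:
  assumes "finite X" "adversary X f B \<Lambda>" "0 \<le> \<Lambda>'" "\<Lambda>' \<le> \<Lambda>"
  shows "adversary X f B \<Lambda>'"
  using assms query_link_mono[OF assms(1) _ assms(3,4)] unfolding adversary_def by blast

lemma query_link_not:
  "query_link X f G \<Lambda> \<beta> \<Longrightarrow> query_link X f G \<Lambda> (\<lambda>x. \<not> \<beta> x)"
  unfolding query_link_def by auto

lemma query_link_const:
  "finite X \<Longrightarrow> query_link X f G \<Lambda> (\<lambda>x. c)"
  unfolding query_link_def by (intro exI[of _ "\<lambda>x y. if x = y then 1 else 0"]) (auto simp: link_delta)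

lemma query_link_cong:
  "query_link X f G \<Lambda> \<beta> \<Longrightarrow> (\<And>x. x \<in> X \<Longrightarrow> \<beta> x = \<beta>' x) \<Longrightarrow> query_link X f G \<Lambda> \<beta>'"
  unfolding query_link_def by auto

lemma link_not: "link X (\<lambda>x. \<not> f x) G = link X f G"
  by (auto simp: link_def)

lemma adversary_not:
  assumes "adversary X f B \<Lambda>"
  shows "adversary X (\<lambda>x. \<not> f x) B \<Lambda>"
proof -
  obtain G w where G: "link X f G" "aligned X f G w" "\<forall>\<beta>\<in>B. query_link X f G \<Lambda> \<beta>"
    using assms unfolding adversary_def by blast
  have "(\<Sum>x | x \<in> X \<and> \<not> \<not> f x. \<Sum>y | y \<in> X \<and> \<not> f y. w x * w y * G x y)
      = (\<Sum>y | y \<in> X \<and> \<not> f y. \<Sum>x | x \<in> X \<and> f x. w y * w x * G y x)"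
    by (subst sum.swap)
       (auto intro!: sum.cong simp: gram_sym[OF link_gram[OF G(1)]] mult_ac)
  moreover have "{x \<in> X. (\<not> f x) = b} = {x \<in> X. f x = (\<not> b)}" for b by auto
  ultimately have "aligned X (\<lambda>x. \<not> f x) G w"
    using G(2) unfolding aligned_def by simp
  moreover have "query_link X (\<lambda>x. \<not> f x) G \<Lambda> \<beta>" if "\<beta> \<in> B" for \<beta>
    using G(3) that unfolding query_link_def by (simp add: link_not)
  ultimately show ?thesis
    using G(1) unfolding adversary_def by (auto simp: link_not)
qed

lemma adversary_nonconstant:
  assumes "adversary X f B \<Lambda>"
  shows "\<exists>x\<in>X. f x = b"
proof -
  obtain w where "(\<Sum>x | x \<in> X \<and> f x = b. (w x)\<^sup>2) = (1::real)"
    using assms unfolding adversary_def aligned_def by blast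
  then have "{x \<in> X. f x = b} \<noteq> {}" by (metis sum.empty zero_neq_one)
  then show ?thesis by auto
qed

text \<open>Hardness of a subproblem passes to any total function containing it:
  \<open>\<phi>\<close> embeds the hard inputs, the weights vanish elsewhere, and on the hard inputs
  every variable is constant or one of the known queries, up to negation. Conjunction, cheat sheet
  and XOR search are all treated on a convenient domain and then embedded.\<close>

lemma adversary_embed:
  fixes \<phi> :: "'a \<Rightarrow> 'b"
  assumes adv: "adversary X f B \<Lambda>" and fin: "finite X" "finite Y"
    and \<phi>: "inj_on \<phi> X" "\<And>x. x \<in> X \<Longrightarrow> \<phi> x \<in> Y" "\<And>x. x \<in> X \<Longrightarrow> f' (\<phi> x) = f x"
    and bits: "\<And>\<gamma>. \<gamma> \<in> C \<Longrightarrow> (\<exists>c. \<forall>x\<in>X. \<gamma> (\<phi> x) = c) \<or>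
        (\<exists>\<beta>\<in>B. (\<forall>x\<in>X. \<gamma> (\<phi> x) = \<beta> x) \<or> (\<forall>x\<in>X. \<gamma> (\<phi> x) = (\<not> \<beta> x)))"
  shows "adversary Y f' C \<Lambda>"
proof -
  obtain G w where G: "link X f G" "aligned X f G w"
    and GB: "\<And>\<beta>. \<beta> \<in> B \<Longrightarrow> query_link X f G \<Lambda> \<beta>"
    using adv unfolding adversary_def by blast
  define \<psi> where "\<psi> = the_inv_into X \<phi>"
  have \<psi>: "\<psi> (\<phi> x) = x" if "x \<in> X" for x
    unfolding \<psi>_def by (rule the_inv_into_f_f[OF \<phi>(1) that])
  define Z where "Z = \<phi> ` X"
  have \<psi>Z: "\<psi> z \<in> X" "\<phi> (\<psi> z) = z" if "z \<in> Z" for z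
    using that \<psi> unfolding Z_def by auto
  \<comment> \<open>Points outside the image get private unit vectors, orthogonal to everything
    else: the kernel stays a link and its cross block gains only zeros.\<close>
  define E where "E H = (\<lambda>x y. (if x \<in> Z \<and> y \<in> Z then H (\<psi> x) (\<psi> y) else 0)
      + (if x \<in> Y - Z \<and> y \<in> Y - Z then if x = y then 1 else 0 else 0))"
    for H :: "'a \<Rightarrow> 'a \<Rightarrow> real"
  have EH: "E H (\<phi> x) (\<phi> y) = H x y" if "x \<in> X" "y \<in> X" for H x y
    using that \<psi> by (auto simp: E_def Z_def)
  have linkE: "link Y f' (E H)" if H: "link X f H" for H
    unfolding link_def
  proof (intro conjI ballI impI)
    show "gram Y (E H)" unfolding E_def
      using link_gram[OF H] \<psi>Z fin
      by (intro gram_add gram_ext_zero gram_comp[of X H Z \<psi>] gram_delta) auto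
    fix x y assume xy: "x \<in> Y" "y \<in> Y" "f' x = f' y"
    show "E H x y = (if x = y then 1 else 0)"
    proof (cases "x \<in> Z \<and> y \<in> Z")
      case True
      then have "f (\<psi> x) = f (\<psi> y)" using xy(3) \<psi>Z \<phi>(3) by metis
      then have "H (\<psi> x) (\<psi> y) = (if \<psi> x = \<psi> y then 1 else 0)"
        using link_same[OF H] \<psi>Z True by auto
      moreover have "\<psi> x = \<psi> y \<longleftrightarrow> x = y" using \<psi>Z True by metis
      ultimately show ?thesis using True by (auto simp: E_def)
    qed (use xy in \<open>auto simp: E_def\<close>)
  qed
  have off: "E H x y = 0" if "x \<in> Y" "y \<in> Y" "f' x \<noteq> f' y" "x \<notin> Z \<or> y \<notin> Z" for H x y
    using that by (auto simp: E_def)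
  define w' where "w' = (\<lambda>y. if y \<in> Z then w (\<psi> y) else 0)"
  have w': "w' (\<phi> x) = w x" if "x \<in> X" for x
    using that \<psi> by (auto simp: w'_def Z_def)
  have sub: "\<phi> ` {x \<in> X. f x = b} \<subseteq> {y \<in> Y. f' y = b}" for b
    using \<phi> by auto
  have inj: "inj_on \<phi> {x \<in> X. f x = b}" for b
    using \<phi>(1) by (rule inj_on_subset) auto
  have transfer: "(\<Sum>y | y \<in> Y \<and> f' y = b. h y) = (\<Sum>x | x \<in> X \<and> f x = b. h (\<phi> x))"
    if "\<And>y. y \<in> Y - Z \<Longrightarrow> h y = 0" for h :: "'b \<Rightarrow> real" and b
  proof -
    have "(\<Sum>y | y \<in> Y \<and> f' y = b. h y) = (\<Sum>y\<in>\<phi> ` {x \<in> X. f x = b}. h y)"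
    proof (rule sum.mono_neutral_right)
      show "\<forall>i\<in>{y \<in> Y. f' y = b} - \<phi> ` {x \<in> X. f x = b}. h i = 0"
      proof
        fix y assume y: "y \<in> {y \<in> Y. f' y = b} - \<phi> ` {x \<in> X. f x = b}"
        then have "y \<notin> Z" using \<phi>(3) unfolding Z_def by auto
        then show "h y = 0" using y that by auto
      qed
    qed (use sub fin in auto)
    also have "\<dots> = (\<Sum>x | x \<in> X \<and> f x = b. h (\<phi> x))"
      by (simp add: sum.reindex[OF inj])
    finally show ?thesis .
  qed
  have al: "aligned Y f' (E G) w'"
    unfolding aligned_def
  proof (intro conjI allI)
    fix b
    have "(\<Sum>y | y \<in> Y \<and> f' y = b. (w' y)\<^sup>2) = (\<Sum>x | x \<in> X \<and> f x = b. (w' (\<phi> x))\<^sup>2)"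
      by (rule transfer) (simp add: w'_def)
    also have "\<dots> = (\<Sum>x | x \<in> X \<and> f x = b. (w x)\<^sup>2)"
      by (rule sum.cong) (auto simp: w')
    finally show "(\<Sum>y | y \<in> Y \<and> f' y = b. (w' y)\<^sup>2) = 1"
      using G(2) unfolding aligned_def by simp
    have "(\<Sum>x | x \<in> Y \<and> f' x = False. \<Sum>y | y \<in> Y \<and> f' y = True. w' x * w' y * E G x y)
        = (\<Sum>x | x \<in> X \<and> f x = False. \<Sum>y | y \<in> Y \<and> f' y = True. w' (\<phi> x) * w' y * E G (\<phi> x) y)"
      by (rule transfer) (simp add: w'_def)
    also have "\<dots> = (\<Sum>x | x \<in> X \<and> f x = False. \<Sum>y | y \<in> X \<and> f y = True.
        w' (\<phi> x) * w' (\<phi> y) * E G (\<phi> x) (\<phi> y))"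
      by (intro sum.cong refl transfer) (simp add: w'_def)
    also have "\<dots> = (\<Sum>x | x \<in> X \<and> f x = False. \<Sum>y | y \<in> X \<and> f y = True. w x * w y * G x y)"
      by (intro sum.cong refl) (auto simp: w' EH)
    finally show "(\<Sum>x | x \<in> Y \<and> \<not> f' x. \<Sum>y | y \<in> Y \<and> f' y. w' x * w' y * E G x y) = 1"
      using G(2) unfolding aligned_def by simp
  qed
  have "query_link Y f' (E G) \<Lambda> \<gamma>" if \<gamma>: "\<gamma> \<in> C" for \<gamma>
  proof -
    have "query_link X f G \<Lambda> (\<lambda>x. \<gamma> (\<phi> x))"
    proof (cases "\<exists>c. \<forall>x\<in>X. \<gamma> (\<phi> x) = c")
      case True
      then obtain c where "\<forall>x\<in>X. \<gamma> (\<phi> x) = c" by blast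
      then show ?thesis
        by (intro query_link_cong[OF query_link_const[OF fin(1), of f G \<Lambda> c]]) auto
    next
      case False
      then obtain \<beta> where \<beta>: "\<beta> \<in> B"
        "(\<forall>x\<in>X. \<gamma> (\<phi> x) = \<beta> x) \<or> (\<forall>x\<in>X. \<gamma> (\<phi> x) = (\<not> \<beta> x))"
        using bits[OF \<gamma>] by blast
      from \<beta>(2) show ?thesis
      proof
        assume "\<forall>x\<in>X. \<gamma> (\<phi> x) = \<beta> x"
        then show ?thesis using query_link_cong[OF GB[OF \<beta>(1)]] by simp
      next
        assume "\<forall>x\<in>X. \<gamma> (\<phi> x) = (\<not> \<beta> x)"
        then show ?thesis using query_link_cong[OF query_link_not[OF GB[OF \<beta>(1)]]] by simp
      qed
    qed
    then obtain K where K: "link X f K" "\<And>x y. x \<in> X \<Longrightarrow> y \<in> X \<Longrightarrow> f x \<noteq> f y \<Longrightarrow>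
        K x y = \<Lambda> * G x y * (if \<gamma> (\<phi> x) \<noteq> \<gamma> (\<phi> y) then 1 else 0)"
      unfolding query_link_def by auto
    show ?thesis unfolding query_link_def
    proof (intro exI[of _ "E K"] conjI ballI impI)
      show "link Y f' (E K)" by (rule linkE[OF K(1)])
      fix x y assume xy: "x \<in> Y" "y \<in> Y" "f' x \<noteq> f' y"
      show "E K x y = \<Lambda> * E G x y * (if \<gamma> x \<noteq> \<gamma> y then 1 else 0)"
      proof (cases "x \<in> Z \<and> y \<in> Z")
        case True
        then obtain u v where "u \<in> X" "v \<in> X" "x = \<phi> u" "y = \<phi> v" unfolding Z_def by auto
        then show ?thesis using K(2)[of u v] xy(3) \<phi>(3) by (simp add: EH)
      next
        case False
        then show ?thesis using off[OF xy] by auto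
      qed
    qed
  qed
  then show ?thesis unfolding adversary_def using linkE[OF G(1)] al by blast
qed

subsection \<open>Quantum query algorithms and the adversary bound\<close>

text \<open>AM-GM with a free weight. Choosing the weight well matters per measurement outcome in
  \<open>adversary_lower_bound\<close>, and to balance two error terms in
  \<open>letter_bound\<close>.\<close>

lemma young: "(\<rho>::real) > 0 \<Longrightarrow> \<bar>u * v\<bar> \<le> (\<rho> * u\<^sup>2 + v\<^sup>2 / \<rho>) / 2"
proof -
  assume \<rho>: "\<rho> > 0"
  have "0 \<le> (\<rho> * \<bar>u\<bar> - \<bar>v\<bar>)\<^sup>2 / \<rho>" using \<rho> by simp
  also have "\<dots> = \<rho> * u\<^sup>2 + v\<^sup>2 / \<rho> - 2 * \<bar>u * v\<bar>"
    using \<rho> by (simp add: power2_eq_square field_simps abs_mult)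
  finally show ?thesis by simp
qed

lemma sum_rotate:
  "(\<Sum>x\<in>A. \<Sum>y\<in>B. \<Sum>t\<in>C. g x y t) = (\<Sum>t\<in>C. \<Sum>x\<in>A. \<Sum>y\<in>B. g x y t)"
proof -
  have "(\<Sum>x\<in>A. \<Sum>y\<in>B. \<Sum>t\<in>C. g x y t) = (\<Sum>x\<in>A. \<Sum>t\<in>C. \<Sum>y\<in>B. g x y t)"
    by (rule sum.cong[OF refl], rule sum.swap)
  also have "\<dots> = (\<Sum>t\<in>C. \<Sum>x\<in>A. \<Sum>y\<in>B. g x y t)" by (rule sum.swap)
  finally show ?thesis .
qed

text \<open>The two orthonormal families of a link turn \<open>\<alpha>\<close> and
  \<open>\<beta>\<close> into vectors \<open>A False \<alpha>\<close> and
  \<open>A True \<beta>\<close> of the same norms; the form is their inner product, estimated by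
  \<open>young\<close>.\<close>

lemma link_bound_real:
  assumes L: "link X f G" and fin: "finite X" and s: "s > 0"
  shows "\<bar>\<Sum>x | x \<in> X \<and> \<not> f x. \<Sum>y | y \<in> X \<and> f y. G x y * (\<alpha> x * \<beta> y)\<bar>
    \<le> (s * (\<Sum>x | x \<in> X \<and> \<not> f x. (\<alpha> x)\<^sup>2) + (\<Sum>y | y \<in> X \<and> f y. (\<beta> y)\<^sup>2) / s) / 2"
proof -
  obtain d :: nat and b where b: "\<And>x y. x \<in> X \<Longrightarrow> y \<in> X \<Longrightarrow> G x y = (\<Sum>t<d. b t x * b t y)"
    using L unfolding link_def gram_def by blast
  define A where "A c \<gamma> t = (\<Sum>x | x \<in> X \<and> f x = c. b t x * \<gamma> x)" for c \<gamma> t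
  have norm: "(\<Sum>t<d. (A c \<gamma> t)\<^sup>2) = (\<Sum>x | x \<in> X \<and> f x = c. (\<gamma> x)\<^sup>2)" for c \<gamma>
  proof -
    let ?Y = "{x \<in> X. f x = c}"
    have "(\<Sum>t<d. (A c \<gamma> t)\<^sup>2) = (\<Sum>t<d. \<Sum>x\<in>?Y. \<Sum>y\<in>?Y. (b t x * \<gamma> x) * (b t y * \<gamma> y))"
      by (simp add: A_def power2_eq_square sum_product)
    also have "\<dots> = (\<Sum>x\<in>?Y. \<Sum>y\<in>?Y. \<Sum>t<d. (b t x * \<gamma> x) * (b t y * \<gamma> y))"
      by (rule sum_rotate[symmetric])
    also have "\<dots> = (\<Sum>x\<in>?Y. \<Sum>y\<in>?Y. G x y * (\<gamma> x * \<gamma> y))"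
      by (intro sum.cong refl) (simp add: b sum_distrib_left sum_distrib_right mult_ac)
    also have "\<dots> = (\<Sum>x\<in>?Y. \<Sum>y\<in>?Y. if x = y then \<gamma> x * \<gamma> y else 0)"
      by (intro sum.cong refl) (simp add: link_same[OF L])
    also have "\<dots> = (\<Sum>x\<in>?Y. (\<gamma> x)\<^sup>2)"
      using fin by (intro sum.cong refl) (simp add: power2_eq_square)
    finally show ?thesis .
  qed
  have "(\<Sum>x | x \<in> X \<and> \<not> f x. \<Sum>y | y \<in> X \<and> f y. G x y * (\<alpha> x * \<beta> y))
     = (\<Sum>x | x \<in> X \<and> \<not> f x. \<Sum>y | y \<in> X \<and> f y. \<Sum>t<d. (b t x * \<alpha> x) * (b t y * \<beta> y))"
    by (intro sum.cong refl) (simp add: b sum_distrib_left sum_distrib_right mult_ac)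
  also have "\<dots> = (\<Sum>t<d. \<Sum>x | x \<in> X \<and> \<not> f x. \<Sum>y | y \<in> X \<and> f y. (b t x * \<alpha> x) * (b t y * \<beta> y))"
    by (rule sum_rotate)
  also have "\<dots> = (\<Sum>t<d. A False \<alpha> t * A True \<beta> t)"
    by (simp add: A_def sum_product)
  finally have eq: "(\<Sum>x | x \<in> X \<and> \<not> f x. \<Sum>y | y \<in> X \<and> f y. G x y * (\<alpha> x * \<beta> y)) = \<dots>" .
  have "\<bar>\<Sum>t<d. A False \<alpha> t * A True \<beta> t\<bar> \<le> (\<Sum>t<d. (s * (A False \<alpha> t)\<^sup>2 + (A True \<beta> t)\<^sup>2 / s) / 2)"
    by (rule order_trans[OF sum_abs sum_mono]) (rule young[OF s])
  also have "\<dots> = (s * (\<Sum>t<d. (A False \<alpha> t)\<^sup>2) + (\<Sum>t<d. (A True \<beta> t)\<^sup>2) / s) / 2"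
    by (simp add: sum.distrib sum_distrib_left sum_divide_distrib[symmetric])
  finally show ?thesis using eq norm[of False \<alpha>] norm[of True \<beta>] by simp
qed

lemma link_bound:
  fixes a :: "'a \<Rightarrow> complex"
  assumes L: "link X f G" and fin: "finite X" and s: "s > 0"
  shows "\<bar>\<Sum>x | x \<in> X \<and> \<not> f x. \<Sum>y | y \<in> X \<and> f y. G x y * Re (cnj (a x) * b y)\<bar>
    \<le> (s * (\<Sum>x | x \<in> X \<and> \<not> f x. (cmod (a x))\<^sup>2) + (\<Sum>y | y \<in> X \<and> f y. (cmod (b y))\<^sup>2) / s) / 2"
proof -
  have eq: "(\<Sum>x | x \<in> X \<and> \<not> f x. \<Sum>y | y \<in> X \<and> f y. G x y * Re (cnj (a x) * b y))
    = (\<Sum>x | x \<in> X \<and> \<not> f x. \<Sum>y | y \<in> X \<and> f y. G x y * (Re (a x) * Re (b y)))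
    + (\<Sum>x | x \<in> X \<and> \<not> f x. \<Sum>y | y \<in> X \<and> f y. G x y * (Im (a x) * Im (b y)))"
    by (simp add: sum.distrib distrib_left)
  have gen: "\<bar>p + q\<bar> \<le> (s * (a1 + a2) + (b1 + b2) / s) / 2"
    if "\<bar>p\<bar> \<le> (s * a1 + b1 / s) / 2" "\<bar>q\<bar> \<le> (s * a2 + b2 / s) / 2" for p q a1 a2 b1 b2 :: real
    using that unfolding distrib_left add_divide_distrib by linarith
  show ?thesis
    unfolding eq cmod_power2 sum.distrib
    by (rule gen; rule link_bound_real[OF assms])
qed

section \<open>The oracle and the inner products of query states\<close>

lemma oracle_map_div: "oracle_map N m x j div (2 * m) = j div (2 * m)"
proof -
  have "(j + 1) div 2 = j div 2" if "even j" using that by simp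
  moreover have "(j - 1) div 2 = j div 2" if "odd j" using that by (auto elim: oddE)
  ultimately show ?thesis
    unfolding oracle_map_def Let_def by (auto simp: div_mult2_eq simp del: One_nat_def)
qed

lemma oracle_map_invol: "oracle_map N m x (oracle_map N m x j) = j"
proof (cases "j div (2 * m) < N \<and> x ! (j div (2 * m))")
  case True
  then have "oracle_map N m x j = (if even j then j + 1 else j - 1)"
    by (simp add: oracle_map_def Let_def)
  moreover from this have "oracle_map N m x (oracle_map N m x j)
      = (if even (oracle_map N m x j) then oracle_map N m x j + 1 else oracle_map N m x j - 1)"
    using True oracle_map_div[of N m x j] by (simp add: oracle_map_def Let_def)
  ultimately show ?thesis by (auto elim: oddE)
next
  case False
  then have "oracle_map N m x j = j" by (auto simp: oracle_map_def Let_def)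
  then show ?thesis by simp
qed

lemma qdim_div: "m > 0 \<Longrightarrow> j < qdim N m \<longleftrightarrow> j div (2 * m) < N + 1"
  by (simp add: qdim_def div_less_iff_less_mult mult_ac)

lemma oracle_map_lt: "m > 0 \<Longrightarrow> oracle_map N m x j < qdim N m \<longleftrightarrow> j < qdim N m"
  by (simp add: qdim_div oracle_map_div)

lemma oracle_map_bij:
  assumes "\<And>j. oracle_map N m x j \<in> B \<longleftrightarrow> j \<in> B"
  shows "bij_betw (oracle_map N m x) B B"
  by (rule bij_betw_byWitness[where f' = "oracle_map N m x"])
     (use assms in \<open>auto simp: oracle_map_invol\<close>)

lemma oracle_map_cong:
  "x ! (j div (2 * m)) = y ! (j div (2 * m)) \<or> \<not> j div (2 * m) < N
    \<Longrightarrow> oracle_map N m x j = oracle_map N m y j"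
  by (auto simp: oracle_map_def Let_def)

lemma oracle_mat_apply:
  assumes "m > 0" "u \<in> carrier_vec (qdim N m)" "r < qdim N m"
  shows "(oracle_mat N m x *\<^sub>v u) $ r = u $ oracle_map N m x r"
proof -
  have "(oracle_mat N m x *\<^sub>v u) $ r
      = (\<Sum>c<qdim N m. (if r = oracle_map N m x c then 1 else 0) * u $ c)"
    using assms(2,3) by (simp add: oracle_mat_def scalar_prod_def atLeast0LessThan)
  also have "\<dots> = (\<Sum>c<qdim N m. if c = oracle_map N m x r then u $ c else 0)"
    by (intro sum.cong refl) (auto simp: oracle_map_invol)
  also have "\<dots> = u $ oracle_map N m x r"
    using assms by (simp add: oracle_map_lt)
  finally show ?thesis .
qed

lemma unitary_columns:
  assumes "unitary d V" "k < d" "l < d"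
  shows "(\<Sum>j<d. cnj (V $$ (j, k)) * V $$ (j, l)) = (if k = l then 1 else 0)"
proof -
  have V: "V \<in> carrier_mat d d" "mat_adjoint V * V = 1\<^sub>m d" using assms(1) by (auto simp: unitary_def)
  have "(mat_adjoint V * V) $$ (k, l) = (\<Sum>j<d. cnj (V $$ (j, k)) * V $$ (j, l))"
    using V(1) assms(2,3)
    by (simp add: mat_adjoint_def scalar_prod_def atLeast0LessThan mat_of_rows_def)
  then show ?thesis using V(2) assms(2,3) by simp
qed

lemma unitary_inner:
  assumes "unitary d V" "u \<in> carrier_vec d" "v \<in> carrier_vec d"
  shows "(\<Sum>j<d. cnj ((V *\<^sub>v u) $ j) * (V *\<^sub>v v) $ j) = (\<Sum>j<d. cnj (u $ j) * v $ j)"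
proof -
  have V: "V \<in> carrier_mat d d" using assms(1) by (auto simp: unitary_def)
  have app: "(V *\<^sub>v w) $ j = (\<Sum>k<d. V $$ (j, k) * w $ k)" if "w \<in> carrier_vec d" "j < d" for w j
    using V that by (auto simp: scalar_prod_def atLeast0LessThan intro!: sum.cong)
  have "(\<Sum>j<d. cnj ((V *\<^sub>v u) $ j) * (V *\<^sub>v v) $ j)
      = (\<Sum>j<d. \<Sum>k<d. \<Sum>l<d. (cnj (V $$ (j, k)) * V $$ (j, l)) * (cnj (u $ k) * v $ l))"
  proof (intro sum.cong refl)
    fix j assume "j \<in> {..<d}"
    then have "cnj ((V *\<^sub>v u) $ j) * (V *\<^sub>v v) $ j
        = (\<Sum>k<d. \<Sum>l<d. cnj (V $$ (j, k) * u $ k) * (V $$ (j, l) * v $ l))"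
      by (simp only: lessThan_iff app assms cnj_sum sum_product)
    also have "\<dots> = (\<Sum>k<d. \<Sum>l<d. (cnj (V $$ (j, k)) * V $$ (j, l)) * (cnj (u $ k) * v $ l))"
      by (intro sum.cong refl) (simp add: mult_ac)
    finally show "cnj ((V *\<^sub>v u) $ j) * (V *\<^sub>v v) $ j
        = (\<Sum>k<d. \<Sum>l<d. (cnj (V $$ (j, k)) * V $$ (j, l)) * (cnj (u $ k) * v $ l))" .
  qed
  also have "\<dots> = (\<Sum>k<d. \<Sum>l<d. \<Sum>j<d. (cnj (V $$ (j, k)) * V $$ (j, l)) * (cnj (u $ k) * v $ l))"
    by (rule sum_rotate[symmetric])
  also have "\<dots> = (\<Sum>k<d. \<Sum>l<d. (if k = l then 1 else 0) * (cnj (u $ k) * v $ l))"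
    by (intro sum.cong refl) (simp add: sum_distrib_right[symmetric] unitary_columns[OF assms(1)])
  also have "\<dots> = (\<Sum>k<d. \<Sum>l<d. if k = l then cnj (u $ k) * v $ l else 0)"
    by (intro sum.cong refl) simp
  also have "\<dots> = (\<Sum>j<d. cnj (u $ j) * v $ j)"
    by (intro sum.cong refl) simp
  finally show ?thesis .
qed

lemma query_state_carrier:
  assumes "\<forall>t\<le>T. unitary (qdim N m) (V t)" "t \<le> T"
  shows "query_state N m V x t \<in> carrier_vec (qdim N m)"
  using assms(2)
proof (induction t)
  case 0
  then show ?case using assms(1) by (auto simp: unitary_def intro!: mult_mat_vec_carrier)
next
  case (Suc t)
  have "V (Suc t) \<in> carrier_mat (qdim N m) (qdim N m)" using assms(1) Suc.prems by (auto simp: unitary_def)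
  moreover have "oracle_mat N m x \<in> carrier_mat (qdim N m) (qdim N m)" by (simp add: oracle_mat_def)
  ultimately show ?case using Suc by (auto intro!: mult_mat_vec_carrier)
qed

lemma query_state_inner_0:
  assumes "unitary (qdim N m) (V 0)" "m > 0"
  shows "(\<Sum>j<qdim N m. cnj (query_state N m V x 0 $ j) * query_state N m V y 0 $ j) = 1"
proof -
  have "qdim N m > 0" using assms(2) by (simp add: qdim_def)
  then have "(\<Sum>j<qdim N m. cnj (unit_vec (qdim N m) 0 $ j) * unit_vec (qdim N m) 0 $ j)
     = (\<Sum>j<qdim N m. if j = 0 then 1 else (0::complex))"
    by (intro sum.cong refl) (auto simp: unit_vec_def)
  then show ?thesis using unitary_inner[OF assms(1)] \<open>qdim N m > 0\<close> by simp
qed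

lemma query_state_inner_Suc:
  assumes "\<forall>t\<le>T. unitary (qdim N m) (V t)" "Suc t \<le> T" "m > 0"
  shows "(\<Sum>j<qdim N m. cnj (query_state N m V x (Suc t) $ j) * query_state N m V y (Suc t) $ j)
    = (\<Sum>j<qdim N m. cnj (query_state N m V x t $ oracle_map N m x j)
         * query_state N m V y t $ oracle_map N m y j)"
proof -
  have c: "oracle_mat N m z *\<^sub>v query_state N m V z t \<in> carrier_vec (qdim N m)" for z
    using query_state_carrier[OF assms(1), of t] assms(2)
    by (intro mult_mat_vec_carrier) (auto simp: oracle_mat_def)
  have "unitary (qdim N m) (V (Suc t))" using assms by auto
  from unitary_inner[OF this c c] show ?thesis
    using oracle_mat_apply[OF assms(3) query_state_carrier[OF assms(1)]] assms(2)
    by simp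
qed

lemma query_state_norm:
  assumes "\<forall>t\<le>T. unitary (qdim N m) (V t)" "t \<le> T" "m > 0"
  shows "(\<Sum>j<qdim N m. (cmod (query_state N m V x t $ j))\<^sup>2) = 1"
proof -
  have conv: "(\<Sum>j<d. cnj (u j) * u j) = complex_of_real (\<Sum>j<d. (cmod (u j))\<^sup>2)" for d :: nat and u
    unfolding of_real_sum complex_norm_square by (simp add: mult.commute)
  have "(\<Sum>j<qdim N m. cnj (query_state N m V x t $ j) * query_state N m V x t $ j) = 1"
    using assms(2)
  proof (induction t)
    case 0
    then show ?case using query_state_inner_0 assms(1,3) by blast
  next
    case (Suc t)
    have "(\<Sum>j<qdim N m. cnj (query_state N m V x t $ oracle_map N m x j)
           * query_state N m V x t $ oracle_map N m x j)
      = (\<Sum>j<qdim N m. cnj (query_state N m V x t $ j) * query_state N m V x t $ j)"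
      using oracle_map_lt[OF assms(3)]
      by (intro sum.reindex_bij_betw oracle_map_bij) auto
    then show ?case using query_state_inner_Suc[OF assms(1) Suc.prems assms(3)] Suc by simp
  qed
  then show ?thesis unfolding conv using of_real_eq_1_iff by blast
qed

text \<open>On basis states whose queried bit is the same in \<open>x\<close> and \<open>y\<close>,
  both oracles act as one and the same permutation, so these terms cancel; only queries that
  distinguish \<open>x\<close> from \<open>y\<close> can change an inner product.\<close>

lemma oracle_inner_diff:
  assumes m: "m > 0" and h: "\<And>j. h j = h' j j"
  shows "(\<Sum>j<qdim N m. h j) - (\<Sum>j<qdim N m. (h' (oracle_map N m x j) (oracle_map N m y j) :: real))
    = (\<Sum>j | j < 2 * m * N \<and> x ! (j div (2 * m)) \<noteq> y ! (j div (2 * m)).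
         h j - h' (oracle_map N m x j) (oracle_map N m y j))"
proof -
  define E where "E = {j. j < qdim N m \<and> (x ! (j div (2 * m)) = y ! (j div (2 * m)) \<or> \<not> j div (2 * m) < N)}"
  define D where "D = {j. j < 2 * m * N \<and> x ! (j div (2 * m)) \<noteq> y ! (j div (2 * m))}"
  have lt: "j div (2 * m) < N \<longleftrightarrow> j < 2 * m * N" for j
    using m by (simp add: div_less_iff_less_mult mult_ac)
  have split: "{..<qdim N m} = E \<union> D" "E \<inter> D = {}" "finite E" "finite D"
    unfolding E_def D_def lt by (auto simp: qdim_def)
  have "(\<Sum>j\<in>E. h' (oracle_map N m x j) (oracle_map N m y j))
      = (\<Sum>j\<in>E. h (oracle_map N m x j))"
    using oracle_map_cong[of x _ m y N] by (intro sum.cong refl) (auto simp: E_def h)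
  also have "\<dots> = (\<Sum>j\<in>E. h j)"
    using oracle_map_lt[OF m]
    by (intro sum.reindex_bij_betw oracle_map_bij) (simp add: E_def oracle_map_div)
  finally show ?thesis
    unfolding D_def[symmetric] using split by (simp add: sum.union_disjoint sum_subtractf)
qed

text \<open>The three components of \<open>adversary\<close> have separate tasks:
  \<open>aligned\<close> fixes the initial progress, the query links bound the loss per query, and
  the link \<open>G\<close> itself controls the final measurement. The constant comes from
  \<open>\<Lambda> / 18 \<le> 2 * T\<close>.\<close>

theorem adversary_lower_bound:
  assumes adv: "adversary (inputs N) f (input_bits N) \<Lambda>" and \<Lambda>: "0 \<le> \<Lambda>"
    and qc: "quantum_computable N f T"
  shows "\<Lambda> \<le> 36 * real T"
proof -
  obtain G w where L: "link (inputs N) f G" and al: "aligned (inputs N) f G w"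
    and Q: "\<And>\<beta>. \<beta> \<in> input_bits N \<Longrightarrow> query_link (inputs N) f G \<Lambda> \<beta>"
    using adv unfolding adversary_def by blast
  obtain m V A where m: "m > 0" and V: "\<forall>t\<le>T. unitary (qdim N m) (V t)"
    and out: "\<And>x. x \<in> inputs N \<Longrightarrow> output_prob N m V A T x (f x) \<ge> 2 / 3"
    using qc unfolding quantum_computable_def by blast
  define X where "X b = {x \<in> inputs N. f x = b}" for b
  have fX: "finite (X b)" for b by (simp add: X_def)
  have XF: "{x \<in> inputs N. \<not> f x} = X False" and XT: "{x \<in> inputs N. f x} = X True"
    by (auto simp: X_def)
  define d where "d = qdim N m"
  define \<psi> where "\<psi> t x j = complex_of_real (w x) * (query_state N m V x t $ j)" for t x j
  have w1: "(\<Sum>x\<in>X b. (w x)\<^sup>2) = 1" for b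
    using al unfolding aligned_def X_def by blast
  have wG: "(\<Sum>x\<in>X False. \<Sum>y\<in>X True. w x * w y * G x y) = 1"
    using al unfolding aligned_def XF XT by blast
  have cm: "(cmod (\<psi> t x j))\<^sup>2 = (w x)\<^sup>2 * (cmod (query_state N m V x t $ j))\<^sup>2" for t x j
    by (simp add: \<psi>_def norm_mult power_mult_distrib)
  have \<psi>1: "(\<Sum>j<d. \<Sum>x\<in>X b. (cmod (\<psi> t x j))\<^sup>2) = 1" if "t \<le> T" for b t
  proof -
    have "(\<Sum>j<d. \<Sum>x\<in>X b. (cmod (\<psi> t x j))\<^sup>2) = (\<Sum>x\<in>X b. (w x)\<^sup>2 * (\<Sum>j<d. (cmod (query_state N m V x t $ j))\<^sup>2))"
      by (subst sum.swap) (simp add: cm sum_distrib_left)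
    also have "\<dots> = 1" using query_state_norm[OF V that m] by (simp add: d_def w1)
    finally show ?thesis .
  qed
  have \<psi>1': "(\<Sum>j<d. \<Sum>x\<in>X b. (cmod (\<psi> t x (oracle_map N m x j)))\<^sup>2) = 1" if "t \<le> T" for b t
  proof -
    have "(\<Sum>j<d. (cmod (\<psi> t x (oracle_map N m x j)))\<^sup>2) = (\<Sum>j<d. (cmod (\<psi> t x j))\<^sup>2)" for x
      using oracle_map_lt[OF m]
      by (intro sum.reindex_bij_betw[of _ "{..<d}" "{..<d}" "\<lambda>j. (cmod (\<psi> t x j))\<^sup>2"] oracle_map_bij)
         (auto simp: d_def)
    then show ?thesis using \<psi>1[OF that, of b] by (subst sum.swap, subst (asm) sum.swap) simp
  qed
  have bound: "\<bar>\<Sum>x\<in>X False. \<Sum>y\<in>X True. K x y * Re (cnj (a x) * b y)\<bar>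
    \<le> (s * (\<Sum>x\<in>X False. (cmod (a x))\<^sup>2) + (\<Sum>y\<in>X True. (cmod (b y))\<^sup>2) / s) / 2"
    if "link (inputs N) f K" "s > 0" for K a b s
    using link_bound[OF that(1) _ that(2), of a b] unfolding XF XT by simp
  \<comment> \<open>The progress function: it starts at \<open>\<Lambda>\<close>, drops by at most 2 per query, and must end below \<open>17 \<Lambda> / 18\<close>.\<close>
  define W where "W t = (\<Sum>x\<in>X False. \<Sum>y\<in>X True. \<Lambda> * G x y * (\<Sum>j<d. Re (cnj (\<psi> t x j) * \<psi> t y j)))" for t
  have W0: "W 0 = \<Lambda>"
  proof -
    have "(\<Sum>j<d. Re (cnj (\<psi> 0 x j) * \<psi> 0 y j)) = w x * w y" for x y
    proof -
      have "(\<Sum>j<d. cnj (\<psi> 0 x j) * \<psi> 0 y j) = complex_of_real (w x * w y) *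
          (\<Sum>j<d. cnj (query_state N m V x 0 $ j) * query_state N m V y 0 $ j)"
        by (simp add: \<psi>_def sum_distrib_left mult_ac)
      also have "\<dots> = complex_of_real (w x * w y)"
        using query_state_inner_0[of N m V x y] V m by (simp add: d_def)
      finally have "Re (\<Sum>j<d. cnj (\<psi> 0 x j) * \<psi> 0 y j) = w x * w y" by simp
      then show ?thesis by simp
    qed
    then have "W 0 = \<Lambda> * (\<Sum>x\<in>X False. \<Sum>y\<in>X True. w x * w y * G x y)"
      by (simp add: W_def sum_distrib_left mult_ac)
    then show ?thesis using wG by simp
  qed
  have step: "W t - W (Suc t) \<le> 2" if t: "Suc t \<le> T" for t
  proof -
    define J where "J = {..<2 * m * N}"
    define c where "c x y j = Re (cnj (\<psi> t x j) * \<psi> t y j)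
       - Re (cnj (\<psi> t x (oracle_map N m x j)) * \<psi> t y (oracle_map N m y j))" for x y j
    have Jd: "J \<subseteq> {..<d}" by (auto simp: J_def d_def qdim_def)
    have "\<exists>K. link (inputs N) f K \<and> (\<forall>x\<in>inputs N. \<forall>y\<in>inputs N. f x \<noteq> f y \<longrightarrow>
        K x y = \<Lambda> * G x y * (if x ! i \<noteq> y ! i then 1 else 0))" if "i < N" for i
      using Q[of "\<lambda>x. x ! i"] that unfolding query_link_def input_bits_def by auto
    then obtain K where K: "\<And>i. i < N \<Longrightarrow> link (inputs N) f (K i)"
      "\<And>i x y. i < N \<Longrightarrow> x \<in> inputs N \<Longrightarrow> y \<in> inputs N \<Longrightarrow> f x \<noteq> f y \<Longrightarrow>
         K i x y = \<Lambda> * G x y * (if x ! i \<noteq> y ! i then 1 else 0)"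
      by metis
    have Jlt: "j div (2 * m) < N" if "j \<in> J" for j
      using that m by (simp add: J_def div_less_iff_less_mult mult_ac)
    have ipSuc: "(\<Sum>j<d. Re (cnj (\<psi> (Suc t) x j) * \<psi> (Suc t) y j))
        = (\<Sum>j<d. Re (cnj (\<psi> t x (oracle_map N m x j)) * \<psi> t y (oracle_map N m y j)))" for x y
    proof -
      have "(\<Sum>j<d. cnj (\<psi> (Suc t) x j) * \<psi> (Suc t) y j) = complex_of_real (w x * w y) *
          (\<Sum>j<d. cnj (query_state N m V x (Suc t) $ j) * query_state N m V y (Suc t) $ j)"
        by (simp add: \<psi>_def sum_distrib_left mult_ac)
      also have "\<dots> = (\<Sum>j<d. cnj (\<psi> t x (oracle_map N m x j)) * \<psi> t y (oracle_map N m y j))"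
        unfolding d_def query_state_inner_Suc[OF V t m]
        by (simp add: \<psi>_def sum_distrib_left mult_ac)
      finally show ?thesis by (metis Re_sum)
    qed
    have diff: "(\<Sum>j<d. Re (cnj (\<psi> t x j) * \<psi> t y j))
          - (\<Sum>j<d. Re (cnj (\<psi> t x (oracle_map N m x j)) * \<psi> t y (oracle_map N m y j)))
        = (\<Sum>j\<in>J. if x ! (j div (2 * m)) \<noteq> y ! (j div (2 * m)) then c x y j else 0)" for x y
    proof -
      have "(\<Sum>j<d. Re (cnj (\<psi> t x j) * \<psi> t y j))
          - (\<Sum>j<d. Re (cnj (\<psi> t x (oracle_map N m x j)) * \<psi> t y (oracle_map N m y j)))
        = (\<Sum>j | j < 2 * m * N \<and> x ! (j div (2 * m)) \<noteq> y ! (j div (2 * m)). c x y j)"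
        unfolding c_def d_def
        by (rule oracle_inner_diff[OF m, where h' = "\<lambda>j k. Re (cnj (\<psi> t x j) * \<psi> t y k)"]) (rule refl)
      also have "\<dots> = (\<Sum>j | j \<in> J \<and> x ! (j div (2 * m)) \<noteq> y ! (j div (2 * m)). c x y j)"
        by (simp only: J_def lessThan_iff)
      also have "\<dots> = (\<Sum>j\<in>J. if x ! (j div (2 * m)) \<noteq> y ! (j div (2 * m)) then c x y j else 0)"
        by (rule sum.inter_filter) (simp add: J_def)
      finally show ?thesis .
    qed
    have "W t - W (Suc t) = (\<Sum>x\<in>X False. \<Sum>y\<in>X True. \<Lambda> * G x y *
        ((\<Sum>j<d. Re (cnj (\<psi> t x j) * \<psi> t y j))
          - (\<Sum>j<d. Re (cnj (\<psi> t x (oracle_map N m x j)) * \<psi> t y (oracle_map N m y j)))))"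
      by (simp only: W_def ipSuc sum_subtractf right_diff_distrib)
    also have "\<dots> = (\<Sum>x\<in>X False. \<Sum>y\<in>X True. \<Lambda> * G x y *
        (\<Sum>j\<in>J. if x ! (j div (2 * m)) \<noteq> y ! (j div (2 * m)) then c x y j else 0))"
      by (simp only: diff)
    also have "\<dots> = (\<Sum>x\<in>X False. \<Sum>y\<in>X True. \<Sum>j\<in>J. K (j div (2 * m)) x y * c x y j)"
    proof (rule sum.cong[OF refl], rule sum.cong[OF refl])
      fix x y assume xy: "x \<in> X False" "y \<in> X True"
      have "\<Lambda> * G x y * (if x ! (j div (2 * m)) \<noteq> y ! (j div (2 * m)) then c x y j else 0)
          = K (j div (2 * m)) x y * c x y j" if "j \<in> J" for j
        using K(2)[OF Jlt[OF that], of x y] xy by (simp add: X_def)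
      then show "\<Lambda> * G x y * (\<Sum>j\<in>J. if x ! (j div (2 * m)) \<noteq> y ! (j div (2 * m)) then c x y j else 0)
          = (\<Sum>j\<in>J. K (j div (2 * m)) x y * c x y j)"
        unfolding sum_distrib_left by (intro sum.cong refl)
    qed
    also have "\<dots> = (\<Sum>j\<in>J. \<Sum>x\<in>X False. \<Sum>y\<in>X True. K (j div (2 * m)) x y * c x y j)"
      by (rule sum_rotate)
    finally have eq: "W t - W (Suc t) = (\<Sum>j\<in>J. \<Sum>x\<in>X False. \<Sum>y\<in>X True. K (j div (2 * m)) x y * c x y j)" .
    \<comment> \<open>Each \<open>p b\<close> and \<open>p' b\<close> has total mass 1 over all
      basis states, so the four halves in \<open>le\<close> add up to 2.\<close>
    define p where "p b j = (\<Sum>x\<in>X b. (cmod (\<psi> t x j))\<^sup>2)" for b j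
    define p' where "p' b j = (\<Sum>x\<in>X b. (cmod (\<psi> t x (oracle_map N m x j)))\<^sup>2)" for b j
    have nonneg: "0 \<le> p b j" "0 \<le> p' b j" for b j
      by (simp_all add: p_def p'_def sum_nonneg)
    have one: "(\<Sum>j<d. p b j) = 1" "(\<Sum>j<d. p' b j) = 1" for b
      using \<psi>1[of t b] \<psi>1'[of t b] t by (simp_all add: p_def p'_def)
    have le: "(\<Sum>x\<in>X False. \<Sum>y\<in>X True. K (j div (2 * m)) x y * c x y j)
        \<le> (p False j + p True j) / 2 + (p' False j + p' True j) / 2" if j: "j \<in> J" for j
    proof -
      have gen: "s - s' \<le> (r + q) / 2 + (r' + q') / 2"
        if "\<bar>s\<bar> \<le> (1 * r + q / 1) / 2" "\<bar>s'\<bar> \<le> (1 * r' + q' / 1) / 2" for s s' r q r' q' :: real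
        using that unfolding mult_1 div_by_1 by linarith
      have eq: "(\<Sum>x\<in>X False. \<Sum>y\<in>X True. K (j div (2 * m)) x y * c x y j)
        = (\<Sum>x\<in>X False. \<Sum>y\<in>X True. K (j div (2 * m)) x y * Re (cnj (\<psi> t x j) * \<psi> t y j))
        - (\<Sum>x\<in>X False. \<Sum>y\<in>X True. K (j div (2 * m)) x y *
             Re (cnj (\<psi> t x (oracle_map N m x j)) * \<psi> t y (oracle_map N m y j)))"
        unfolding c_def right_diff_distrib sum_subtractf by (rule refl)
      have L: "link (inputs N) f (K (j div (2 * m)))" by (rule K(1)[OF Jlt[OF j]])
      have b1: "\<bar>\<Sum>x\<in>X False. \<Sum>y\<in>X True. K (j div (2 * m)) x y * Re (cnj (\<psi> t x j) * \<psi> t y j)\<bar>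
        \<le> (1 * p False j + p True j / 1) / 2"
        unfolding p_def by (rule bound[OF L]) simp
      have b2: "\<bar>\<Sum>x\<in>X False. \<Sum>y\<in>X True. K (j div (2 * m)) x y *
          Re (cnj (\<psi> t x (oracle_map N m x j)) * \<psi> t y (oracle_map N m y j))\<bar>
        \<le> (1 * p' False j + p' True j / 1) / 2"
        unfolding p'_def by (rule bound[OF L]) simp
      show ?thesis unfolding eq by (rule gen[OF b1 b2])
    qed
    have "W t - W (Suc t) \<le> (\<Sum>j\<in>J. (p False j + p True j) / 2 + (p' False j + p' True j) / 2)"
      unfolding eq by (rule sum_mono) (rule le)
    also have "\<dots> \<le> (\<Sum>j<d. (p False j + p True j) / 2 + (p' False j + p' True j) / 2)"
      by (rule sum_mono2[OF _ Jd]) (use nonneg in \<open>auto intro!: add_nonneg_nonneg\<close>)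
    also have "\<dots> = 2"
      by (simp add: sum.distrib sum_divide_distrib[symmetric] one)
    finally show ?thesis .
  qed
  have Wt: "t \<le> T \<Longrightarrow> W t \<ge> \<Lambda> - 2 * real t" for t
  proof (induction t)
    case (Suc t)
    then show ?case using step[of t] by simp
  qed (simp add: W0)
  define u where "u x j = (cmod (query_state N m V x T $ j))\<^sup>2" for x j
  \<comment> \<open>Outcome weights for the AM-GM inequality: 3/2 on the outcomes that a rejecting
    input should avoid. An error of at most 1/3 leaves 2/3 * 2/3 + 3/2 * 1/3 = 17/18, and
    symmetrically with \<open>1 / s j\<close> for accepting inputs.\<close>
  define s where "s j = (if j \<in> A then 3 / 2 else 2 / 3 :: real)" for j
  have sp: "s j > 0" for j by (simp add: s_def)
  have u1: "(\<Sum>j<d. u x j) = 1" for x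
    using query_state_norm[OF V order_refl m] by (simp add: d_def u_def)
  have split: "(\<Sum>j<d. r j) = (\<Sum>j | j < d \<and> (j \<in> A \<longleftrightarrow> b). r j) + (\<Sum>j | j < d \<and> (j \<in> A \<longleftrightarrow> \<not> b). r j)"
    for r :: "nat \<Rightarrow> real" and b
    by (subst sum.union_disjoint[symmetric]) (auto intro!: sum.cong)
  have uF: "(\<Sum>j<d. s j * u x j) \<le> 17 / 18" if x: "x \<in> X False" for x
  proof -
    have o: "(\<Sum>j | j < d \<and> (j \<in> A \<longleftrightarrow> False). u x j) \<ge> 2 / 3"
      using out[of x] x by (simp add: X_def output_prob_def d_def u_def)
    have "(\<Sum>j<d. s j * u x j) = (\<Sum>j | j < d \<and> (j \<in> A \<longleftrightarrow> False). 2 / 3 * u x j)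
        + (\<Sum>j | j < d \<and> (j \<in> A \<longleftrightarrow> \<not> False). 3 / 2 * u x j)"
      unfolding split[of _ False] by (intro arg_cong2[of _ _ _ _ "(+)"] sum.cong refl) (auto simp: s_def)
    then show ?thesis
      using u1[of x] o unfolding split[of _ False] sum_distrib_left[symmetric] by linarith
  qed
  have uT: "(\<Sum>j<d. u x j / s j) \<le> 17 / 18" if x: "x \<in> X True" for x
  proof -
    have o: "(\<Sum>j | j < d \<and> (j \<in> A \<longleftrightarrow> True). u x j) \<ge> 2 / 3"
      using out[of x] x by (simp add: X_def output_prob_def d_def u_def)
    have "(\<Sum>j<d. u x j / s j) = (\<Sum>j | j < d \<and> (j \<in> A \<longleftrightarrow> True). 2 / 3 * u x j)
        + (\<Sum>j | j < d \<and> (j \<in> A \<longleftrightarrow> \<not> True). 3 / 2 * u x j)"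
      unfolding split[of _ True] by (intro arg_cong2[of _ _ _ _ "(+)"] sum.cong refl) (auto simp: s_def)
    then show ?thesis
      using u1[of x] o unfolding split[of _ True] sum_distrib_left[symmetric] by linarith
  qed
  define P where "P j = (\<Sum>x\<in>X False. (cmod (\<psi> T x j))\<^sup>2)" for j
  define R where "R j = (\<Sum>x\<in>X True. (cmod (\<psi> T x j))\<^sup>2)" for j
  have "W T = (\<Sum>x\<in>X False. \<Sum>y\<in>X True. \<Sum>j<d. \<Lambda> * (G x y * Re (cnj (\<psi> T x j) * \<psi> T y j)))"
    by (simp only: W_def sum_distrib_left mult.assoc)
  also have "\<dots> = (\<Sum>j<d. \<Sum>x\<in>X False. \<Sum>y\<in>X True. \<Lambda> * (G x y * Re (cnj (\<psi> T x j) * \<psi> T y j)))"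
    by (rule sum_rotate)
  also have "\<dots> = \<Lambda> * (\<Sum>j<d. \<Sum>x\<in>X False. \<Sum>y\<in>X True. G x y * Re (cnj (\<psi> T x j) * \<psi> T y j))"
    by (simp only: sum_distrib_left)
  finally have WT: "W T = \<dots>" .
  have "W T \<le> \<Lambda> * (\<Sum>j<d. (s j * P j + R j / s j) / 2)"
    unfolding WT P_def R_def
    by (rule mult_left_mono[OF _ \<Lambda>], rule sum_mono, rule order_trans[OF abs_ge_self],
        rule bound[OF L sp])
  also have "(\<Sum>j<d. (s j * P j + R j / s j) / 2) = ((\<Sum>j<d. s j * P j) + (\<Sum>j<d. R j / s j)) / 2"
    by (simp only: sum.distrib sum_divide_distrib[symmetric])
  also have "(\<Sum>j<d. s j * P j) = (\<Sum>x\<in>X False. (w x)\<^sup>2 * (\<Sum>j<d. s j * u x j))"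
    unfolding P_def cm u_def sum_distrib_left by (subst sum.swap) (simp only: mult.left_commute)
  also have "(\<Sum>j<d. R j / s j) = (\<Sum>x\<in>X True. (w x)\<^sup>2 * (\<Sum>j<d. u x j / s j))"
    unfolding R_def cm u_def sum_distrib_left sum_divide_distrib
    by (subst sum.swap) (simp only: times_divide_eq_right)
  also have "\<Lambda> * (((\<Sum>x\<in>X False. (w x)\<^sup>2 * (\<Sum>j<d. s j * u x j))
        + (\<Sum>x\<in>X True. (w x)\<^sup>2 * (\<Sum>j<d. u x j / s j))) / 2)
      \<le> \<Lambda> * (((\<Sum>x\<in>X False. (w x)\<^sup>2 * (17 / 18)) + (\<Sum>x\<in>X True. (w x)\<^sup>2 * (17 / 18))) / 2)"
    by (rule mult_left_mono[OF _ \<Lambda>], rule divide_right_mono, rule add_mono;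
        (rule sum_mono, rule mult_left_mono[OF uF] mult_left_mono[OF uT], assumption)?) auto
  also have "\<dots> = \<Lambda> * (17 / 18)"
    by (simp only: sum_distrib_right[symmetric] w1) simp
  finally have "W T \<le> \<Lambda> * (17 / 18)" .
  with Wt[of T] show ?thesis by simp
qed

section \<open>An algorithm for every function, so that the least number of queries is
  attained\<close>

text \<open>Each copying step of the algorithm is prescribed on the reachable basis states only;
  completing it to a permutation makes it unitary.\<close>

lemma extend_to_permutation:
  assumes "finite D" "A \<subseteq> D" "inj_on h A" "h ` A \<subseteq> D"
  shows "\<exists>\<pi>. bij_betw \<pi> D D \<and> (\<forall>a\<in>A. \<pi> a = h a)"
proof -
  have "card (D - A) = card (D - h ` A)"
    using assms by (simp add: card_Diff_subset finite_subset card_image)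
  then obtain g where g: "bij_betw g (D - A) (D - h ` A)"
    using finite_same_card_bij[of "D - A" "D - h ` A"] assms(1) by auto
  define \<pi> where "\<pi> a = (if a \<in> A then h a else g a)" for a
  have "bij_betw \<pi> (A \<union> (D - A)) (h ` A \<union> (D - h ` A))"
  proof (rule bij_betw_combine)
    show "bij_betw \<pi> A (h ` A)"
      using assms(3) by (simp add: bij_betw_def \<pi>_def inj_on_def)
    show "bij_betw \<pi> (D - A) (D - h ` A)"
      by (rule iffD1[OF bij_betw_cong g]) (simp add: \<pi>_def)
  qed auto
  moreover have "A \<union> (D - A) = D" "h ` A \<union> (D - h ` A) = D" using assms by auto
  ultimately show ?thesis by (intro exI[of _ \<pi>]) (simp add: \<pi>_def)
qed

definition perm_mat :: "nat \<Rightarrow> (nat \<Rightarrow> nat) \<Rightarrow> complex mat" where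
  "perm_mat d \<pi> = mat d d (\<lambda>(r, c). if r = \<pi> c then 1 else 0)"

lemma perm_mat_unitary:
  assumes "bij_betw \<pi> {..<d} {..<d}"
  shows "unitary d (perm_mat d \<pi>)"
proof -
  have lt: "\<pi> c < d" if "c < d" for c using bij_betwE[OF assms] that by auto
  have inj: "\<pi> a = \<pi> c \<longleftrightarrow> a = c" if "a < d" "c < d" for a c
    using bij_betw_imp_inj_on[OF assms] that by (auto simp: inj_on_def)
  have "mat_adjoint (perm_mat d \<pi>) * perm_mat d \<pi> = 1\<^sub>m d"
  proof (rule eq_matI)
    fix k l assume "k < dim_row (1\<^sub>m d)" "l < dim_col (1\<^sub>m d)"
    then have kl: "k < d" "l < d" by auto
    then have "(mat_adjoint (perm_mat d \<pi>) * perm_mat d \<pi>) $$ (k, l)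
       = (\<Sum>j<d. cnj (if j = \<pi> k then 1 else 0) * (if j = \<pi> l then 1 else 0))"
      by (simp add: perm_mat_def mat_adjoint_def scalar_prod_def atLeast0LessThan mat_of_rows_def)
    also have "\<dots> = (\<Sum>j<d. if j = \<pi> k then (if \<pi> k = \<pi> l then 1 else 0) else 0)"
      by (intro sum.cong refl) auto
    also have "\<dots> = 1\<^sub>m d $$ (k, l)" using kl lt inj by simp
    finally show "(mat_adjoint (perm_mat d \<pi>) * perm_mat d \<pi>) $$ (k, l) = 1\<^sub>m d $$ (k, l)" .
  qed (auto simp: perm_mat_def mat_adjoint_def)
  then show ?thesis by (simp add: unitary_def perm_mat_def)
qed

lemma perm_mat_unit_vec:
  assumes "bij_betw \<pi> {..<d} {..<d}" "c < d"
  shows "perm_mat d \<pi> *\<^sub>v unit_vec d c = unit_vec d (\<pi> c)"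
proof (rule eq_vecI)
  fix r assume "r < dim_vec (unit_vec d (\<pi> c))"
  then show "(perm_mat d \<pi> *\<^sub>v unit_vec d c) $ r = unit_vec d (\<pi> c) $ r"
    using assms bij_betwE[OF assms(1)] by (auto simp: perm_mat_def)
qed (simp add: perm_mat_def)

lemma oracle_unit_vec:
  assumes "m > 0" "c < qdim N m"
  shows "oracle_mat N m x *\<^sub>v unit_vec (qdim N m) c = unit_vec (qdim N m) (oracle_map N m x c)"
proof (rule eq_vecI)
  fix r assume "r < dim_vec (unit_vec (qdim N m) (oracle_map N m x c))"
  then have r: "r < qdim N m" by simp
  have "oracle_map N m x r = c \<longleftrightarrow> r = oracle_map N m x c" by (metis oracle_map_invol)
  then show "(oracle_mat N m x *\<^sub>v unit_vec (qdim N m) c) $ r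
      = unit_vec (qdim N m) (oracle_map N m x c) $ r"
    using oracle_mat_apply[OF assms(1) _ r, of "unit_vec (qdim N m) c"] r assms
    by (simp add: unit_vec_def oracle_map_lt)
qed (simp add: oracle_mat_def)

text \<open>
  The algorithm queries the variables one by one and copies the answers to the workspace.
\<close>

lemma quantum_computable_all: "\<exists>T. quantum_computable N f T"
proof -
  define m :: nat where "m = 2 ^ N"
  define d where "d = qdim N m"
  have m: "m > 0" by (simp add: m_def)
  have d: "d = 2 * m * N + 2 * m" by (simp add: d_def qdim_def algebra_simps)
  define h where "h t j = 2 * (m * Suc t + (j - 2 * m * t) div 2 + 2 ^ t * ((j - 2 * m * t) mod 2))" for t j :: nat
  define Dom where "Dom t = (\<lambda>u. 2 * m * t + u) ` {..<2 ^ Suc t}" for t :: nat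
  have ex: "\<exists>\<pi>. bij_betw \<pi> {..<d} {..<d} \<and> (t < N \<longrightarrow> (\<forall>a\<in>Dom t. \<pi> a = h t a))" for t
  proof (cases "t < N")
    case True
    have pw: "2 ^ Suc t \<le> m" unfolding m_def using True by (intro power_increasing) auto
    have tm: "m * Suc t \<le> m * N" using True by (intro mult_left_mono) auto
    have hu: "h t (2 * m * t + u) = 2 * (m * Suc t + u div 2 + 2 ^ t * (u mod 2))" for u
      by (simp add: h_def)
    have "\<exists>\<pi>. bij_betw \<pi> {..<d} {..<d} \<and> (\<forall>a\<in>Dom t. \<pi> a = h t a)"
    proof (rule extend_to_permutation)
      have "2 * m * t + 2 * m \<le> 2 * m * N" using tm by (simp add: algebra_simps)
      then show "Dom t \<subseteq> {..<d}" unfolding Dom_def d using pw by auto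
      show "inj_on (h t) (Dom t)"
      proof (rule inj_onI)
        fix a b assume "a \<in> Dom t" "b \<in> Dom t" and eq: "h t a = h t b"
        then obtain u v where u: "u < 2 ^ Suc t" "a = 2 * m * t + u" and v: "v < 2 ^ Suc t" "b = 2 * m * t + v"
          unfolding Dom_def by auto
        have lt: "u div 2 < 2 ^ t" "v div 2 < 2 ^ t" using u v by auto
        have e: "u div 2 + 2 ^ t * (u mod 2) = v div 2 + 2 ^ t * (v mod 2)"
          using eq hu u(2) v(2) by simp
        have "u mod 2 = (u div 2 + 2 ^ t * (u mod 2)) div 2 ^ t" using lt by simp
        moreover have "v mod 2 = (v div 2 + 2 ^ t * (v mod 2)) div 2 ^ t" using lt by simp
        ultimately have 1: "u mod 2 = v mod 2" using e by simp
        with e have "u div 2 = v div 2" by simp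
        with 1 have "u = v" by (metis div_mult_mod_eq)
        then show "a = b" using u v by simp
      qed
      show "h t ` Dom t \<subseteq> {..<d}"
      proof
        fix z assume "z \<in> h t ` Dom t"
        then obtain u where u: "u < 2 ^ Suc t" "z = 2 * (m * Suc t + u div 2 + 2 ^ t * (u mod 2))"
          unfolding Dom_def using hu by auto
        have "2 ^ t * (u mod 2) \<le> 2 ^ t * 1" by (rule mult_left_mono) auto
        moreover have "u div 2 < 2 ^ t" using u by auto
        moreover have "2 ^ t + 2 ^ t \<le> m" using pw by simp
        ultimately have "u div 2 + 2 ^ t * (u mod 2) < m" by linarith
        then show "z \<in> {..<d}" unfolding d u(2) using tm by simp
      qed
    qed simp
    then show ?thesis by blast
  qed (auto intro!: exI[of _ id])
  then obtain \<pi> where bij: "\<And>t. bij_betw (\<pi> t) {..<d} {..<d}"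
    and \<pi>: "\<And>t a. t < N \<Longrightarrow> a \<in> Dom t \<Longrightarrow> \<pi> t a = h t a"
    by metis
  define V where "V t = (case t of 0 \<Rightarrow> 1\<^sub>m d | Suc t' \<Rightarrow> perm_mat d (\<pi> t'))" for t
  define e where "e t x = 2 * (m * t + horner_sum of_bool 2 (take t x))" for t and x :: "bool list"
  have un: "unitary d (V t)" for t
  proof (cases t)
    case 0
    have "mat_adjoint (1\<^sub>m d :: complex mat) * 1\<^sub>m d = 1\<^sub>m d"
    proof (rule eq_matI)
      fix i j assume "i < dim_row (1\<^sub>m d)" "j < dim_col (1\<^sub>m d)"
      then have "i < d" "j < d" by auto
      moreover from this have "(mat_adjoint (1\<^sub>m d :: complex mat) * 1\<^sub>m d) $$ (i, j) = mat_adjoint (1\<^sub>m d :: complex mat) $$ (i, j)"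
        by (subst right_mult_one_mat[of _ d]) (auto simp: mat_adjoint_def)
      ultimately show "(mat_adjoint (1\<^sub>m d :: complex mat) * 1\<^sub>m d) $$ (i, j) = 1\<^sub>m d $$ (i, j)"
        by (simp add: mat_adjoint_def mat_of_rows_def)
    qed (auto simp: mat_adjoint_def)
    then show ?thesis using 0 by (simp add: unitary_def V_def)
  qed (auto simp: V_def perm_mat_unitary[OF bij])
  have state: "query_state N m V x t = unit_vec d (e t x)" if x: "x \<in> inputs N" and "t \<le> N" for x t
    using \<open>t \<le> N\<close>
  proof (induction t)
    case 0
    then show ?case by (simp add: V_def e_def d_def[symmetric])
  next
    case (Suc t)
    then have t: "t < N" by simp
    let ?w = "horner_sum of_bool 2 (take t x) :: nat"
    have len: "length x = N" using x by (simp add: inputs_def)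
    have w: "?w < 2 ^ t" using horner_sum_of_bool_2_less[of "take t x"] t len by simp
    have wm: "2 ^ Suc t \<le> m" unfolding m_def using t by (intro power_increasing) auto
    have tm: "m * Suc t \<le> m * N" using t by (intro mult_left_mono) auto
    have div: "e t x div (2 * m) = t"
      unfolding e_def div_mult2_eq using w wm m by simp
    have elt: "e t x < qdim N m" unfolding qdim_div[OF m] div using t by simp
    have om: "oracle_map N m x (e t x) = 2 * m * t + (2 * ?w + of_bool (x ! t))"
      unfolding oracle_map_def Let_def div using t by (auto simp: e_def)
    have dom: "oracle_map N m x (e t x) \<in> Dom t"
      unfolding om Dom_def using w by (intro image_eqI[OF refl]) auto
    have "\<pi> t (oracle_map N m x (e t x)) = 2 * (m * Suc t + (?w + 2 ^ t * of_bool (x ! t)))"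
      unfolding \<pi>[OF t dom] unfolding om h_def by auto
    also have "?w + 2 ^ t * of_bool (x ! t) = horner_sum of_bool 2 (take (Suc t) x)"
      using t len by (simp add: take_Suc_conv_app_nth horner_sum_append)
    finally have "\<pi> t (oracle_map N m x (e t x)) = e (Suc t) x" by (simp add: e_def)
    moreover have "oracle_map N m x (e t x) < d" using elt oracle_map_lt[OF m] d_def by simp
    ultimately show ?case
      using Suc oracle_unit_vec[OF m elt] perm_mat_unit_vec[OF bij]
      by (simp add: V_def d_def[symmetric])
  qed
  define A where "A = e N ` {x \<in> inputs N. f x}"
  have inj: "inj_on (e N) (inputs N)"
  proof (rule inj_onI)
    fix x y assume x: "x \<in> inputs N" and y: "y \<in> inputs N" and "e N x = e N y"
    then have eq: "horner_sum of_bool 2 x = (horner_sum of_bool 2 y :: nat)" by (simp add: e_def inputs_def)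
    show "x = y"
    proof (rule nth_equalityI)
      fix i assume "i < length x"
      then show "x ! i = y ! i"
        using arg_cong[OF eq, of "\<lambda>z. bit z i"] x y
        by (simp add: bit_horner_sum_bit_iff inputs_def)
    qed (use x y in \<open>simp add: inputs_def\<close>)
  qed
  have "output_prob N m V A N x (f x) \<ge> 2 / 3" if x: "x \<in> inputs N" for x
  proof -
    have len: "length x = N" using x by (simp add: inputs_def)
    have "horner_sum of_bool 2 x < (2 ^ N :: nat)" using horner_sum_of_bool_2_less[of x] len by simp
    then have elt: "e N x < d" unfolding d e_def m_def using len by simp
    have mem: "e N x \<in> A \<longleftrightarrow> f x" unfolding A_def using inj x by (auto simp: inj_on_def)
    have "output_prob N m V A N x (f x)
        = (\<Sum>j | j < d \<and> (j \<in> A \<longleftrightarrow> f x). if j = e N x then 1 else 0)"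
      unfolding output_prob_def d_def[symmetric] state[OF x order_refl]
      by (intro sum.cong refl) (auto simp: unit_vec_def)
    also have "\<dots> = 1" using elt mem by (simp add: sum.delta)
    finally show ?thesis by simp
  qed
  then have "quantum_computable N f N"
    unfolding quantum_computable_def using m un d_def by (intro exI[of _ m] exI[of _ V] exI[of _ A]) auto
  then show ?thesis by blast
qed

theorem Q_ge_adversary:
  assumes "adversary (inputs N) f (input_bits N) \<Lambda>" "0 \<le> \<Lambda>"
  shows "\<Lambda> / 36 \<le> real (Q N f)"
proof -
  have "quantum_computable N f (Q N f)"
    unfolding Q_def using quantum_computable_all by (rule LeastI_ex)
  from adversary_lower_bound[OF assms this] show ?thesis by simp
qed

subsection \<open>Block composition\<close>

definition blk :: "nat \<Rightarrow> nat \<Rightarrow> bool list \<Rightarrow> bool list" where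
  "blk M i x = take M (drop (i * M) x)"

definition block_map :: "nat \<Rightarrow> nat \<Rightarrow> (bool list \<Rightarrow> bool) \<Rightarrow> bool list \<Rightarrow> bool list" where
  "block_map n M g x = map (\<lambda>i. g (blk M i x)) [0..<n]"

lemma block_map_inputs [simp]: "block_map n M g x \<in> inputs n"
  by (simp add: block_map_def inputs_def)

lemma block_map_nth [simp]: "i < n \<Longrightarrow> block_map n M g x ! i = g (blk M i x)"
  by (simp add: block_map_def)

lemma block_bound: "i < n \<Longrightarrow> i * M + M \<le> n * (M::nat)"
  by (metis add.commute mult_Suc mult_le_mono1 Suc_leI)

lemma blk_inputs: "i * M + M \<le> length x \<Longrightarrow> blk M i x \<in> inputs M"
  by (simp add: blk_def inputs_def)

lemma blk_in_inputs: "x \<in> inputs (n * M) \<Longrightarrow> i < n \<Longrightarrow> blk M i x \<in> inputs M"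
  using block_bound[of i n M] by (intro blk_inputs) (simp add: inputs_def)

lemma blk_nth: "i * M + M \<le> length x \<Longrightarrow> q < M \<Longrightarrow> blk M i x ! q = x ! (i * M + q)"
  by (simp add: blk_def)

lemma blk_nth_inputs: "x \<in> inputs (n * M) \<Longrightarrow> i < n \<Longrightarrow> q < M \<Longrightarrow> blk M i x ! q = x ! (i * M + q)"
  using block_bound[of i n M] by (intro blk_nth) (auto simp: inputs_def)

lemma div_mod_block:
  assumes "k < n * (M::nat)"
  shows "k div M < n" "k mod M < M" "k div M * M + k mod M = k" "M > 0"
proof -
  show "M > 0" using assms by (cases M) auto
  then show "k div M < n" "k mod M < M" "k div M * M + k mod M = k"
    using assms by (simp_all add: div_less_iff_less_mult)
qed

lemma blk_ext:
  assumes "x \<in> inputs (n * M)" "y \<in> inputs (n * M)" "\<And>i. i < n \<Longrightarrow> blk M i x = blk M i y"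
  shows "x = y"
proof (rule nth_equalityI)
  show "length x = length y" using assms by (simp add: inputs_def)
  fix k assume "k < length x"
  then have k: "k < n * M" using assms by (simp add: inputs_def)
  note d = div_mod_block[OF k]
  show "x ! k = y ! k"
    using blk_nth_inputs[OF assms(1) d(1,2)] blk_nth_inputs[OF assms(2) d(1,2)] assms(3)[OF d(1)] d(3)
    by simp
qed

lemma length_concat_blocks:
  "(\<And>i. i < n \<Longrightarrow> length (h i) = M) \<Longrightarrow> length (concat (map h [0..<n])) = n * M"
  by (induction n) auto

text \<open>The tail \<open>z\<close> is there for the induction, which splits off the last block
  and hands it to the tail.\<close>

lemma blk_concat:
  assumes "\<And>i. i < n \<Longrightarrow> length (h i) = M" "i < n"
  shows "blk M i (concat (map h [0..<n]) @ z) = h i"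
  using assms
proof (induction n arbitrary: z)
  case (Suc n)
  show ?case
  proof (cases "i < n")
    case True
    then show ?thesis using Suc.IH[of "h n @ z"] Suc.prems by simp
  next
    case False
    then have "i = n" using Suc.prems by simp
    moreover have "length (concat (map h [0..<n])) = n * M"
      using Suc.prems by (intro length_concat_blocks) simp
    ultimately show ?thesis using Suc.prems(1)[of n] by (simp add: blk_def)
  qed
qed simp

text \<open>Cutting an input into blocks is a bijection onto a product of sets, so sums of products
  factorise. The norms and alignments of the tensor products below reduce to this.\<close>

lemma block_sum:
  fixes \<phi> :: "nat \<Rightarrow> bool list \<Rightarrow> real"
  assumes "\<And>i. i < n \<Longrightarrow> A i \<subseteq> inputs M"
  shows "(\<Sum>x | x \<in> inputs (n * M) \<and> (\<forall>i<n. blk M i x \<in> A i). \<Prod>i<n. \<phi> i (blk M i x))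
    = (\<Prod>i<n. \<Sum>y\<in>A i. \<phi> i y)"
proof -
  have fin: "finite (A i)" if "i < n" for i by (rule finite_subset[OF assms[OF that] finite_inputs])
  let ?S = "{x \<in> inputs (n * M). \<forall>i<n. blk M i x \<in> A i}"
  let ?r = "\<lambda>x. restrict (\<lambda>i. blk M i x) {..<n}"
  let ?c = "\<lambda>h. concat (map h [0..<n])"
  have len: "length (h i) = M" if "h \<in> PiE {..<n} A" "i < n" for h i
    using that assms[OF that(2)] by (auto simp: inputs_def)
  have cin: "?c h \<in> ?S" if "h \<in> PiE {..<n} A" for h
    using length_concat_blocks[of n h M] len[OF that] blk_concat[of n h M _ "[]"] that
    by (auto simp: inputs_def)
  have bij: "bij_betw ?r ?S (PiE {..<n} A)"
  proof (rule bij_betw_byWitness[where f' = ?c])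
    show "\<forall>x\<in>?S. ?c (?r x) = x"
    proof
      fix x assume x: "x \<in> ?S"
      then have r: "?r x \<in> PiE {..<n} A" by auto
      show "?c (?r x) = x"
      proof (rule blk_ext)
        show "?c (?r x) \<in> inputs (n * M)" using cin[OF r] by simp
        show "x \<in> inputs (n * M)" using x by simp
        fix i assume "i < n"
        then show "blk M i (?c (?r x)) = blk M i x"
          using blk_concat[of n "?r x" M i "[]"] len[OF r] by simp
      qed
    qed
    show "\<forall>h\<in>PiE {..<n} A. ?r (?c h) = h"
    proof
      fix h assume h: "h \<in> PiE {..<n} A"
      show "?r (?c h) = h"
      proof
        fix i show "?r (?c h) i = h i"
          using blk_concat[of n h M i "[]"] len[OF h] PiE_arb[OF h, of i] by (cases "i < n") simp_all
      qed
    qed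
    show "?r ` ?S \<subseteq> PiE {..<n} A" by (auto simp: PiE_def extensional_def)
    show "?c ` PiE {..<n} A \<subseteq> ?S" using cin by blast
  qed
  have "(\<Prod>i<n. \<Sum>y\<in>A i. \<phi> i y) = (\<Sum>h\<in>PiE {..<n} A. \<Prod>i<n. \<phi> i (h i))"
    using fin by (intro prod_sum_PiE) auto
  also have "\<dots> = (\<Sum>x\<in>?S. \<Prod>i<n. \<phi> i (?r x i))"
    by (rule sum.reindex_bij_betw[OF bij, symmetric])
  also have "\<dots> = (\<Sum>x\<in>?S. \<Prod>i<n. \<phi> i (blk M i x))"
    by (intro sum.cong prod.cong refl) simp
  finally show ?thesis by simp
qed

text \<open>In terms of the vectors behind \<open>G\<close>, the \<open>w\<close>-weighted sums of
  the two families are unit vectors with inner product 1, hence equal. Composition uses the diagonal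
  cases as well, since corresponding blocks of two composed inputs may have equal or different
  values.\<close>

lemma aligned_all:
  assumes L: "link X f G" and al: "aligned X f G w" and fin: "finite X"
  shows "(\<Sum>x | x \<in> X \<and> f x = b. \<Sum>y | y \<in> X \<and> f y = c. w x * w y * G x y) = 1"
proof (cases "b = c")
  case True
  have "(\<Sum>x | x \<in> X \<and> f x = b. \<Sum>y | y \<in> X \<and> f y = b. w x * w y * G x y)
      = (\<Sum>x | x \<in> X \<and> f x = b. \<Sum>y | y \<in> X \<and> f y = b. if x = y then (w x)\<^sup>2 else 0)"
    by (intro sum.cong refl) (auto simp: link_same[OF L] power2_eq_square)
  also have "\<dots> = (\<Sum>x | x \<in> X \<and> f x = b. (w x)\<^sup>2)"
    using fin by (intro sum.cong refl) simp
  finally show ?thesis using al True by (simp add: aligned_def)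
next
  case False
  have 1: "(\<Sum>x | x \<in> X \<and> \<not> f x. \<Sum>y | y \<in> X \<and> f y. w x * w y * G x y) = 1"
    using al by (simp add: aligned_def)
  have 2: "(\<Sum>x | x \<in> X \<and> f x. \<Sum>y | y \<in> X \<and> \<not> f y. w x * w y * G x y)
      = (\<Sum>x | x \<in> X \<and> \<not> f x. \<Sum>y | y \<in> X \<and> f y. w x * w y * G x y)"
    by (subst sum.swap) (auto intro!: sum.cong simp: gram_sym[OF link_gram[OF L]] mult_ac)
  show ?thesis using 1 2 False by (cases b; cases c) simp_all
qed

text \<open>If the outer values agree, the outer factor vanishes unless both inputs have the same
  block values; then every inner factor is an identity kernel and the product detects a difference
  in any block. The inner kernels may vary from block to block, because a query affects one block
  only.\<close>

lemma link_compose: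
  assumes f: "link (inputs n) f Kf" and g: "\<And>i. i < n \<Longrightarrow> link (inputs M) g (H i)"
  shows "link (inputs (n * M)) (\<lambda>x. f (block_map n M g x))
    (\<lambda>x y. Kf (block_map n M g x) (block_map n M g y) * (\<Prod>i<n. H i (blk M i x) (blk M i y)))"
  unfolding link_def
proof (intro conjI ballI impI)
  show "gram (inputs (n * M))
    (\<lambda>x y. Kf (block_map n M g x) (block_map n M g y) * (\<Prod>i<n. H i (blk M i x) (blk M i y)))"
  proof (rule gram_mult)
    show "gram (inputs (n * M)) (\<lambda>x y. Kf (block_map n M g x) (block_map n M g y))"
      by (rule gram_comp[OF link_gram[OF f]]) simp
    show "gram (inputs (n * M)) (\<lambda>x y. \<Prod>i<n. H i (blk M i x) (blk M i y))"
    proof (rule gram_prod)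
      fix i assume "i \<in> {..<n}"
      then show "gram (inputs (n * M)) (\<lambda>x y. H i (blk M i x) (blk M i y))"
        using blk_in_inputs by (intro gram_comp[OF link_gram[OF g], where h = "blk M i"]) auto
    qed
  qed
  fix x y assume x: "x \<in> inputs (n * M)" and y: "y \<in> inputs (n * M)"
    and eq: "f (block_map n M g x) = f (block_map n M g y)"
  have Kf: "Kf (block_map n M g x) (block_map n M g y)
      = (if block_map n M g x = block_map n M g y then 1 else 0)"
    by (rule link_same[OF f _ _ eq]) simp_all
  show "Kf (block_map n M g x) (block_map n M g y) * (\<Prod>i<n. H i (blk M i x) (blk M i y))
      = (if x = y then 1 else 0)"
  proof (cases "block_map n M g x = block_map n M g y")
    case True
    have "g (blk M i x) = g (blk M i y)" if "i < n" for i
      using arg_cong[OF True, of "\<lambda>z. z ! i"] that by simp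
    then have H: "H i (blk M i x) (blk M i y) = (if blk M i x = blk M i y then 1 else 0)"
      if "i < n" for i
      using link_same[OF g[OF that] blk_in_inputs[OF x that] blk_in_inputs[OF y that]] that by simp
    show ?thesis
    proof (cases "x = y")
      case True
      then show ?thesis using Kf H by simp
    next
      case False
      then obtain i where i: "i < n" "blk M i x \<noteq> blk M i y" using blk_ext[OF x y] by blast
      then have "(\<Prod>i<n. H i (blk M i x) (blk M i y)) = 0"
        using H by (intro prod_zero) auto
      then show ?thesis using False by simp
    qed
  qed (use Kf in auto)
qed

text \<open>Kernel and weights are tensor products. For a query to bit \<open>q\<close> of block
  \<open>p\<close>, the outer link for bit \<open>p\<close> is combined with the inner link for bit
  \<open>q\<close> in block \<open>p\<close>, while all other blocks keep \<open>Gg\<close>; so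
  \<open>\<Lambda>\<^sub>1\<close> and \<open>\<Lambda>\<^sub>2\<close> arise as separate
  factors.\<close>

theorem adversary_compose:
  assumes advf: "adversary (inputs n) f (input_bits n) \<Lambda>\<^sub>1"
    and advg: "adversary (inputs M) g (input_bits M) \<Lambda>\<^sub>2"
  shows "adversary (inputs (n * M)) (\<lambda>x. f (block_map n M g x)) (input_bits (n * M)) (\<Lambda>\<^sub>1 * \<Lambda>\<^sub>2)"
proof -
  obtain Gf wf where Lf: "link (inputs n) f Gf" and alf: "aligned (inputs n) f Gf wf"
    and qf: "\<And>\<beta>. \<beta> \<in> input_bits n \<Longrightarrow> query_link (inputs n) f Gf \<Lambda>\<^sub>1 \<beta>"
    using advf unfolding adversary_def by blast
  obtain Gg wg where Lg: "link (inputs M) g Gg" and alg: "aligned (inputs M) g Gg wg"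
    and qg: "\<And>\<beta>. \<beta> \<in> input_bits M \<Longrightarrow> query_link (inputs M) g Gg \<Lambda>\<^sub>2 \<beta>"
    using advg unfolding adversary_def by blast
  define X where "X = inputs (n * M)"
  define F where "F x = f (block_map n M g x)" for x
  define G where "G x y = Gf (block_map n M g x) (block_map n M g y) * (\<Prod>i<n. Gg (blk M i x) (blk M i y))"
    for x y
  define w where "w x = wf (block_map n M g x) * (\<Prod>i<n. wg (blk M i x))" for x
  have finX: "finite X" by (simp add: X_def)
  have L: "link X F G"
    unfolding X_def F_def[abs_def] G_def[abs_def] by (rule link_compose[OF Lf Lg])
  define S where "S a = {x \<in> X. \<forall>i<n. blk M i x \<in> {u \<in> inputs M. g u = a ! i}}" for a
  have S: "x \<in> S a \<longleftrightarrow> x \<in> X \<and> block_map n M g x = a" if "a \<in> inputs n" for x a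
  proof -
    have "block_map n M g x = a \<longleftrightarrow> (\<forall>i<n. g (blk M i x) = a ! i)"
      using that by (auto simp: list_eq_iff_nth_eq block_map_def inputs_def)
    then show ?thesis unfolding S_def X_def mem_Collect_eq using blk_in_inputs[of x n M] by blast
  qed
  have group: "(\<Sum>x | x \<in> X \<and> F x = b. h x) = (\<Sum>a | a \<in> inputs n \<and> f a = b. \<Sum>x\<in>S a. h x)"
    for h :: "bool list \<Rightarrow> real" and b
  proof -
    have "(\<Sum>x | x \<in> X \<and> F x = b. h x)
        = (\<Sum>a | a \<in> inputs n \<and> f a = b. \<Sum>x | x \<in> {x. x \<in> X \<and> F x = b} \<and> block_map n M g x = a. h x)"
      using finX by (intro sum.group[symmetric]) (auto simp: F_def)
    also have "\<dots> = (\<Sum>a | a \<in> inputs n \<and> f a = b. \<Sum>x\<in>S a. h x)"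
      by (intro sum.cong refl) (auto simp: S F_def)
    finally show ?thesis .
  qed
  have bs: "(\<Sum>x\<in>S a. \<Prod>i<n. \<phi> i (blk M i x)) = (\<Prod>i<n. \<Sum>u | u \<in> inputs M \<and> g u = a ! i. \<phi> i u)"
    for a and \<phi> :: "nat \<Rightarrow> bool list \<Rightarrow> real"
    unfolding S_def X_def by (rule block_sum) auto
  have sq: "(\<Sum>x | x \<in> X \<and> F x = b. (w x)\<^sup>2) = 1" for b
  proof -
    have "(\<Sum>x\<in>S a. (w x)\<^sup>2) = (wf a)\<^sup>2" if "a \<in> inputs n" for a
    proof -
      have "(\<Sum>x\<in>S a. (w x)\<^sup>2) = (\<Sum>x\<in>S a. (wf a)\<^sup>2 * (\<Prod>i<n. (wg (blk M i x))\<^sup>2))"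
        by (intro sum.cong refl) (simp add: w_def power_mult_distrib prod_power_distrib S[OF that])
      also have "\<dots> = (wf a)\<^sup>2"
        using alg by (simp add: sum_distrib_left[symmetric] bs[where \<phi> = "\<lambda>i u. (wg u)\<^sup>2"] aligned_def)
      finally show ?thesis .
    qed
    then show ?thesis using alf by (simp add: group aligned_def)
  qed
  have val: "(\<Sum>x | x \<in> X \<and> \<not> F x. \<Sum>y | y \<in> X \<and> F y. w x * w y * G x y) = 1"
  proof -
    have inner: "(\<Sum>x\<in>S a. \<Sum>y\<in>S b. w x * w y * G x y) = wf a * wf b * Gf a b"
      if ab: "a \<in> inputs n" "b \<in> inputs n" for a b
    proof -
      have "(\<Sum>x\<in>S a. \<Sum>y\<in>S b. w x * w y * G x y)
          = (\<Sum>x\<in>S a. \<Sum>y\<in>S b. wf a * wf b * Gf a b *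
              (\<Prod>i<n. wg (blk M i x) * wg (blk M i y) * Gg (blk M i x) (blk M i y)))"
        by (intro sum.cong refl) (simp add: w_def G_def S[OF ab(1)] S[OF ab(2)] prod.distrib)
      also have "\<dots> = wf a * wf b * Gf a b * (\<Sum>x\<in>S a. \<Sum>y\<in>S b.
              (\<Prod>i<n. wg (blk M i x) * wg (blk M i y) * Gg (blk M i x) (blk M i y)))"
        by (simp only: sum_distrib_left)
      also have "(\<Sum>x\<in>S a. \<Sum>y\<in>S b. (\<Prod>i<n. wg (blk M i x) * wg (blk M i y) * Gg (blk M i x) (blk M i y)))
          = (\<Sum>x\<in>S a. \<Prod>i<n. \<Sum>v | v \<in> inputs M \<and> g v = b ! i. wg (blk M i x) * wg v * Gg (blk M i x) v)"
        by (intro sum.cong refl) (rule bs[where \<phi> = "\<lambda>i v. wg (blk M i _) * wg v * Gg (blk M i _) v"])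
      also have "\<dots> = (\<Prod>i<n. \<Sum>u | u \<in> inputs M \<and> g u = a ! i. \<Sum>v | v \<in> inputs M \<and> g v = b ! i. wg u * wg v * Gg u v)"
        by (rule bs[where \<phi> = "\<lambda>i u. \<Sum>v | v \<in> inputs M \<and> g v = b ! i. wg u * wg v * Gg u v"])
      \<comment> \<open>Every factor is 1 by \<open>aligned_all\<close>, whether or not
        \<open>a\<close> and \<open>b\<close> agree at position \<open>i\<close>.\<close>
      also have "\<dots> = 1" by (simp add: aligned_all[OF Lg alg])
      finally show ?thesis by simp
    qed
    have "(\<Sum>x | x \<in> X \<and> F x = False. \<Sum>y | y \<in> X \<and> F y = True. w x * w y * G x y)
        = (\<Sum>a | a \<in> inputs n \<and> f a = False. \<Sum>x\<in>S a. \<Sum>b | b \<in> inputs n \<and> f b = True. \<Sum>y\<in>S b. w x * w y * G x y)"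
      by (simp only: group)
    also have "\<dots> = (\<Sum>a | a \<in> inputs n \<and> f a = False. \<Sum>b | b \<in> inputs n \<and> f b = True. \<Sum>x\<in>S a. \<Sum>y\<in>S b. w x * w y * G x y)"
      by (intro sum.cong refl sum.swap)
    also have "\<dots> = (\<Sum>a | a \<in> inputs n \<and> f a = False. \<Sum>b | b \<in> inputs n \<and> f b = True. wf a * wf b * Gf a b)"
      by (intro sum.cong refl inner) auto
    also have "\<dots> = 1" using alf by (simp add: aligned_def)
    finally show ?thesis by simp
  qed
  have "query_link X F G (\<Lambda>\<^sub>1 * \<Lambda>\<^sub>2) \<beta>" if \<beta>: "\<beta> \<in> input_bits (n * M)" for \<beta>
  proof -
    obtain k where k: "k < n * M" "\<beta> = (\<lambda>x. x ! k)" using \<beta> by (auto simp: input_bits_def)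
    define p q where "p = k div M" and "q = k mod M"
    have pq: "p < n" "q < M" "p * M + q = k"
      using div_mod_block[OF k(1)] by (auto simp: p_def q_def)
    obtain Kf where Kf: "link (inputs n) f Kf" "\<And>x y. x \<in> inputs n \<Longrightarrow> y \<in> inputs n \<Longrightarrow> f x \<noteq> f y \<Longrightarrow>
        Kf x y = \<Lambda>\<^sub>1 * Gf x y * (if x ! p \<noteq> y ! p then 1 else 0)"
      using qf[of "\<lambda>x. x ! p"] pq(1) unfolding query_link_def input_bits_def by auto
    obtain Kg where Kg: "link (inputs M) g Kg" "\<And>x y. x \<in> inputs M \<Longrightarrow> y \<in> inputs M \<Longrightarrow> g x \<noteq> g y \<Longrightarrow>
        Kg x y = \<Lambda>\<^sub>2 * Gg x y * (if x ! q \<noteq> y ! q then 1 else 0)"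
      using qg[of "\<lambda>x. x ! q"] pq(2) unfolding query_link_def input_bits_def by auto
    define H where "H i = (if i = p then Kg else Gg)" for i
    define K where "K x y = Kf (block_map n M g x) (block_map n M g y) * (\<Prod>i<n. H i (blk M i x) (blk M i y))"
      for x y
    have "link X F K"
      unfolding X_def F_def[abs_def] K_def[abs_def]
      by (rule link_compose[OF Kf(1)]) (use Lg Kg(1) in \<open>simp add: H_def\<close>)
    then show ?thesis
    proof (rule query_linkI)
      fix x y assume x: "x \<in> X" and y: "y \<in> X" and F: "\<not> F x" "F y"
      let ?a = "block_map n M g x" and ?b = "block_map n M g y"
      have bl: "blk M p x \<in> inputs M" "blk M p y \<in> inputs M"
        using blk_in_inputs pq(1) x y by (auto simp: X_def)
      have \<beta>: "\<beta> x = blk M p x ! q" "\<beta> y = blk M p y ! q"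
        using blk_nth_inputs[of _ n M p q] x y pq k(2) by (auto simp: X_def)
      have rest: "(\<Prod>i<n. h i) = h p * (\<Prod>i\<in>{..<n} - {p}. h i)" for h :: "nat \<Rightarrow> real"
        using pq(1) by (intro prod.remove) auto
      have restH: "(\<Prod>i\<in>{..<n} - {p}. H i (blk M i x) (blk M i y)) = (\<Prod>i\<in>{..<n} - {p}. Gg (blk M i x) (blk M i y))"
        by (intro prod.cong refl) (auto simp: H_def)
      have Kf': "Kf ?a ?b = \<Lambda>\<^sub>1 * Gf ?a ?b * (if g (blk M p x) \<noteq> g (blk M p y) then 1 else 0)"
        using Kf(2)[of ?a ?b] F pq(1) by (simp add: F_def)
      show "K x y = \<Lambda>\<^sub>1 * \<Lambda>\<^sub>2 * G x y * (if \<beta> x \<noteq> \<beta> y then 1 else 0)"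
      \<comment> \<open>If the values of block \<open>p\<close> agree, the outer mask kills the left
        side, and on the right two blocks differing in bit \<open>q\<close> are orthogonal members
        of one family.\<close>
      proof (cases "g (blk M p x) = g (blk M p y)")
        case True
        then have "Gg (blk M p x) (blk M p y) = 0" if "\<beta> x \<noteq> \<beta> y"
          using link_same[OF Lg bl True] that \<beta> by auto
        then show ?thesis using True Kf' by (auto simp: K_def G_def rest)
      next
        case False
        then show ?thesis
          using Kg(2)[OF bl False] Kf' \<beta> by (simp add: K_def G_def rest restH) (simp add: H_def)
      qed
    qed (rule link_gram[OF L])
  qed
  then show ?thesis
    using L sq val unfolding adversary_def aligned_def X_def F_def by blast
qed

text \<open>The hard inputs are the all-ones input, numbered \<open>n\<close>, and for each
  \<open>j < n\<close> the input with a single zero at \<open>j\<close>. The latter are basis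
  vectors, the former is the uniform vector. A query to \<open>i\<close> separates only the inputs
  \<open>i\<close> and \<open>n\<close>, whose entry 1 / sqrt n is scaled to 1 by the bound; so the
  \<open>i\<close>-th basis vector can take the place of the uniform one.\<close>

lemma adversary_and:
  assumes n: "n > 0"
  shows "adversary (inputs n) (\<lambda>x. \<forall>i<n. x ! i) (input_bits n) (sqrt (real n))"
proof -
  define f where "f j = (j = n)" for j :: nat
  define B where "B = (\<lambda>i j. j \<noteq> i) ` {..<n}"
  define v where "v c t j = (if j < n then (if t = j then 1 else 0) else c t :: real)" for c and t j :: nat
  define V where "V c j k = (\<Sum>t<n. v c t j * v c t k)" for c j k
  have s: "sqrt (real n) > 0" using n by simp
  have VT: "V c j n = c j" if "j < n" for c j
  proof -
    have "V c j n = (\<Sum>t<n. if t = j then c j else 0)"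
      using that unfolding V_def v_def by (intro sum.cong refl) auto
    then show ?thesis using that by simp
  qed
  have Vlt: "V c j k = (if j = k then 1 else 0)" if "j < n" "k < n" for c j k
  proof -
    have "V c j k = (\<Sum>t<n. if t = j then (if j = k then 1 else 0) else 0)"
      using that unfolding V_def v_def by (intro sum.cong refl) auto
    then show ?thesis using that(1) by simp
  qed
  have linkV: "link {..n} f (V c)" if "(\<Sum>t<n. (c t)\<^sup>2) = 1" for c
    unfolding link_def
  proof (intro conjI ballI impI)
    show "gram {..n} (V c)" by (rule gramI[of "{..<n}"]) (auto simp: V_def)
    fix j k assume "j \<in> {..n}" "k \<in> {..n}" "f j = f k"
    then consider "j < n" "k < n" | "j = n" "k = n" by (auto simp: f_def)
    then show "V c j k = (if j = k then 1 else 0)"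
    proof cases
      case 2
      have "V c n n = (\<Sum>t<n. (c t)\<^sup>2)" by (simp add: V_def v_def power2_eq_square)
      then show ?thesis using 2 that by simp
    qed (simp add: Vlt)
  qed
  define c where "c = (\<lambda>t::nat. 1 / sqrt (real n))"
  have c1: "(\<Sum>t<n. (c t)\<^sup>2) = 1" using n by (simp add: c_def power_divide)
  define w where "w j = (if j < n then 1 / sqrt (real n) else 1)" for j
  have sets: "{j \<in> {..n}. f j = b} = (if b then {n} else {..<n})" for b
    by (auto simp: f_def)
  have sets': "{j. j \<le> n \<and> \<not> f j} = {..<n}" "{j. j \<le> n \<and> f j} = {n}"
    by (auto simp: f_def)
  have "aligned {..n} f (V c) w"
    unfolding aligned_def
  proof (intro conjI allI)
    show "(\<Sum>x | x \<in> {..n} \<and> f x = b. (w x)\<^sup>2) = 1" for b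
      using n by (cases b) (auto simp: sets sets' w_def power_divide)
    show "(\<Sum>x | x \<in> {..n} \<and> \<not> f x. \<Sum>y | y \<in> {..n} \<and> f y. w x * w y * V c x y) = 1"
      using n by (simp add: sets' w_def VT c_def)
  qed
  moreover have "query_link {..n} f (V c) (sqrt (real n)) \<beta>" if \<beta>: "\<beta> \<in> B" for \<beta>
  proof -
    obtain i where i: "i < n" "\<beta> = (\<lambda>j. j \<noteq> i)" using \<beta> by (auto simp: B_def)
    show ?thesis
    proof (rule query_linkI[OF linkV])
      show "(\<Sum>t<n. (if t = i then 1 else 0 :: real)\<^sup>2) = 1"
        using i by (subst sum.cong[OF refl, where h = "\<lambda>t. if t = i then 1 else 0"]) auto
      fix j k assume "j \<in> {..n}" "k \<in> {..n}" "\<not> f j" "f k"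
      then have "j < n" "k = n" by (auto simp: f_def)
      then show "V (\<lambda>t. if t = i then 1 else 0) j k = sqrt (real n) * V c j k * (if \<beta> j \<noteq> \<beta> k then 1 else 0)"
        using i s by (simp add: VT c_def)
    qed (rule link_gram[OF linkV[OF c1]])
  qed
  ultimately have adv: "adversary {..n} f B (sqrt (real n))"
    using linkV[OF c1] unfolding adversary_def by blast
  define \<phi> where "\<phi> j = map (\<lambda>i. i \<noteq> j) [0..<n]" for j
  show ?thesis
  proof (rule adversary_embed[OF adv, where \<phi> = \<phi>])
    show "inj_on \<phi> {..n}"
    proof (rule inj_onI)
      fix j k assume jk: "j \<in> {..n}" "k \<in> {..n}" "\<phi> j = \<phi> k"
      have "i \<noteq> j \<longleftrightarrow> i \<noteq> k" if "i < n" for i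
        using arg_cong[OF jk(3), of "\<lambda>z. z ! i"] that by (simp add: \<phi>_def)
      then show "j = k" using jk(1,2) by (metis atMost_iff le_neq_implies_less)
    qed
    fix \<gamma> assume "\<gamma> \<in> input_bits n"
    then obtain i where "i < n" "\<gamma> = (\<lambda>x. x ! i)" by (auto simp: input_bits_def)
    then show "(\<exists>c. \<forall>x\<in>{..n}. \<gamma> (\<phi> x) = c) \<or>
        (\<exists>\<beta>\<in>B. (\<forall>x\<in>{..n}. \<gamma> (\<phi> x) = \<beta> x) \<or> (\<forall>x\<in>{..n}. \<gamma> (\<phi> x) = (\<not> \<beta> x)))"
      by (rule_tac disjI2, rule_tac bexI[of _ "\<lambda>j. j \<noteq> i"], rule_tac disjI1) (auto simp: B_def \<phi>_def)
  next
    fix j assume "j \<in> {..n}"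
    then show "(\<forall>i<n. \<phi> j ! i) = f j"
      by (auto simp: \<phi>_def f_def) (metis le_neq_implies_less)
  qed (use finite_inputs in \<open>simp_all add: \<phi>_def inputs_def\<close>)
qed

subsection \<open>Adversary bounds from matrices\<close>

definition quad :: "'a set \<Rightarrow> ('a \<Rightarrow> 'a \<Rightarrow> real) \<Rightarrow> ('a \<Rightarrow> real) \<Rightarrow> real" where
  "quad X M a = (\<Sum>x\<in>X. \<Sum>y\<in>X. M x y * (a x * a y))"

lemma quad_insert:
  assumes "finite X" "z \<notin> X" "\<And>x. x \<in> X \<Longrightarrow> M x z = M z x"
  shows "quad (insert z X) M a = M z z * (a z)\<^sup>2 + 2 * a z * (\<Sum>x\<in>X. M z x * a x) + quad X M a"
proof -
  have "quad (insert z X) M a = M z z * (a z * a z) + (\<Sum>y\<in>X. M z y * (a z * a y))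
      + ((\<Sum>x\<in>X. M x z * (a x * a z)) + quad X M a)"
    using assms(1,2) by (simp add: quad_def sum.distrib)
  also have "(\<Sum>x\<in>X. M x z * (a x * a z)) = a z * (\<Sum>x\<in>X. M z x * a x)"
    using assms(3) by (simp add: sum_distrib_left mult_ac)
  also have "(\<Sum>y\<in>X. M z y * (a z * a y)) = a z * (\<Sum>x\<in>X. M z x * a x)"
    by (simp add: sum_distrib_left mult_ac)
  finally show ?thesis by (simp add: power2_eq_square algebra_simps)
qed

text \<open>Cholesky decomposition, one Schur complement at a time.\<close>

lemma gram_if_psd:
  assumes "finite X" "\<And>x y. x \<in> X \<Longrightarrow> y \<in> X \<Longrightarrow> M x y = M y x" "\<And>a. quad X M a \<ge> 0"
  shows "gram X M"
  using assms
proof (induction X arbitrary: M rule: finite_induct)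
  case empty
  show ?case by (rule gramI[of "{}"]) auto
next
  case (insert z X)
  have sym: "M x y = M y x" if "x \<in> insert z X" "y \<in> insert z X" for x y
    using insert.prems(1) that by blast
  have q: "0 \<le> M z z * (a z)\<^sup>2 + 2 * a z * (\<Sum>x\<in>X. M z x * a x) + quad X M a" for a
    using insert.prems(2)[of a] quad_insert[OF insert.hyps(1,2), of M a] sym by auto
  have upd: "quad X M' (\<lambda>x. if x = z then c else a x) = quad X M' a"
    "(\<Sum>x\<in>X. M z x * (if x = z then c else a x)) = (\<Sum>x\<in>X. M z x * a x)" for a c M'
    unfolding quad_def using insert.hyps(2) by (auto intro!: sum.cong)
  have q': "0 \<le> M z z * c\<^sup>2 + 2 * c * (\<Sum>x\<in>X. M z x * a x) + quad X M a" for a c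
    using q[of "\<lambda>x. if x = z then c else a x"] unfolding upd by simp
  have "0 \<le> M z z"
    using q'[of 1 "\<lambda>_. 0"] by (simp add: quad_def)
  then consider "M z z = 0" | "M z z > 0" by linarith
  then show ?case
  proof cases
    case 1
    have zero: "M z x = 0" if x: "x \<in> X" for x
    proof (rule ccontr)
      assume nz: "M z x \<noteq> 0"
      have s: "(\<Sum>y\<in>X. M z y * (if y = x then 1 else 0)) = M z x"
      proof -
        have "(\<Sum>y\<in>X. M z y * (if y = x then 1 else 0)) = (\<Sum>y\<in>X. if y = x then M z y else 0)"
          by (intro sum.cong refl) auto
        then show ?thesis using x insert.hyps(1) by simp
      qed
      define r where "r = quad X M (\<lambda>y. if y = x then 1 else 0)"
      have pos: "0 \<le> 2 * c * M z x + r" for c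
        using q'[of c "\<lambda>y. if y = x then 1 else 0"] 1 s by (simp add: r_def)
      \<comment> \<open>With this \<open>c\<close> the expression in \<open>pos\<close> would be
        -1.\<close>
      have "2 * (- (r + 1) / (2 * M z x)) * M z x = - (r + 1)"
        using nz by (simp add: field_simps)
      with pos[of "- (r + 1) / (2 * M z x)"] show False by linarith
    qed
    have "gram X M"
      using q'[of 0] sym by (intro insert.IH) auto
    then have "gram (insert z X) (\<lambda>x y. if x \<in> X \<and> y \<in> X then M x y else 0)"
      by (rule gram_ext_zero)
    then show ?thesis
      by (rule gram_cong) (use 1 zero sym in auto)
  next
    case 2
    define M' where "M' x y = M x y - M z x * M z y / M z z" for x y
    have "gram X M'"
    proof (rule insert.IH)
      show "M' x y = M' y x" if "x \<in> X" "y \<in> X" for x y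
        using sym that by (simp add: M'_def mult.commute)
      fix a
      define l where "l = (\<Sum>x\<in>X. M z x * a x)"
      have "l\<^sup>2 = (\<Sum>x\<in>X. \<Sum>y\<in>X. M z x * M z y * (a x * a y))"
        by (simp add: l_def power2_eq_square sum_product mult_ac)
      then have "quad X M' a = quad X M a - l\<^sup>2 / M z z"
        by (simp add: quad_def M'_def left_diff_distrib sum_subtractf sum_divide_distrib)
      \<comment> \<open>The minimiser of the quadratic polynomial in the coordinate of
        \<open>z\<close>.\<close>
      moreover have "0 \<le> M z z * (- l / M z z)\<^sup>2 + 2 * (- l / M z z) * l + quad X M a"
        unfolding l_def by (rule q')
      moreover have "M z z * (- l / M z z)\<^sup>2 + 2 * (- l / M z z) * l = - (l\<^sup>2 / M z z)"
        using 2 by (simp add: field_simps power2_eq_square)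
      ultimately show "0 \<le> quad X M' a" by linarith
    qed
    then have g: "gram (insert z X) (\<lambda>x y. if x \<in> X \<and> y \<in> X then M' x y else 0)"
      by (rule gram_ext_zero)
    have "gram (insert z X) (\<lambda>x y. (M z x / sqrt (M z z)) * (M z y / sqrt (M z z))
        + (if x \<in> X \<and> y \<in> X then M' x y else 0))"
      by (rule gram_add[OF gram_rank_one g])
    then show ?thesis
    proof (rule gram_cong)
      fix x y assume xy: "x \<in> insert z X" "y \<in> insert z X"
      have "(M z x / sqrt (M z z)) * (M z y / sqrt (M z z)) = M z x * M z y / M z z"
        using 2 by simp
      then show "M x y = (M z x / sqrt (M z z)) * (M z y / sqrt (M z z))
        + (if x \<in> X \<and> y \<in> X then M' x y else 0)"
        using xy 2 sym[of x z] by (auto simp: M'_def)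
    qed
  qed
qed

definition form :: "'a set \<Rightarrow> ('a \<Rightarrow> bool) \<Rightarrow> ('a \<Rightarrow> 'a \<Rightarrow> real) \<Rightarrow> ('a \<Rightarrow> real) \<Rightarrow> ('a \<Rightarrow> real) \<Rightarrow> real" where
  "form X f A a b = (\<Sum>x | x \<in> X \<and> \<not> f x. \<Sum>y | y \<in> X \<and> f y. A x y * (a x * b y))"

definition sqn :: "'a set \<Rightarrow> ('a \<Rightarrow> real) \<Rightarrow> real" where
  "sqn X a = (\<Sum>x\<in>X. (a x)\<^sup>2)"

text \<open>The symmetric matrix with identity diagonal blocks and cross block \<open>A\<close> is
  positive semidefinite exactly if \<open>A\<close> is a contraction; \<open>gram_if_psd\<close>
  then yields the vectors.\<close>

lemma link_if_contraction:
  assumes fin: "finite X"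
    and A: "\<And>a b. \<bar>form X f A a b\<bar> \<le> (sqn {x \<in> X. \<not> f x} a + sqn {x \<in> X. f x} b) / 2"
  shows "\<exists>K. link X f K \<and> (\<forall>x\<in>X. \<forall>y\<in>X. \<not> f x \<longrightarrow> f y \<longrightarrow> K x y = A x y)"
proof -
  define K where "K x y = (if f x = f y then (if x = y then 1 else 0) else if f y then A x y else A y x)" for x y
  have "quad X K a \<ge> 0" for a
  proof -
    let ?X = "{x \<in> X. \<not> f x}" and ?Y = "{x \<in> X. f x}"
    have split: "(\<Sum>x\<in>X. h x) = (\<Sum>x\<in>?X. h x) + (\<Sum>x\<in>?Y. h x)" for h :: "'a \<Rightarrow> real"
      using fin by (subst sum.union_disjoint[symmetric]) (auto intro!: sum.cong)
    have diag: "(\<Sum>x | x \<in> X \<and> f x = c. \<Sum>y | y \<in> X \<and> f y = c. K x y * (a x * a y)) = sqn {x \<in> X. f x = c} a" for c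
    proof -
      have "(\<Sum>x | x \<in> X \<and> f x = c. \<Sum>y | y \<in> X \<and> f y = c. K x y * (a x * a y))
          = (\<Sum>x | x \<in> X \<and> f x = c. \<Sum>y | y \<in> X \<and> f y = c. if x = y then (a x)\<^sup>2 else 0)"
        by (intro sum.cong refl) (auto simp: K_def power2_eq_square)
      then show ?thesis using fin by (simp add: sqn_def)
    qed
    have cross: "(\<Sum>x\<in>?X. \<Sum>y\<in>?Y. K x y * (a x * a y)) = form X f A a a"
      unfolding form_def by (intro sum.cong refl) (auto simp: K_def)
    have "(\<Sum>y\<in>?X. \<Sum>x\<in>?Y. K x y * (a x * a y)) = form X f A a a"
      unfolding form_def by (intro sum.cong refl) (auto simp: K_def mult.commute)
    then have cross': "(\<Sum>x\<in>?Y. \<Sum>y\<in>?X. K x y * (a x * a y)) = form X f A a a"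
      by (subst sum.swap)
    have "quad X K a = sqn ?X a + form X f A a a + (form X f A a a + sqn ?Y a)"
      unfolding quad_def split sum.distrib using diag[of False] diag[of True] cross cross' by simp
    then show ?thesis using A[of a a] by (simp add: abs_le_iff)
  qed
  then have "gram X K" using fin by (intro gram_if_psd) (auto simp: K_def)
  then show ?thesis by (intro exI[of _ K]) (auto simp: link_def K_def)
qed

lemma form_scale: "form X f A (\<lambda>x. s * a x) (\<lambda>x. t * b x) = s * t * form X f A a b"
  by (simp add: form_def sum_distrib_left mult_ac)

lemma sqn_scale: "sqn X (\<lambda>x. s * a x) = s\<^sup>2 * sqn X a"
  by (simp add: sqn_def sum_distrib_left power_mult_distrib)

lemma sqn_nonneg: "0 \<le> sqn X a"
  by (simp add: sqn_def sum_nonneg)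

lemma sqn_eq_0: "finite X \<Longrightarrow> sqn X a = 0 \<Longrightarrow> x \<in> X \<Longrightarrow> a x = 0"
  by (simp add: sqn_def sum_nonneg_eq_0_iff)

text \<open>Compactness of a product of two unit spheres: \<open>aligned\<close> asks for a norm
  that is attained, not just approached. The points of the product topology over \<open>X\<close>
  are extensional functions; hence the restrictions to \<open>X\<close>.\<close>

lemma norm_attained:
  fixes A :: "'a \<Rightarrow> 'a \<Rightarrow> real"
  assumes fin: "finite X" and ne: "sqn {x \<in> X. \<not> f x} u = 1" "sqn {x \<in> X. f x} u = 1"
  shows "\<exists>w. sqn {x \<in> X. \<not> f x} w = 1 \<and> sqn {x \<in> X. f x} w = 1 \<and>
    (\<forall>a. sqn {x \<in> X. \<not> f x} a = 1 \<longrightarrow> sqn {x \<in> X. f x} a = 1 \<longrightarrow> form X f A a a \<le> form X f A w w)"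
proof -
  define T where "T = product_topology (\<lambda>_::'a. euclideanreal) X"
  define C where "C = PiE X (\<lambda>_. {-1..1::real})"
  define S where "S b = {a \<in> topspace T. sqn {x \<in> X. f x = b} a \<in> {1}}" for b
  have proj: "continuous_map T euclideanreal (\<lambda>a. a x)" if "x \<in> X" for x
    unfolding T_def by (rule continuous_map_product_projection[OF that])
  have cont: "continuous_map T euclideanreal (\<lambda>a. sqn {x \<in> X. f x = b} a)" for b
    unfolding sqn_def power2_eq_square
    using fin by (intro continuous_map_sum continuous_map_real_mult proj) auto
  have "compactin T C"
    unfolding T_def C_def compactin_PiE by auto
  moreover have "closedin T (S False \<inter> S True)"
    unfolding S_def by (intro closedin_Int closedin_continuous_map_preimage[OF cont]) auto
  ultimately have comp: "compactin T (C \<inter> (S False \<inter> S True))"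
    by (rule compact_Int_closedin)
  have fcont: "continuous_map T euclideanreal (\<lambda>a. form X f A a a)"
    unfolding form_def
    using fin by (intro continuous_map_sum continuous_map_real_mult proj) auto
  let ?D = "(\<lambda>a. form X f A a a) ` (C \<inter> (S False \<inter> S True))"
  have cD: "compact ?D"
    using image_compactin[OF comp fcont] by simp
  have inD: "restrict a X \<in> C \<inter> (S False \<inter> S True)"
    if a: "sqn {x \<in> X. \<not> f x} a = 1" "sqn {x \<in> X. f x} a = 1" for a
  proof -
    have eq: "sqn {x \<in> X. f x = b} (restrict a X) = 1" for b
    proof -
      have "sqn {x \<in> X. f x = b} (restrict a X) = sqn {x \<in> X. f x = b} a"
        unfolding sqn_def by (intro sum.cong refl) auto
      then show ?thesis using a by (cases b) auto
    qed
    have "\<bar>a x\<bar> \<le> 1" if x: "x \<in> X" for x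
    proof -
      have "(a x)\<^sup>2 \<le> sqn {y \<in> X. f y = f x} a"
        unfolding sqn_def by (rule member_le_sum) (use x fin in auto)
      also have "\<dots> = 1" using a by (cases "f x") auto
      finally show ?thesis by (simp add: abs_square_le_1)
    qed
    then have "restrict a X \<in> C" unfolding C_def by (auto simp: abs_le_iff)
    then show ?thesis using eq[of False] eq[of True] by (simp add: S_def T_def)
  qed
  have "?D \<noteq> {}" using inD[OF ne] by blast
  from compact_attains_sup[OF cD this] obtain w
    where w: "w \<in> C \<inter> (S False \<inter> S True)"
      and max: "\<And>a. a \<in> C \<inter> (S False \<inter> S True) \<Longrightarrow> form X f A a a \<le> form X f A w w" by auto
  have "form X f A a a \<le> form X f A w w"
    if "sqn {x \<in> X. \<not> f x} a = 1" "sqn {x \<in> X. f x} a = 1" for a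
  proof -
    have "form X f A (restrict a X) (restrict a X) = form X f A a a"
      unfolding form_def by (intro sum.cong refl) auto
    then show ?thesis using max[OF inD[OF that]] by simp
  qed
  then show ?thesis using w unfolding S_def by (intro exI[of _ w]) auto
qed

lemma form_cong:
  assumes "\<And>x. x \<in> X \<Longrightarrow> \<not> f x \<Longrightarrow> a x = a' x" "\<And>x. x \<in> X \<Longrightarrow> f x \<Longrightarrow> b x = b' x"
  shows "form X f A a b = form X f A a' b'"
  unfolding form_def by (intro sum.cong refl) (use assms in auto)

lemma sqn_cong: "(\<And>x. x \<in> X \<Longrightarrow> a x = b x) \<Longrightarrow> sqn X a = sqn X b"
  by (simp add: sqn_def)

text \<open>The interface from explicit matrices to \<open>adversary\<close>. The matrix is divided
  by its true norm \<open>\<mu>\<close>, attained at \<open>w\<close>, of which the test vector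
  \<open>u\<close> only gives the lower estimate \<open>\<Lambda>\<close>; the bound obtained for
  \<open>\<mu>\<close> is lowered to \<open>\<Lambda>\<close> at the end.\<close>

theorem adversary_from_matrix:
  fixes A :: "'a \<Rightarrow> 'a \<Rightarrow> real"
  assumes fin: "finite X" and \<Lambda>: "\<Lambda> > 0"
    and D: "\<And>\<beta> a b. \<beta> \<in> B \<Longrightarrow>
      \<bar>form X f (\<lambda>x y. A x y * (if \<beta> x \<noteq> \<beta> y then 1 else 0)) a b\<bar>
        \<le> (sqn {x \<in> X. \<not> f x} a + sqn {x \<in> X. f x} b) / 2"
    and u: "sqn {x \<in> X. \<not> f x} u = 1" "sqn {x \<in> X. f x} u = 1" "form X f A u u \<ge> \<Lambda>"
  shows "adversary X f B \<Lambda>"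
proof -
  let ?X = "{x \<in> X. \<not> f x}" and ?Y = "{x \<in> X. f x}"
  obtain w where w: "sqn ?X w = 1" "sqn ?Y w = 1"
    and max: "\<And>a. sqn ?X a = 1 \<Longrightarrow> sqn ?Y a = 1 \<Longrightarrow> form X f A a a \<le> form X f A w w"
    using norm_attained[OF fin u(1,2), of A] by blast
  define \<mu> where "\<mu> = form X f A w w"
  have \<mu>: "\<mu> \<ge> \<Lambda>" using max[OF u(1,2)] u(3) by (simp add: \<mu>_def)
  have upper: "form X f A a b \<le> \<mu> * (sqn ?X a + sqn ?Y b) / 2" for a b
  proof (cases "sqn ?X a = 0 \<or> sqn ?Y b = 0")
    case True
    then have "form X f A a b = 0"
    proof
      assume "sqn ?X a = 0"
      then have "a x = 0" if "x \<in> X" "\<not> f x" for x using sqn_eq_0[of ?X a x] fin that by simp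
      then show ?thesis by (simp add: form_def)
    next
      assume "sqn ?Y b = 0"
      then have "b x = 0" if "x \<in> X" "f x" for x using sqn_eq_0[of ?Y b x] fin that by simp
      then show ?thesis by (simp add: form_def)
    qed
    then show ?thesis using \<mu> \<Lambda> sqn_nonneg[of ?X a] sqn_nonneg[of ?Y b] by simp
  next
    case False
    define p q where "p = sqrt (sqn ?X a)" and "q = sqrt (sqn ?Y b)"
    have pq: "p > 0" "q > 0" "p\<^sup>2 = sqn ?X a" "q\<^sup>2 = sqn ?Y b"
      using False sqn_nonneg[of ?X a] sqn_nonneg[of ?Y b] by (auto simp: p_def q_def)
    \<comment> \<open>Scaling both halves to unit length makes \<open>max\<close> applicable;
      \<open>2 * p * q \<le> p\<^sup>2 + q\<^sup>2\<close> brings back the squared norms.\<close>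
    define c where "c x = (if f x then b x / q else a x / p)" for x
    have cX: "sqn ?X c = sqn ?X (\<lambda>x. (1 / p) * a x)" and cY: "sqn ?Y c = sqn ?Y (\<lambda>x. (1 / q) * b x)"
      by (auto intro!: sqn_cong simp: c_def)
    have "sqn ?X c = 1" "sqn ?Y c = 1"
      unfolding cX cY sqn_scale using pq(3,4)[symmetric] pq(1,2) by (simp_all add: power_divide)
    then have "form X f A c c \<le> \<mu>" unfolding \<mu>_def by (rule max)
    moreover have "form X f A c c = form X f A (\<lambda>x. (1 / p) * a x) (\<lambda>x. (1 / q) * b x)"
      by (rule form_cong) (auto simp: c_def)
    moreover have "\<dots> = form X f A a b / (p * q)" unfolding form_scale by simp
    ultimately have "form X f A a b / (p * q) \<le> \<mu>" by simp
    then have "form X f A a b \<le> \<mu> * (p * q)" using pq by (simp add: pos_divide_le_eq)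
    also have "\<dots> \<le> \<mu> * ((p\<^sup>2 + q\<^sup>2) / 2)"
      using \<mu> \<Lambda> sum_squares_bound[of p q] by (intro mult_left_mono) (auto simp: power2_eq_square)
    finally show ?thesis using pq by simp
  qed
  have abs: "\<bar>form X f (\<lambda>x y. A x y / \<mu>) a b\<bar> \<le> (sqn ?X a + sqn ?Y b) / 2" for a b
  proof -
    have div: "form X f (\<lambda>x y. A x y / \<mu>) a b = form X f A a b / \<mu>"
      by (simp add: form_def sum_divide_distrib)
    \<comment> \<open>Negating \<open>a\<close> gives the bound from below.\<close>
    have "form X f A (\<lambda>x. (- 1) * a x) (\<lambda>x. 1 * b x) = - form X f A a b" unfolding form_scale by simp
    moreover have "sqn ?X (\<lambda>x. (- 1) * a x) = sqn ?X a" unfolding sqn_scale by simp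
    ultimately have "- form X f A a b \<le> \<mu> * (sqn ?X a + sqn ?Y b) / 2"
      using upper[of "\<lambda>x. (- 1) * a x" "\<lambda>x. 1 * b x"] by simp
    then have "\<bar>form X f A a b\<bar> \<le> \<mu> * (sqn ?X a + sqn ?Y b) / 2" using upper[of a b] by simp
    then show ?thesis unfolding div using \<mu> \<Lambda> by (simp add: field_simps)
  qed
  obtain G where G: "link X f G" "\<And>x y. x \<in> X \<Longrightarrow> y \<in> X \<Longrightarrow> \<not> f x \<Longrightarrow> f y \<Longrightarrow> G x y = A x y / \<mu>"
    using link_if_contraction[OF fin abs] by blast
  have al: "aligned X f G w"
    unfolding aligned_def
  proof (intro conjI allI)
    show "(\<Sum>x | x \<in> X \<and> f x = b. (w x)\<^sup>2) = 1" for b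
      using w by (cases b) (auto simp: sqn_def)
    have "(\<Sum>x\<in>?X. \<Sum>y\<in>?Y. w x * w y * G x y) = (\<Sum>x\<in>?X. \<Sum>y\<in>?Y. (A x y * (w x * w y)) / \<mu>)"
      by (intro sum.cong refl) (simp add: G(2))
    also have "\<dots> = \<mu> / \<mu>" unfolding \<mu>_def form_def sum_divide_distrib[symmetric] by (rule refl)
    finally show "(\<Sum>x\<in>?X. \<Sum>y\<in>?Y. w x * w y * G x y) = 1" using \<mu> \<Lambda> by simp
  qed
  have "query_link X f G \<mu> \<beta>" if \<beta>: "\<beta> \<in> B" for \<beta>
  proof -
    obtain K where K: "link X f K" "\<And>x y. x \<in> X \<Longrightarrow> y \<in> X \<Longrightarrow> \<not> f x \<Longrightarrow> f y \<Longrightarrow>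
        K x y = A x y * (if \<beta> x \<noteq> \<beta> y then 1 else 0)"
      using link_if_contraction[OF fin D[OF \<beta>]] by blast
    show ?thesis
      by (rule query_linkI[OF K(1)]) (use K(2) G \<mu> \<Lambda> link_gram in auto)
  qed
  then have "adversary X f B \<mu>" using G(1) al unfolding adversary_def by blast
  then show ?thesis using adversary_mono[OF fin] \<mu> \<Lambda> by auto
qed

subsection \<open>Cheat sheets\<close>

text \<open>A tensor product over the blocks of \<open>snd p\<close> in which every factor also sees
  the common hidden bit \<open>fst p\<close>.\<close>

definition lift :: "nat \<Rightarrow> nat \<Rightarrow> (nat \<Rightarrow> bool \<times> bool list \<Rightarrow> bool \<times> bool list \<Rightarrow> real)
    \<Rightarrow> bool \<times> bool list \<Rightarrow> bool \<times> bool list \<Rightarrow> real" where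
  "lift l M H p q = (\<Prod>j<l. H j (fst p, blk M j (snd p)) (fst q, blk M j (snd q)))"

text \<open>Outside \<open>Z\<close> the points get private unit vectors. This is made for the bits
  of a cell, whose kernel becomes orthonormal after discarding the filled inputs that the bit cannot
  reveal.\<close>

lemma link_lift:
  assumes gram: "\<And>j. j < l \<Longrightarrow> gram (UNIV \<times> inputs M) (H j)"
    and same: "\<And>t x y j. (t, x) \<in> Z \<Longrightarrow> (t, y) \<in> Z \<Longrightarrow> j < l \<Longrightarrow>
      H j (t, blk M j x) (t, blk M j y) = (if blk M j x = blk M j y then 1 else 0)"
    and Z: "Z \<subseteq> UNIV \<times> inputs (l * M)"
  shows "link (UNIV \<times> inputs (l * M)) fst
    (\<lambda>p q. (if p \<in> Z \<and> q \<in> Z then lift l M H p q else 0) + (if p \<notin> Z \<and> p = q then 1 else 0))"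
  unfolding link_def
proof (intro conjI ballI impI)
  let ?X = "(UNIV :: bool set) \<times> inputs (l * M)"
  have g1: "gram Z (lift l M H)"
    unfolding lift_def
  proof (rule gram_prod)
    fix j assume j: "j \<in> {..<l}"
    have "(fst p, blk M j (snd p)) \<in> UNIV \<times> inputs M" if "p \<in> Z" for p
      using that Z j blk_in_inputs by auto
    then show "gram Z (\<lambda>p q. H j (fst p, blk M j (snd p)) (fst q, blk M j (snd q)))"
      using j by (intro gram_comp[OF gram, where h = "\<lambda>p. (fst p, blk M j (snd p))"]) auto
  qed
  have g2: "gram ?X (\<lambda>p q. if p \<in> ?X - Z \<and> q \<in> ?X - Z then if p = q then 1 else 0 else 0)"
    by (rule gram_ext_zero, rule gram_delta) simp
  have "gram ?X (\<lambda>p q. (if p \<in> Z \<and> q \<in> Z then lift l M H p q else 0)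
      + (if p \<in> ?X - Z \<and> q \<in> ?X - Z then if p = q then 1 else 0 else 0))"
    by (rule gram_add[OF gram_ext_zero[OF g1] g2])
  then show "gram ?X (\<lambda>p q. (if p \<in> Z \<and> q \<in> Z then lift l M H p q else 0)
      + (if p \<notin> Z \<and> p = q then 1 else 0))"
    by (rule gram_cong) auto
  fix p q assume pq: "p \<in> ?X" "q \<in> ?X" "fst p = fst q"
  show "(if p \<in> Z \<and> q \<in> Z then lift l M H p q else 0) + (if p \<notin> Z \<and> p = q then 1 else 0)
      = (if p = q then 1 else 0)"
  proof (cases "p \<in> Z \<and> q \<in> Z")
    case True
    obtain t x y where txy: "p = (t, x)" "q = (t, y)" using pq(3) by (cases p, cases q) auto
    have H: "H j (t, blk M j x) (t, blk M j y) = (if blk M j x = blk M j y then 1 else 0)" if "j < l" for j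
      using same True txy that by simp
    have "lift l M H p q = (if x = y then 1 else 0)"
    proof (cases "x = y")
      case False
      then obtain j where "j < l" "blk M j x \<noteq> blk M j y"
        using blk_ext[of x l M y] pq txy by auto
      then show ?thesis using H False by (auto simp: lift_def txy intro!: prod_zero)
    next
      case True
      have "(\<Prod>j<l. H j (t, blk M j x) (t, blk M j y)) = 1"
        by (rule prod.neutral) (use H True in auto)
      then show ?thesis using True by (simp add: lift_def txy)
    qed
    then show ?thesis using True txy by simp
  qed auto
qed

lemma prod_same_except:
  fixes p l :: nat
  assumes "p < l"
  shows "(\<Prod>j<l. if j = p then a else (b j :: real)) = a * (\<Prod>j\<in>{..<l} - {p}. b j)"
proof -
  have "(\<Prod>j<l. if j = p then a else b j) = a * (\<Prod>j\<in>{..<l} - {p}. if j = p then a else b j)"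
    by (subst prod.remove[of "{..<l}" p]) (use assms in auto)
  also have "(\<Prod>j\<in>{..<l} - {p}. if j = p then a else b j) = (\<Prod>j\<in>{..<l} - {p}. b j)"
    by (intro prod.cong) auto
  finally show ?thesis .
qed

text \<open>The second family models a bit of a cell: it deviates from the blank sheet only if the
  sheet is filled, and only for inputs whose vector of values of \<open>F\<close> is the one
  \<open>a\<close> that addresses this cell.\<close>

definition hidden_bits :: "nat \<Rightarrow> nat \<Rightarrow> (bool list \<Rightarrow> bool) \<Rightarrow> (bool \<times> bool list \<Rightarrow> bool) set" where
  "hidden_bits l M F = (\<lambda>k p. snd p ! k) ` {..<l * M} \<union>
     {\<lambda>p. fst p \<and> R (snd p) | R. \<exists>a. \<forall>x\<in>inputs (l * M). R x \<longrightarrow> block_map l M F x = a}"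

text \<open>
  Whether a hidden cheat sheet is filled cannot be detected without knowing all \<open>l\<close> values of
  \<open>F\<close>.  The two halves of the kernel are the \<open>l\<close>-fold tensor power of
  \<open>(1 + [\<tau> = \<tau>'] s s') G / 2\<close> with \<open>s = (-1)\<^sup>F\<close>, whose cross block \<open>G / 2\<close> spans all inputs.
\<close>

lemma adversary_hidden:
  assumes adv: "adversary (inputs M) F (input_bits M) \<Lambda>"
    and \<Lambda>': "0 \<le> \<Lambda>'" "\<Lambda>' \<le> 2 * \<Lambda>" "\<Lambda>' \<le> sqrt 2 ^ l"
  shows "adversary (UNIV \<times> inputs (l * M)) fst (hidden_bits l M F) \<Lambda>'"
proof -
  obtain G w where L: "link (inputs M) F G" and al: "aligned (inputs M) F G w"
    and Qb: "\<And>\<beta>. \<beta> \<in> input_bits M \<Longrightarrow> query_link (inputs M) F G \<Lambda> \<beta>"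
    using adv unfolding adversary_def by blast
  define X where "X = (UNIV :: bool set) \<times> inputs (l * M)"
  have finX: "finite X" by (simp add: X_def)
  define s where "s x = (if F x then 1 else - 1 :: real)" for x
  have ss: "s x * s y = (if F x = F y then 1 else - 1)" for x y by (auto simp: s_def)
  define g where "g p q = G (snd p) (snd q) * (1 / 2 * (1 + (if fst p = fst q then s (snd p) * s (snd q) else 0)))"
    for p q :: "bool \<times> bool list"
  have gram2: "gram ((UNIV :: bool set) \<times> inputs M) (\<lambda>p q. K (snd p) (snd q))" if "gram (inputs M) K" for K
    by (rule gram_comp[OF that]) auto
  have gram_g: "gram (UNIV \<times> inputs M) g"
  proof -
    have "gram (UNIV \<times> inputs M) (\<lambda>p q. ((if fst p then s (snd p) else 0) * (if fst q then s (snd q) else 0))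
       + ((if fst p then 0 else s (snd p)) * (if fst q then 0 else s (snd q))))"
      by (intro gram_add gram_rank_one)
    then have "gram (UNIV \<times> inputs M) (\<lambda>(p :: bool \<times> bool list) q. if fst p = fst q then s (snd p) * s (snd q) else 0)"
      by (rule gram_cong) auto
    then show ?thesis unfolding g_def[abs_def]
      by (intro gram_mult gram2[OF link_gram[OF L]] gram_scale gram_add gram_const) auto
  qed
  have g_same: "g (t, x) (t, y) = (if x = y then 1 else 0)" if "x \<in> inputs M" "y \<in> inputs M" for t x y
    using link_same[OF L that] by (auto simp: g_def ss)
  have g_cross: "g (False, x) (True, y) = G x y / 2" for x y by (simp add: g_def)
  define GG where "GG = lift l M (\<lambda>_. g)"
  have links: "link X fst (lift l M H)"
    if "\<And>j. j < l \<Longrightarrow> gram (UNIV \<times> inputs M) (H j)"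
      "\<And>j t x y. j < l \<Longrightarrow> x \<in> inputs M \<Longrightarrow> y \<in> inputs M \<Longrightarrow> H j (t, x) (t, y) = (if x = y then 1 else 0)" for H
  proof -
    have "link X fst (\<lambda>p q. (if p \<in> X \<and> q \<in> X then lift l M H p q else 0) + (if p \<notin> X \<and> p = q then 1 else 0))"
      unfolding X_def by (rule link_lift) (use that blk_in_inputs in auto)
    then show ?thesis unfolding link_def using gram_cong[of X _ "lift l M H"] by auto
  qed
  have LG: "link X fst GG" unfolding GG_def by (rule links) (auto simp: gram_g g_same)
  \<comment> \<open>Both values of \<open>F\<close> now occur on either side, so the squared weights
    \<open>w\<close> of a block sum to 2; hence the division by sqrt 2.\<close>
  define w' where "w' p = (\<Prod>j<l. w (blk M j (snd p)) / sqrt 2)" for p :: "bool \<times> bool list"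
  have img: "{p \<in> X. fst p = t} = Pair t ` inputs (l * M)" for t by (auto simp: X_def)
  have reidx: "(\<Sum>p | p \<in> X \<and> fst p = t. h p) = (\<Sum>x\<in>inputs (l * M). h (t, x))" for t and h :: "bool \<times> bool list \<Rightarrow> real"
    unfolding img by (subst sum.reindex) (auto simp: inj_on_def)
  have bs: "(\<Sum>x\<in>inputs (l * M). \<Prod>j<l. \<phi> j (blk M j x)) = (\<Prod>j<l. \<Sum>u\<in>inputs M. \<phi> j u)" for \<phi> :: "nat \<Rightarrow> bool list \<Rightarrow> real"
  proof -
    have "{x \<in> inputs (l * M). \<forall>j<l. blk M j x \<in> inputs M} = inputs (l * M)" using blk_in_inputs by auto
    then show ?thesis using block_sum[of l "\<lambda>_. inputs M" M \<phi>] by simp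
  qed
  have split: "(\<Sum>u\<in>inputs M. h u) = (\<Sum>u | u \<in> inputs M \<and> F u = False. h u) + (\<Sum>u | u \<in> inputs M \<and> F u = True. h u)"
    for h :: "bool list \<Rightarrow> real"
    by (subst sum.union_disjoint[symmetric]) (auto intro!: sum.cong)
  have "aligned X fst GG w'"
    unfolding aligned_def
  proof (intro conjI allI)
    fix t
    have "(\<Sum>u\<in>inputs M. (w u / sqrt 2)\<^sup>2) = 1"
      using al unfolding aligned_def split by (simp only: power_divide sum_divide_distrib[symmetric]) simp
    then show "(\<Sum>p | p \<in> X \<and> fst p = t. (w' p)\<^sup>2) = 1"
      unfolding reidx w'_def prod_power_distrib[symmetric] snd_conv
      using bs[of "\<lambda>_ u. (w u / sqrt 2)\<^sup>2"] by (simp add: prod_power_distrib)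
    have q: "(\<Sum>u\<in>inputs M. \<Sum>v\<in>inputs M. (w u / sqrt 2) * (w v / sqrt 2) * (G u v / 2)) = 1"
    proof -
      have "(\<Sum>u\<in>inputs M. \<Sum>v\<in>inputs M. (w u / sqrt 2) * (w v / sqrt 2) * (G u v / 2))
          = (\<Sum>u\<in>inputs M. \<Sum>v\<in>inputs M. w u * w v * G u v) / 4"
        unfolding sum_divide_distrib by (intro sum.cong refl) (simp add: field_simps)
      \<comment> \<open>Each of the four combinations of values of \<open>F\<close> contributes
        1.\<close>
      also have "(\<Sum>u\<in>inputs M. \<Sum>v\<in>inputs M. w u * w v * G u v) = 4"
        unfolding split sum.distrib aligned_all[OF L al finite_inputs] by simp
      finally show ?thesis by simp
    qed
    have "(\<Sum>p | p \<in> X \<and> fst p = False. \<Sum>q | q \<in> X \<and> fst q = True. w' p * w' q * GG p q)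
        = (\<Sum>x\<in>inputs (l * M). \<Sum>y\<in>inputs (l * M). \<Prod>j<l.
             (w (blk M j x) / sqrt 2) * (w (blk M j y) / sqrt 2) * (G (blk M j x) (blk M j y) / 2))"
      unfolding reidx w'_def GG_def lift_def fst_conv snd_conv g_cross prod.distrib by simp
    also have "\<dots> = (\<Sum>x\<in>inputs (l * M). \<Prod>j<l. \<Sum>v\<in>inputs M.
             (w (blk M j x) / sqrt 2) * (w v / sqrt 2) * (G (blk M j x) v / 2))"
      by (rule sum.cong[OF refl]) (rule bs[where \<phi> = "\<lambda>j v. (w (blk M j _) / sqrt 2) * (w v / sqrt 2) * (G (blk M j _) v / 2)"])
    also have "\<dots> = (\<Prod>j<l. \<Sum>u\<in>inputs M. \<Sum>v\<in>inputs M. (w u / sqrt 2) * (w v / sqrt 2) * (G u v / 2))"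
      by (rule bs[where \<phi> = "\<lambda>j u. \<Sum>v\<in>inputs M. (w u / sqrt 2) * (w v / sqrt 2) * (G u v / 2)"])
    also have "\<dots> = 1" unfolding q by simp
    finally show "(\<Sum>p | p \<in> X \<and> \<not> fst p. \<Sum>q | q \<in> X \<and> fst q. w' p * w' q * GG p q) = 1" by simp
  qed
  moreover have "query_link X fst GG \<Lambda>' \<beta>" if "\<beta> \<in> hidden_bits l M F" for \<beta>
    using that unfolding hidden_bits_def
  proof
    assume "\<beta> \<in> (\<lambda>k p. snd p ! k) ` {..<l * M}"
    then obtain k where k: "k < l * M" "\<beta> = (\<lambda>p. snd p ! k)" by auto
    define p q where "p = k div M" and "q = k mod M"
    have pq: "p < l" "q < M" "p * M + q = k"
      using div_mod_block[OF k(1)] by (auto simp: p_def q_def)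
    obtain K where K: "link (inputs M) F K" "\<And>x y. x \<in> inputs M \<Longrightarrow> y \<in> inputs M \<Longrightarrow> F x \<noteq> F y \<Longrightarrow>
        K x y = \<Lambda> * G x y * (if x ! q \<noteq> y ! q then 1 else 0)"
      using Qb[of "\<lambda>x. x ! q"] pq(2) unfolding query_link_def input_bits_def by auto
    define \<sigma> where "\<sigma> t = (if t then 1 else - 1 :: real)" for t
    \<comment> \<open>The sign \<open>\<sigma>\<close> makes the second factor the indicator of
      \<open>F x = F y\<close> within a side, where \<open>K\<close> is the identity kernel, and of
      \<open>F x \<noteq> F y\<close> across, where \<open>K\<close> is the masked
      \<open>\<Lambda> * G\<close>. Compared with the cross entry \<open>G / 2\<close> of
      \<open>g\<close> this gives \<open>2 * \<Lambda>\<close>.\<close>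
    define k1 where "k1 p q = K (snd p) (snd q) * (1 / 2 * (1 + (\<sigma> (fst p) * s (snd p)) * (\<sigma> (fst q) * s (snd q))))"
      for p q :: "bool \<times> bool list"
    have gk: "gram (UNIV \<times> inputs M) k1"
      unfolding k1_def[abs_def]
      by (intro gram_mult[OF gram2[OF link_gram[OF K(1)]]] gram_scale gram_add gram_const gram_rank_one) auto
    have k_same: "k1 (t, x) (t, y) = (if x = y then 1 else 0)" if "x \<in> inputs M" "y \<in> inputs M" for t x y
      using link_same[OF K(1) that] by (auto simp: k1_def \<sigma>_def s_def)
    have k_cross: "k1 (False, x) (True, y) = \<Lambda> * G x y * (if x ! q \<noteq> y ! q then 1 else 0)"
      if "x \<in> inputs M" "y \<in> inputs M" for x y
    proof (cases "F x = F y")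
      case True
      then show ?thesis using link_same[OF L that] by (auto simp: k1_def \<sigma>_def s_def)
    next
      case False
      then show ?thesis using K(2)[OF that] by (auto simp: k1_def \<sigma>_def s_def)
    qed
    have "link X fst (lift l M (\<lambda>j. if j = p then k1 else g))"
      by (rule links) (auto simp: gram_g gk g_same k_same)
    then have "query_link X fst GG (2 * \<Lambda>) \<beta>"
    proof (rule query_linkI)
      fix z z' assume z: "z \<in> X" "z' \<in> X" "\<not> fst z" "fst z'"
      then obtain x y where xy: "z = (False, x)" "z' = (True, y)" "x \<in> inputs (l * M)" "y \<in> inputs (l * M)"
        by (cases z, cases z') (auto simp: X_def)
      have bl: "blk M p x \<in> inputs M" "blk M p y \<in> inputs M" using blk_in_inputs pq(1) xy by auto
      have \<beta>: "\<beta> z = blk M p x ! q" "\<beta> z' = blk M p y ! q"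
        using blk_nth_inputs[of _ l M p q] xy pq k(2) by auto
      have "lift l M (\<lambda>j. if j = p then k1 else g) z z'
          = (\<Prod>j<l. if j = p then k1 (False, blk M p x) (True, blk M p y) else G (blk M j x) (blk M j y) / 2)"
        unfolding lift_def xy by (intro prod.cong refl) (auto simp: g_cross)
      also have "\<dots> = k1 (False, blk M p x) (True, blk M p y) * (\<Prod>j\<in>{..<l} - {p}. G (blk M j x) (blk M j y) / 2)"
        by (rule prod_same_except[OF pq(1)])
      finally have 1: "lift l M (\<lambda>j. if j = p then k1 else g) z z' = \<dots>" .
      have "GG z z' = (\<Prod>j<l. G (blk M j x) (blk M j y) / 2)"
        unfolding GG_def lift_def xy by (simp add: g_cross)
      also have "\<dots> = G (blk M p x) (blk M p y) / 2 * (\<Prod>j\<in>{..<l} - {p}. G (blk M j x) (blk M j y) / 2)"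
        using pq(1) by (intro prod.remove) auto
      finally show "lift l M (\<lambda>j. if j = p then k1 else g) z z' = 2 * \<Lambda> * GG z z' * (if \<beta> z \<noteq> \<beta> z' then 1 else 0)"
        unfolding 1 k_cross[OF bl] \<beta> by simp
    qed (rule link_gram[OF LG])
    then show ?thesis using query_link_mono[OF finX] \<Lambda>' by blast
  next
    assume "\<beta> \<in> {\<lambda>p. fst p \<and> R (snd p) | R. \<exists>a. \<forall>x\<in>inputs (l * M). R x \<longrightarrow> block_map l M F x = a}"
    then obtain R a where R: "\<beta> = (\<lambda>p. fst p \<and> R (snd p))"
      "\<And>x. x \<in> inputs (l * M) \<Longrightarrow> R x \<Longrightarrow> block_map l M F x = a" by auto
    \<comment> \<open>On the filled side only inputs with value vector \<open>a\<close> remain, and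
      among them \<open>G\<close> itself is an identity kernel in every block. So the filled side
      takes the factor 1, the empty side the indicator of \<open>F x = F y\<close>, and the cross
      entry is \<open>G / sqrt 2\<close> instead of \<open>G / 2\<close>: a gain of sqrt 2 per
      block.\<close>
    define Z where "Z = {p \<in> X. fst p \<longrightarrow> R (snd p)}"
    define h where "h p = (if fst p then 1 else 1 / sqrt 2)" for p :: "bool \<times> bool list"
    define h' where "h' p = (if fst p then 0 else s (snd p) / sqrt 2)" for p :: "bool \<times> bool list"
    define c where "c p q = G (snd p) (snd q) * (h p * h q + h' p * h' q)" for p q
    have gc: "gram (UNIV \<times> inputs M) c"
      unfolding c_def[abs_def]
      by (intro gram_mult[OF gram2[OF link_gram[OF L]]] gram_add gram_rank_one)
    define K where "K p q = (if p \<in> Z \<and> q \<in> Z then lift l M (\<lambda>_. c) p q else 0) + (if p \<notin> Z \<and> p = q then 1 else 0)"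
      for p q
    have "link X fst K"
      unfolding K_def[abs_def] X_def
    proof (rule link_lift)
      fix t x y j assume txy: "(t, x) \<in> Z" "(t, y) \<in> Z" and j: "j < l"
      have xy: "x \<in> inputs (l * M)" "y \<in> inputs (l * M)" using txy by (auto simp: Z_def X_def)
      have bl: "blk M j x \<in> inputs M" "blk M j y \<in> inputs M" using blk_in_inputs j xy by auto
      show "c (t, blk M j x) (t, blk M j y) = (if blk M j x = blk M j y then 1 else 0)"
      proof (cases t)
        case True
        then have "block_map l M F x = block_map l M F y"
          using txy R(2)[OF xy(1)] R(2)[OF xy(2)] by (simp add: Z_def)
        then have "F (blk M j x) = F (blk M j y)"
          using block_map_nth[OF j, of M F x] block_map_nth[OF j, of M F y] by simp
        then show ?thesis using True link_same[OF L bl] by (simp add: c_def h_def h'_def)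
      next
        case False
        have "h (False, blk M j x) * h (False, blk M j y) + h' (False, blk M j x) * h' (False, blk M j y)
            = (if F (blk M j x) = F (blk M j y) then 1 else 0)"
          by (simp add: h_def h'_def ss)
        then have "c (t, blk M j x) (t, blk M j y) = G (blk M j x) (blk M j y) * \<dots>"
          using False by (simp only: c_def fst_conv snd_conv)
        then show ?thesis using link_same[OF L bl] by auto
      qed
    qed (auto simp: gc Z_def X_def)
    then have "query_link X fst GG (sqrt 2 ^ l) \<beta>"
    proof (rule query_linkI)
      fix z z' assume z: "z \<in> X" "z' \<in> X" "\<not> fst z" "fst z'"
      then obtain x y where xy: "z = (False, x)" "z' = (True, y)" "x \<in> inputs (l * M)" "y \<in> inputs (l * M)"
        by (cases z, cases z') (auto simp: X_def)
      have r2: "sqrt 2 * (1 / 2) = 1 / sqrt 2" by (simp add: real_div_sqrt field_simps)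
      have "GG z z' = (\<Prod>j<l. G (blk M j x) (blk M j y)) * (1 / 2) ^ l"
        unfolding GG_def lift_def xy by (simp add: g_cross prod_dividef power_one_over)
      then have "sqrt 2 ^ l * GG z z' = (\<Prod>j<l. G (blk M j x) (blk M j y)) * (sqrt 2 * (1 / 2)) ^ l"
        by (simp only: power_mult_distrib mult_ac)
      moreover have "lift l M (\<lambda>_. c) z z' = (\<Prod>j<l. G (blk M j x) (blk M j y)) * (1 / sqrt 2) ^ l"
        unfolding lift_def xy by (simp add: c_def h_def h'_def prod_dividef power_one_over)
      ultimately have "lift l M (\<lambda>_. c) z z' = sqrt 2 ^ l * GG z z'" unfolding r2 by simp
      then show "K z z' = sqrt 2 ^ l * GG z z' * (if \<beta> z \<noteq> \<beta> z' then 1 else 0)"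
        using z xy by (auto simp: K_def Z_def R(1))
    qed (rule link_gram[OF LG])
    then show ?thesis using query_link_mono[OF finX] \<Lambda>' by blast
  qed
  ultimately show ?thesis using LG unfolding adversary_def X_def by blast
qed

section \<open>The cheat sheet function and its hard inputs\<close>

definition cheat_entry :: "nat \<Rightarrow> nat \<Rightarrow> nat \<Rightarrow> bool list \<Rightarrow> nat \<Rightarrow> nat \<Rightarrow> bool list" where
  "cheat_entry l M s z a j = blk s (a * l + j) (drop (l * M) z)"

definition cheat_len :: "nat \<Rightarrow> nat \<Rightarrow> nat \<Rightarrow> nat" where
  "cheat_len l M s = l * M + 2 ^ l * l * s"

text \<open>
  The cheat sheet version of \<open>F\<close>: \<open>l\<close> inputs of \<open>F\<close>, followed by \<open>2\<^sup>l\<close> cells of \<open>l\<close> entries, each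
  entry naming a partial assignment by \<open>s\<close> bits.
\<close>

definition cheat_sheet :: "nat \<Rightarrow> nat \<Rightarrow> nat \<Rightarrow> (bool list \<Rightarrow> nat) \<Rightarrow> (bool list \<Rightarrow> nat \<rightharpoonup> bool)
    \<Rightarrow> (bool list \<Rightarrow> bool) \<Rightarrow> bool list \<Rightarrow> bool" where
  "cheat_sheet l M s addr dec F z \<longleftrightarrow> (\<forall>j<l. certificate M F (blk M j z)
      (dec (cheat_entry l M s z (addr (block_map l M F z)) j)))"

text \<open>The hard sheets are blank everywhere, or filled with correct certificates in the one
  addressed cell. The word \<open>blank\<close> is accepted for no input, so the function value on
  these sheets is exactly the hidden bit.\<close>

theorem adversary_cheat_sheet:
  assumes adv: "adversary (inputs M) F (input_bits M) \<Lambda>"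
    and \<Lambda>': "0 \<le> \<Lambda>'" "\<Lambda>' \<le> 2 * \<Lambda>" "\<Lambda>' \<le> sqrt 2 ^ l" and l: "l > 0"
    and addr: "inj_on addr (inputs l)" "\<And>v. v \<in> inputs l \<Longrightarrow> addr v < 2 ^ l"
    and enc: "\<And>x. x \<in> inputs M \<Longrightarrow> enc x \<in> inputs s \<and> certificate M F x (dec (enc x))"
    and blank: "blank \<in> inputs s" "\<And>x. x \<in> inputs M \<Longrightarrow> \<not> certificate M F x (dec blank)"
  shows "adversary (inputs (cheat_len l M s)) (cheat_sheet l M s addr dec F)
    (input_bits (cheat_len l M s)) \<Lambda>'"
proof -
  define item where "item t x i = (if t \<and> i div l = addr (block_map l M F x) then enc (blk M (i mod l) x) else blank)"
    for t x i
  define sheet where "sheet t x = concat (map (item t x) [0..<2 ^ l * l])" for t x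
  define \<phi> where "\<phi> p = snd p @ sheet (fst p) (snd p)" for p :: "bool \<times> bool list"
  have item_len: "length (item t x i) = s" if "x \<in> inputs (l * M)" for t x i
    using enc[OF blk_in_inputs[OF that, of "i mod l"]] blank(1) l by (auto simp: item_def inputs_def)
  have sheet_len: "length (sheet t x) = 2 ^ l * l * s" if "x \<in> inputs (l * M)" for t x
    unfolding sheet_def by (rule length_concat_blocks) (rule item_len[OF that])
  have \<phi>_in: "\<phi> (t, x) \<in> inputs (cheat_len l M s)" if "x \<in> inputs (l * M)" for t x
    using sheet_len[OF that] that by (simp add: \<phi>_def cheat_len_def inputs_def)
  have drop: "drop (l * M) (\<phi> (t, x)) = sheet t x" if "x \<in> inputs (l * M)" for t x
    using that by (simp add: \<phi>_def inputs_def)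
  have blk: "blk M j (\<phi> (t, x)) = blk M j x" if "x \<in> inputs (l * M)" "j < l" for t x j
  proof -
    have "j * M + M \<le> length x" using that block_bound[of j l M] by (simp add: inputs_def)
    then show ?thesis by (simp add: blk_def \<phi>_def)
  qed
  have bm: "block_map l M F (\<phi> (t, x)) = block_map l M F x" if "x \<in> inputs (l * M)" for t x
    using blk[OF that] by (simp add: block_map_def)
  have entry: "cheat_entry l M s (\<phi> (t, x)) a j = (if t \<and> a = addr (block_map l M F x) then enc (blk M j x) else blank)"
    if "x \<in> inputs (l * M)" "a < 2 ^ l" "j < l" for t x a j
  proof -
    have "a * l + j < a * l + l" using that(3) by simp
    also have "a * l + l \<le> 2 ^ l * l" using block_bound[OF that(2), of l] .
    finally have "blk s (a * l + j) (sheet t x) = item t x (a * l + j)"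
      unfolding sheet_def using blk_concat[of "2 ^ l * l" "item t x" s "a * l + j" "[]"] item_len[OF that(1)] by simp
    then show ?thesis using that by (simp add: cheat_entry_def drop item_def)
  qed
  have val: "cheat_sheet l M s addr dec F (\<phi> (t, x)) = t" if x: "x \<in> inputs (l * M)" for t x
  proof -
    have a: "addr (block_map l M F x) < 2 ^ l" by (rule addr(2)) simp
    have "certificate M F (blk M j x) (dec (if t then enc (blk M j x) else blank)) = t" if "j < l" for j
      using enc[OF blk_in_inputs[OF x that]] blank(2)[OF blk_in_inputs[OF x that]] by simp
    then show ?thesis using l by (auto simp: cheat_sheet_def bm[OF x] blk[OF x] entry[OF x a])
  qed
  show ?thesis
  proof (rule adversary_embed[OF adversary_hidden[OF adv \<Lambda>'], where \<phi> = \<phi>])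
    show "inj_on \<phi> (UNIV \<times> inputs (l * M))"
    proof (rule inj_onI)
      fix p q assume "p \<in> UNIV \<times> inputs (l * M)" "q \<in> UNIV \<times> inputs (l * M)" and eq: "\<phi> p = \<phi> q"
      then obtain t x u y where p: "p = (t, x)" "q = (u, y)" and xy: "x \<in> inputs (l * M)" "y \<in> inputs (l * M)"
        by (cases p, cases q) auto
      have "x = y" using eq xy unfolding p by (auto simp: \<phi>_def inputs_def)
      moreover have "t = u" using val[OF xy(1), of t] val[OF xy(2), of u] eq p by simp
      ultimately show "p = q" using p by simp
    qed
    show "\<phi> p \<in> inputs (cheat_len l M s)" if "p \<in> UNIV \<times> inputs (l * M)" for p
      using that \<phi>_in by (cases p) auto
    show "cheat_sheet l M s addr dec F (\<phi> p) = fst p" if "p \<in> UNIV \<times> inputs (l * M)" for p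
      using that val by (cases p) auto
    fix \<gamma> assume "\<gamma> \<in> input_bits (cheat_len l M s)"
    then obtain k where k: "k < cheat_len l M s" "\<gamma> = (\<lambda>z. z ! k)" by (auto simp: input_bits_def)
    show "(\<exists>c. \<forall>x\<in>UNIV \<times> inputs (l * M). \<gamma> (\<phi> x) = c) \<or>
      (\<exists>\<beta>\<in>hidden_bits l M F. (\<forall>x\<in>UNIV \<times> inputs (l * M). \<gamma> (\<phi> x) = \<beta> x) \<or>
        (\<forall>x\<in>UNIV \<times> inputs (l * M). \<gamma> (\<phi> x) = (\<not> \<beta> x)))"
    proof (cases "k < l * M")
      case True
      have mem: "(\<lambda>p. snd p ! k) \<in> hidden_bits l M F" using True by (auto simp: hidden_bits_def)
      have eq: "\<forall>p\<in>UNIV \<times> inputs (l * M). \<gamma> (\<phi> p) = snd p ! k"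
        using True by (auto simp: \<phi>_def k(2) nth_append inputs_def)
      show ?thesis by (rule disjI2, rule bexI[OF _ mem], rule disjI1, rule eq)
    next
      case False
      define r where "r = k - l * M"
      have r: "r < 2 ^ l * l * s" using k(1) False by (simp add: r_def cheat_len_def)
      define i q where "i = r div s" and "q = r mod s"
      note iq = div_mod_block[OF r, folded i_def q_def]
      \<comment> \<open>A bit of the sheet can reveal the filling only if its cell is the addressed
        one and the code of the certificate differs from \<open>blank\<close> there; by injectivity
        of \<open>addr\<close> the first condition fixes all values of \<open>F\<close>.\<close>
      define R where "R x \<longleftrightarrow> i div l = addr (block_map l M F x) \<and> enc (blk M (i mod l) x) ! q \<noteq> blank ! q" for x
      have "\<exists>a. \<forall>x\<in>inputs (l * M). R x \<longrightarrow> block_map l M F x = a"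
      proof (cases "\<exists>v\<in>inputs l. addr v = i div l")
        case True
        then obtain v where v: "v \<in> inputs l" "addr v = i div l" by blast
        show ?thesis
        proof (intro exI[of _ v] ballI impI)
          fix x assume "R x"
          then have "addr (block_map l M F x) = addr v" using v by (simp add: R_def)
          then show "block_map l M F x = v" using addr(1) v(1) by (auto simp: inj_on_def)
        qed
      next
        case False
        then have "\<not> R x" for x using block_map_inputs[of l M F x] by (auto simp: R_def)
        then show ?thesis by blast
      qed
      then have mem: "(\<lambda>p. fst p \<and> R (snd p)) \<in> hidden_bits l M F" by (auto simp: hidden_bits_def)
      have \<gamma>: "\<gamma> (\<phi> (t, x)) = (if t \<and> R x then \<not> blank ! q else blank ! q)" if x: "x \<in> inputs (l * M)" for t x
      proof -
        have "\<gamma> (\<phi> (t, x)) = sheet t x ! r"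
          using False x by (simp add: \<phi>_def k(2) nth_append inputs_def r_def)
        also have "\<dots> = blk s i (sheet t x) ! q"
        proof -
          have "i * s + s \<le> length (sheet t x)" using block_bound[OF iq(1)] sheet_len[OF x] by simp
          from blk_nth[OF this iq(2)] show ?thesis using iq(3) by simp
        qed
        also have "blk s i (sheet t x) = item t x i"
          unfolding sheet_def using blk_concat[of "2 ^ l * l" "item t x" s i "[]"] item_len[OF x] iq(1) by simp
        finally show ?thesis by (auto simp: item_def R_def)
      qed
      show ?thesis
      proof (cases "blank ! q")
        case True
        then have eq: "\<forall>p\<in>UNIV \<times> inputs (l * M). \<gamma> (\<phi> p) = (\<not> (fst p \<and> R (snd p)))" using \<gamma> by auto
        show ?thesis by (rule disjI2, rule bexI[OF _ mem], rule disjI2, rule eq)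
      next
        case False
        then have eq: "\<forall>p\<in>UNIV \<times> inputs (l * M). \<gamma> (\<phi> p) = (fst p \<and> R (snd p))" using \<gamma> by auto
        show ?thesis by (rule disjI2, rule bexI[OF _ mem], rule disjI1, rule eq)
      qed
    qed
  qed (use finite_inputs in auto)
qed

subsection \<open>Searching for an XOR of letters\<close>

definition sdiff :: "'a set \<Rightarrow> 'a set \<Rightarrow> 'a set" where
  "sdiff a c = (a - c) \<union> (c - a)"

text \<open>Walsh characters, with sets in the place of bit vectors and \<open>sdiff\<close> in the
  place of addition modulo 2.\<close>

definition chi :: "'a set \<Rightarrow> 'a set \<Rightarrow> real" where
  "chi a x = (- 1) ^ card (a \<inter> x)"

lemma chi_commute: "chi a x = chi x a"
  by (simp add: chi_def Int_commute)

lemma chi_prod: "finite x \<Longrightarrow> chi a x = (\<Prod>e\<in>x. if e \<in> a then - 1 else 1)"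
  by (simp add: chi_def prod.If_cases Int_commute Collect_conj_eq[symmetric])

lemma chi_sdiff: "finite x \<Longrightarrow> chi (sdiff a c) x = chi a x * chi c x"
  unfolding chi_prod prod.distrib[symmetric] by (rule prod.cong) (auto simp: sdiff_def)

lemma chi_empty [simp]: "chi {} x = 1" "chi a {} = 1"
  by (simp_all add: chi_def)

lemma abs_chi [simp]: "\<bar>chi a x\<bar> = 1"
  by (simp add: chi_def power_abs)

lemma chi_sum:
  assumes "finite I"
  shows "(\<Sum>x\<in>Pow I. chi a x) = (if a \<inter> I = {} then 2 ^ card I else 0)"
proof -
  have "(\<Sum>x\<in>Pow I. chi a x) = (\<Sum>x\<in>Pow I. (\<Prod>e\<in>x. if e \<in> a then - 1 else 1) * (\<Prod>e\<in>I - x. 1))"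
    by (intro sum.cong refl) (simp add: chi_prod finite_subset[OF _ assms])
  also have "\<dots> = (\<Prod>e\<in>I. (if e \<in> a then - 1 else 1) + 1)"
    by (rule prod_add[symmetric, OF assms])
  also have "\<dots> = (if a \<inter> I = {} then 2 ^ card I else 0)"
  proof (cases "a \<inter> I = {}")
    case True
    then have "(\<Prod>e\<in>I. (if e \<in> a then - 1 else 1) + 1) = (\<Prod>e\<in>I. 2 :: real)"
      by (intro prod.cong) auto
    then show ?thesis using True by simp
  next
    case False
    then have "(\<Prod>e\<in>I. (if e \<in> a then - 1 else 1) + 1) = (0 :: real)"
      using assms by (intro prod_zero) auto
    then show ?thesis using False by simp
  qed
  finally show ?thesis .
qed

lemma sdiff_cancel [simp]: "sdiff (sdiff a c) c = a"
  by (auto simp: sdiff_def)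

lemma sdiff_disjoint_iff: "sdiff x y \<inter> L = {} \<longleftrightarrow> x \<inter> L = y \<inter> L"
  by (auto simp: sdiff_def)

lemma sdiff_bij: "c \<subseteq> I \<Longrightarrow> bij_betw (\<lambda>a. sdiff a c) (Pow I) (Pow I)"
  by (rule bij_betw_byWitness[where f' = "\<lambda>a. sdiff a c"]) (auto simp: sdiff_def)

lemma chi_sum2:
  assumes "finite I" "x \<subseteq> I" "y \<subseteq> I"
  shows "(\<Sum>a\<in>Pow I. chi a x * chi a y) = (if x = y then 2 ^ card I else 0)"
proof -
  have "(\<Sum>a\<in>Pow I. chi a x * chi a y) = (\<Sum>a\<in>Pow I. chi (sdiff x y) a)"
  proof (rule sum.cong[OF refl])
    fix a assume "a \<in> Pow I"
    then have "finite a" by (simp add: finite_subset[OF _ assms(1)])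
    then show "chi a x * chi a y = chi (sdiff x y) a"
      by (simp add: chi_sdiff chi_commute[of a x] chi_commute[of a y])
  qed
  also have "\<dots> = (if sdiff x y \<inter> I = {} then 2 ^ card I else 0)" by (rule chi_sum[OF assms(1)])
  also have "sdiff x y \<inter> I = {} \<longleftrightarrow> x = y" using assms by (auto simp: sdiff_def)
  finally show ?thesis .
qed

lemma parseval:
  assumes I: "finite I"
  shows "(\<Sum>a\<in>Pow I. (\<Sum>x\<in>Pow I. u x * chi a x)\<^sup>2) = 2 ^ card I * (\<Sum>x\<in>Pow I. (u x)\<^sup>2)"
proof -
  have "(\<Sum>a\<in>Pow I. (\<Sum>x\<in>Pow I. u x * chi a x)\<^sup>2)
      = (\<Sum>a\<in>Pow I. \<Sum>x\<in>Pow I. \<Sum>y\<in>Pow I. (u x * u y) * (chi a x * chi a y))"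
    by (simp add: power2_eq_square sum_product mult_ac)
  also have "\<dots> = (\<Sum>x\<in>Pow I. \<Sum>y\<in>Pow I. \<Sum>a\<in>Pow I. (u x * u y) * (chi a x * chi a y))"
    by (rule sum_rotate[symmetric])
  also have "\<dots> = (\<Sum>x\<in>Pow I. \<Sum>y\<in>Pow I. if x = y then 2 ^ card I * (u x)\<^sup>2 else 0)"
    by (intro sum.cong refl) (use chi_sum2[OF I] in \<open>auto simp: sum_distrib_left[symmetric] power2_eq_square\<close>)
  also have "\<dots> = (\<Sum>x\<in>Pow I. 2 ^ card I * (u x)\<^sup>2)"
    using I by (intro sum.cong refl) simp
  finally show ?thesis by (simp add: sum_distrib_left)
qed

text \<open>On subsets of \<open>I\<close> it depends only on the symmetric difference of its
  arguments; the characters are its eigenvectors and \<open>\<alpha>\<close> lists the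
  eigenvalues.\<close>

definition ker :: "'a set \<Rightarrow> ('a set \<Rightarrow> real) \<Rightarrow> 'a set \<Rightarrow> 'a set \<Rightarrow> real" where
  "ker I \<alpha> x y = (\<Sum>a\<in>Pow I. \<alpha> a * (chi a x * chi a y)) / 2 ^ card I"

text \<open>The mask is the average of \<open>chi c x * chi c y\<close> over all
  \<open>c \<subseteq> L\<close>, and multiplying by one such product shifts the Fourier weights by
  \<open>c\<close>; so masking averages \<open>\<alpha>\<close> over all changes inside
  \<open>L\<close>.\<close>

lemma ker_agree:
  assumes I: "finite I" and L: "L \<subseteq> I" and xy: "x \<subseteq> I" "y \<subseteq> I"
  shows "ker I (\<lambda>a. (\<Sum>c\<in>Pow L. \<alpha> (sdiff a c)) / 2 ^ card L) x y
    = ker I \<alpha> x y * (if x \<inter> L = y \<inter> L then 1 else 0)"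
proof -
  have fin: "finite L" "finite x" "finite y" 
    using finite_subset[OF L I] finite_subset[OF xy(1) I] finite_subset[OF xy(2) I] by simp_all
  have "(\<Sum>a\<in>Pow I. (\<Sum>c\<in>Pow L. \<alpha> (sdiff a c)) / 2 ^ card L * (chi a x * chi a y))
      = (\<Sum>a\<in>Pow I. \<Sum>c\<in>Pow L. \<alpha> (sdiff a c) * (chi a x * chi a y)) / 2 ^ card L"
    by (simp add: sum_distrib_right sum_divide_distrib)
  also have "(\<Sum>a\<in>Pow I. \<Sum>c\<in>Pow L. \<alpha> (sdiff a c) * (chi a x * chi a y))
      = (\<Sum>c\<in>Pow L. \<Sum>a\<in>Pow I. \<alpha> (sdiff a c) * (chi a x * chi a y))"
    by (rule sum.swap)
  also have "\<dots> = (\<Sum>c\<in>Pow L. \<Sum>a\<in>Pow I. \<alpha> a * (chi (sdiff a c) x * chi (sdiff a c) y))"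
  proof (rule sum.cong[OF refl])
    fix c assume "c \<in> Pow L"
    then have "c \<subseteq> I" using L by auto
    from sum.reindex_bij_betw[OF sdiff_bij[OF this], of "\<lambda>a. \<alpha> (sdiff a c) * (chi a x * chi a y)"]
    show "(\<Sum>a\<in>Pow I. \<alpha> (sdiff a c) * (chi a x * chi a y))
        = (\<Sum>a\<in>Pow I. \<alpha> a * (chi (sdiff a c) x * chi (sdiff a c) y))" by simp
  qed
  also have "\<dots> = (\<Sum>c\<in>Pow L. \<Sum>a\<in>Pow I. (\<alpha> a * (chi a x * chi a y)) * (chi c x * chi c y))"
    using fin by (intro sum.cong refl) (simp add: chi_sdiff mult_ac)
  also have "\<dots> = (\<Sum>a\<in>Pow I. \<alpha> a * (chi a x * chi a y)) * (\<Sum>c\<in>Pow L. chi c x * chi c y)"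
    by (subst sum.swap) (simp add: sum_product)
  also have "(\<Sum>c\<in>Pow L. chi c x * chi c y) = (\<Sum>c\<in>Pow L. chi (sdiff x y) c)"
  proof (rule sum.cong[OF refl])
    fix c assume "c \<in> Pow L"
    then have "finite c" by (simp add: finite_subset[OF _ fin(1)])
    then show "chi c x * chi c y = chi (sdiff x y) c"
      by (simp add: chi_sdiff chi_commute[of c x] chi_commute[of c y])
  qed
  also have "\<dots> = (if x \<inter> L = y \<inter> L then 2 ^ card L else 0)"
    unfolding chi_sum[OF fin(1)] sdiff_disjoint_iff by simp
  finally show ?thesis by (simp add: ker_def)
qed

text \<open>Hence a query to the positions \<open>L\<close> only sees how much
  \<open>\<alpha>\<close> varies under changes inside \<open>L\<close>.\<close>

lemma ker_diff:
  assumes "finite I" "L \<subseteq> I" "x \<subseteq> I" "y \<subseteq> I"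
  shows "ker I \<alpha> x y * (if x \<inter> L \<noteq> y \<inter> L then 1 else 0)
    = ker I (\<lambda>a. \<alpha> a - (\<Sum>c\<in>Pow L. \<alpha> (sdiff a c)) / 2 ^ card L) x y"
proof -
  have "ker I (\<lambda>a. \<alpha> a - (\<Sum>c\<in>Pow L. \<alpha> (sdiff a c)) / 2 ^ card L) x y
      = ker I \<alpha> x y - ker I (\<lambda>a. (\<Sum>c\<in>Pow L. \<alpha> (sdiff a c)) / 2 ^ card L) x y"
    by (simp add: ker_def left_diff_distrib sum_subtractf diff_divide_distrib)
  then show ?thesis unfolding ker_agree[OF assms] by simp
qed

lemma sum_UN_le:
  fixes f :: "'a \<Rightarrow> real"
  assumes "finite T" "\<And>s. s \<in> T \<Longrightarrow> finite (A s)" "\<And>x. 0 \<le> f x"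
  shows "sum f (\<Union>s\<in>T. A s) \<le> (\<Sum>s\<in>T. sum f (A s))"
  using assms(1,2)
proof (induction T rule: finite_induct)
  case (insert s T)
  have "sum f (A s \<union> (\<Union>s\<in>T. A s)) + sum f (A s \<inter> (\<Union>s\<in>T. A s)) = sum f (A s) + sum f (\<Union>s\<in>T. A s)"
    using insert by (intro sum.union_inter) auto
  moreover have "0 \<le> sum f (A s \<inter> (\<Union>s\<in>T. A s))" by (intro sum_nonneg assms(3))
  ultimately show ?case using insert by simp
qed simp

text \<open>
  An input consists of \<open>\<kappa>\<close> columns of \<open>n\<close> letters of \<open>b\<close> bits each and is identified with the set
  \<open>x \<subseteq> I\<close> of its one-bits.  A selection \<open>S\<close> picks a letter in every column; the input is accepted if
  the picked letters XOR to zero for some selection (\<open>x \<in> XS S\<close>).  By \<open>qC\<close> a random input is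
  rejected with probability at least 3/4.
\<close>

locale xor_search =
  fixes \<kappa> n b m :: nat
  assumes \<kappa>: "\<kappa> > 0" and m: "m > 0" and mC: "m ^ (\<kappa> + 1) \<le> n ^ \<kappa>"
    and qC: "4 * \<kappa> * n ^ \<kappa> \<le> 2 ^ b" and qm: "m\<^sup>2 \<le> 2 ^ b"
begin

definition letters :: "(nat \<times> nat) set" where
  "letters = {..<\<kappa>} \<times> {..<n}"

definition I :: "((nat \<times> nat) \<times> nat) set" where
  "I = letters \<times> {..<b}"

definition row :: "nat \<times> nat \<Rightarrow> ((nat \<times> nat) \<times> nat) set" where
  "row i = {i} \<times> {..<b}"

definition sel :: "(nat \<Rightarrow> nat) set" where
  "sel = PiE {..<\<kappa>} (\<lambda>_. {..<n})"

definition gr :: "(nat \<Rightarrow> nat) \<Rightarrow> (nat \<times> nat) set" where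
  "gr S = (\<lambda>j. (j, S j)) ` {..<\<kappa>}"

definition XS :: "(nat \<Rightarrow> nat) \<Rightarrow> ((nat \<times> nat) \<times> nat) set set" where
  "XS S = {x \<in> Pow I. \<forall>\<beta><b. chi (gr S \<times> {\<beta>}) x = 1}"

definition C :: real where "C = real n ^ \<kappa>"

definition q :: real where "q = 2 ^ b"

definition NN :: real where "NN = 2 ^ card I"

lemma n_pos: "n > 0"
proof (rule ccontr)
  assume "\<not> n > 0"
  then have "n ^ \<kappa> = 0" using \<kappa> by simp
  moreover have "0 < m ^ (\<kappa> + 1)" using m by simp
  ultimately show False using mC by linarith
qed

lemma pos: "C > 0" "q > 0" "NN > 0"
  using n_pos by (simp_all add: C_def q_def NN_def)

lemma finI [simp]: "finite I" by (simp add: I_def letters_def)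

lemma fin_sel [simp]: "finite sel" by (simp add: sel_def finite_PiE)

lemma card_sel: "real (card sel) = C" by (simp add: sel_def C_def card_PiE)

lemma gr_letters: "S \<in> sel \<Longrightarrow> gr S \<subseteq> letters"
  by (auto simp: gr_def sel_def letters_def)

lemma gr_I: "S \<in> sel \<Longrightarrow> c \<subseteq> {..<b} \<Longrightarrow> gr S \<times> c \<subseteq> I"
  using gr_letters by (auto simp: I_def)

lemma row_I: "i \<in> letters \<Longrightarrow> row i \<subseteq> I" by (auto simp: row_def I_def)

lemma card_row: "card (row i) = b" by (simp add: row_def)

lemma XS_sub: "x \<in> XS S \<Longrightarrow> x \<subseteq> I" by (simp add: XS_def)

lemma fin_sub: "x \<subseteq> I \<Longrightarrow> finite x" using finI finite_subset by blast

lemma chi_gr: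
  assumes "finite x" "finite c"
  shows "chi (gr S \<times> c) x = (\<Prod>\<beta>\<in>c. chi (gr S \<times> {\<beta>}) x)"
  using assms(2)
proof (induction c rule: finite_induct)
  case (insert \<beta> c)
  have "gr S \<times> insert \<beta> c = sdiff (gr S \<times> {\<beta>}) (gr S \<times> c)"
    using insert.hyps by (auto simp: sdiff_def)
  then show ?case using insert assms(1) by (simp add: chi_sdiff)
qed simp

lemma chi_gr_XS: "x \<in> XS S \<Longrightarrow> c \<subseteq> {..<b} \<Longrightarrow> chi (gr S \<times> c) x = 1"
  using chi_gr[of x c S] fin_sub[OF XS_sub, of x S] finite_subset[of c "{..<b}"]
  by (auto simp: XS_def intro!: prod.neutral)

text \<open>Fourier expansion of a subspace: the characters \<open>gr S \<times> c\<close> are the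
  products of the \<open>b\<close> parity conditions that define \<open>XS S\<close>, so their sum
  is 2^b if all conditions hold and 0 otherwise.\<close>

lemma XS_indicator:
  assumes x: "x \<subseteq> I"
  shows "(\<Sum>c\<in>Pow {..<b}. chi (gr S \<times> c) x) = (if x \<in> XS S then q else 0)"
proof -
  let ?t = "\<lambda>\<beta>. chi (gr S \<times> {\<beta>}) x"
  have "(\<Sum>c\<in>Pow {..<b}. chi (gr S \<times> c) x) = (\<Sum>c\<in>Pow {..<b}. (\<Prod>\<beta>\<in>c. ?t \<beta>) * (\<Prod>\<beta>\<in>{..<b} - c. 1))"
  proof (rule sum.cong[OF refl])
    fix c assume "c \<in> Pow {..<b}"
    then have "finite c" by (auto intro: finite_subset)
    from chi_gr[OF fin_sub[OF x] this, of S]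
    show "chi (gr S \<times> c) x = (\<Prod>\<beta>\<in>c. ?t \<beta>) * (\<Prod>\<beta>\<in>{..<b} - c. 1)"
      by (simp only: prod.neutral_const mult_1_right)
  qed
  also have "\<dots> = (\<Prod>\<beta><b. ?t \<beta> + 1)" by (rule prod_add[symmetric]) simp
  also have "\<dots> = (if x \<in> XS S then q else 0)"
  proof (cases "x \<in> XS S")
    case True
    then have "(\<Prod>\<beta><b. ?t \<beta> + 1) = (\<Prod>\<beta><b. 2)" by (intro prod.cong) (auto simp: XS_def)
    then show ?thesis using True by (simp add: q_def)
  next
    case False
    then obtain \<beta> where "\<beta> < b" "?t \<beta> \<noteq> 1" using x by (auto simp: XS_def)
    moreover from this have "?t \<beta> = - 1" using abs_chi[of "gr S \<times> {\<beta>}" x] by linarith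
    ultimately have "(\<Prod>\<beta><b. ?t \<beta> + 1) = 0" by (intro prod_zero bexI[of _ \<beta>]) auto
    then show ?thesis using False by simp
  qed
  finally show ?thesis .
qed

text \<open>Summing the expansion of the indicator over all inputs leaves only the trivial
  character: the \<open>b\<close> parity conditions are independent.\<close>

lemma card_XS:
  assumes S: "S \<in> sel"
  shows "real (card (XS S)) = NN / q"
proof -
  have sub: "XS S \<subseteq> Pow I" by (auto simp: XS_def)
  have "q * real (card (XS S)) = (\<Sum>x\<in>Pow I. if x \<in> XS S then q else 0)"
    using sub by (simp add: sum.If_cases Int_absorb1 Int_absorb2 inf.absorb2)
  also have "\<dots> = (\<Sum>x\<in>Pow I. \<Sum>c\<in>Pow {..<b}. chi (gr S \<times> c) x)"
    by (intro sum.cong refl) (simp add: XS_indicator)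
  also have "\<dots> = (\<Sum>c\<in>Pow {..<b}. \<Sum>x\<in>Pow I. chi (gr S \<times> c) x)" by (rule sum.swap)
  also have "\<dots> = (\<Sum>c\<in>Pow {..<b}. if c = {} then NN else 0)"
  proof (intro sum.cong refl)
    fix c assume "c \<in> Pow {..<b}"
    then have "(gr S \<times> c) \<inter> I = gr S \<times> c" using gr_I[OF S] by auto
    moreover have "gr S \<times> c = {} \<longleftrightarrow> c = {}" using \<kappa> by (auto simp: gr_def)
    ultimately show "(\<Sum>x\<in>Pow I. chi (gr S \<times> c) x) = (if c = {} then NN else 0)"
      by (simp add: chi_sum NN_def)
  qed
  also have "\<dots> = NN" by simp
  finally show ?thesis using pos by (simp add: field_simps)
qed

section \<open>Fourier mass of functions on accepting inputs\<close>

definition U :: "(nat \<Rightarrow> nat) \<Rightarrow> (((nat \<times> nat) \<times> nat) set \<Rightarrow> real) \<Rightarrow> ((nat \<times> nat) \<times> nat) set \<Rightarrow> real" where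
  "U S u a = (\<Sum>x\<in>XS S. u x * chi a x)"

definition V :: "(((nat \<times> nat) \<times> nat) set \<Rightarrow> real) \<Rightarrow> ((nat \<times> nat) \<times> nat) set \<Rightarrow> real" where
  "V v a = (\<Sum>y\<in>Pow I. v y * chi a y)"

lemma V_parseval: "(\<Sum>a\<in>Pow I. (V v a)\<^sup>2) = NN * (\<Sum>y\<in>Pow I. (v y)\<^sup>2)"
  unfolding V_def NN_def by (rule parseval) simp

lemma U_parseval: "(\<Sum>a\<in>Pow I. (U S u a)\<^sup>2) = NN * (\<Sum>x\<in>XS S. (u x)\<^sup>2)"
proof -
  have sub: "XS S \<subseteq> Pow I" by (auto simp: XS_def)
  have "U S u a = V (\<lambda>x. if x \<in> XS S then u x else 0) a" for a
    unfolding U_def V_def using sub by (intro sum.mono_neutral_cong_left) auto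
  moreover have "(\<Sum>x\<in>XS S. (u x)\<^sup>2) = (\<Sum>x\<in>Pow I. (if x \<in> XS S then u x else 0)\<^sup>2)"
    using sub by (intro sum.mono_neutral_cong_left) auto
  ultimately show ?thesis using V_parseval by simp
qed

lemma U_shift:
  assumes "c \<subseteq> {..<b}"
  shows "U S u (sdiff a (gr S \<times> c)) = U S u a"
  unfolding U_def using chi_gr_XS[OF _ assms] fin_sub[OF XS_sub]
  by (intro sum.cong refl) (simp add: chi_sdiff)

text \<open>\<open>U\<close> is invariant under the \<open>q\<close> shifts by
  \<open>gr S \<times> c\<close>. Applied to characters that avoid the letter \<open>s\<close>,
  different shifts leave different traces on \<open>s\<close>; so the \<open>q\<close> images are
  disjoint, carry equal mass, and none has more than a 1/q share of the total.\<close>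

lemma U_off_letter:
  assumes S: "S \<in> sel" and s: "s \<in> gr S"
  shows "(\<Sum>a | a \<in> Pow I \<and> s \<notin> fst ` a. (U S u a)\<^sup>2) \<le> NN / q * (\<Sum>x\<in>XS S. (u x)\<^sup>2)"
proof -
  let ?P = "{a \<in> Pow I. s \<notin> fst ` a}"
  let ?h = "\<lambda>(c, a). sdiff a (gr S \<times> c)"
  have inj: "inj_on ?h (Pow {..<b} \<times> ?P)"
  proof (rule inj_onI, clarify)
    fix c a d e
    assume ca: "c \<subseteq> {..<b}" "a \<subseteq> I" "s \<notin> fst ` a" "d \<subseteq> {..<b}" "e \<subseteq> I" "s \<notin> fst ` e"
      and eq: "sdiff a (gr S \<times> c) = sdiff e (gr S \<times> d)"
    have rec: "\<beta> \<in> c' \<longleftrightarrow> (s, \<beta>) \<in> sdiff a' (gr S \<times> c')" if "s \<notin> fst ` a'" for \<beta> c' a'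
      using that s by (force simp: sdiff_def)
    have "c = d" using rec[of a _ c] rec[of e _ d] eq ca by auto
    moreover from this eq have "a = e" by (metis sdiff_cancel)
    ultimately show "c = d \<and> a = e" by simp
  qed
  have "q * (\<Sum>a\<in>?P. (U S u a)\<^sup>2) = (\<Sum>c\<in>Pow {..<b}. \<Sum>a\<in>?P. (U S u a)\<^sup>2)"
    by (simp add: q_def card_Pow)
  also have "\<dots> = (\<Sum>c\<in>Pow {..<b}. \<Sum>a\<in>?P. (U S u (?h (c, a)))\<^sup>2)"
    by (intro sum.cong refl) (simp add: U_shift)
  also have "\<dots> = (\<Sum>p\<in>Pow {..<b} \<times> ?P. (U S u (?h p))\<^sup>2)"
    by (simp add: sum.cartesian_product case_prod_beta)
  also have "\<dots> = (\<Sum>a\<in>?h ` (Pow {..<b} \<times> ?P). (U S u a)\<^sup>2)"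
    by (rule sum.reindex[OF inj, unfolded comp_def, symmetric])
  also have "\<dots> \<le> (\<Sum>a\<in>Pow I. (U S u a)\<^sup>2)"
    using gr_I[OF S] by (intro sum_mono2) (auto simp: sdiff_def)
  finally show ?thesis using pos unfolding U_parseval by (simp add: field_simps)
qed

text \<open>A union bound over the \<kappa> letters of \<open>S\<close>. The characters counted here
  are the only ones on which \<open>weight S\<close> may be nonzero, so their small mass is what
  keeps the masked matrix small.\<close>

lemma U_off:
  assumes S: "S \<in> sel"
  shows "(\<Sum>a | a \<in> Pow I \<and> \<not> gr S \<subseteq> fst ` a. (U S u a)\<^sup>2) \<le> real \<kappa> * NN / q * (\<Sum>x\<in>XS S. (u x)\<^sup>2)"
proof -
  have "{a \<in> Pow I. \<not> gr S \<subseteq> fst ` a} \<subseteq> (\<Union>s\<in>gr S. {a \<in> Pow I. s \<notin> fst ` a})" by auto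
  then have "(\<Sum>a | a \<in> Pow I \<and> \<not> gr S \<subseteq> fst ` a. (U S u a)\<^sup>2)
      \<le> (\<Sum>a\<in>(\<Union>s\<in>gr S. {a \<in> Pow I. s \<notin> fst ` a}). (U S u a)\<^sup>2)"
    by (intro sum_mono2) (auto simp: gr_def)
  also have "\<dots> \<le> (\<Sum>s\<in>gr S. \<Sum>a | a \<in> Pow I \<and> s \<notin> fst ` a. (U S u a)\<^sup>2)"
    by (rule sum_UN_le) (auto simp: gr_def)
  also have "\<dots> \<le> (\<Sum>s\<in>gr S. NN / q * (\<Sum>x\<in>XS S. (u x)\<^sup>2))"
    by (rule sum_mono) (rule U_off_letter[OF S])
  also have "\<dots> = real (card (gr S)) * (NN / q * (\<Sum>x\<in>XS S. (u x)\<^sup>2))" by simp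
  also have "card (gr S) = \<kappa>" unfolding gr_def by (subst card_image) (auto simp: inj_on_def)
  finally show ?thesis by simp
qed

lemma bilinear_ker:
  "(\<Sum>x\<in>XS S. \<Sum>y\<in>Pow I. ker I \<gamma> x y * (u x * v y)) = (\<Sum>a\<in>Pow I. \<gamma> a * (U S u a * V v a)) / NN"
proof -
  have "(\<Sum>a\<in>Pow I. \<gamma> a * (U S u a * V v a))
      = (\<Sum>a\<in>Pow I. \<Sum>x\<in>XS S. \<Sum>y\<in>Pow I. \<gamma> a * (chi a x * chi a y) * (u x * v y))"
    unfolding U_def V_def sum_product by (simp add: sum_distrib_left mult_ac)
  also have "\<dots> = (\<Sum>x\<in>XS S. \<Sum>y\<in>Pow I. \<Sum>a\<in>Pow I. \<gamma> a * (chi a x * chi a y) * (u x * v y))"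
    by (rule sum_rotate[symmetric])
  finally show ?thesis
    by (simp add: ker_def NN_def sum_distrib_right sum_divide_distrib)
qed

text \<open>
  The adversary matrix is, up to normalisation, \<open>\<Sum>S. K S\<close> restricted to the accepting rows \<open>x \<in> XS S\<close>, where \<open>K S\<close> has
  Fourier weight \<open>weight S A\<close> on the characters with support \<open>A\<close>.  The weight is large at \<open>A = {}\<close>,
  changes by at most 1 when a letter is added, and vanishes on the characters that are able to
  see the XOR of the letters picked by \<open>S\<close>.
\<close>

definition \<mu> :: "(nat \<times> nat) set \<Rightarrow> nat" where
  "\<mu> A = Max ((\<lambda>j. card {p. (j, p) \<in> A}) ` {..<\<kappa>})"

definition \<phi> :: "(nat \<times> nat) set \<Rightarrow> real" where
  "\<phi> A = real (m - \<mu> A)"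

definition weight :: "(nat \<Rightarrow> nat) \<Rightarrow> (nat \<times> nat) set \<Rightarrow> real" where
  "weight S A = (if gr S \<subseteq> A then 0 else \<phi> A)"

lemma \<phi>_bounds: "0 \<le> \<phi> A" "\<phi> A \<le> real m" by (simp_all add: \<phi>_def)

lemma \<mu>_lt: "\<mu> A < m \<Longrightarrow> j < \<kappa> \<Longrightarrow> card {p. (j, p) \<in> A} < m"
  unfolding \<mu>_def by (subst (asm) Max_less_iff) (use \<kappa> in auto)

lemma finite_column: "finite A \<Longrightarrow> finite {p. (j, p) \<in> A}"
  by (rule finite_subset[of _ "snd ` A"]) force+

lemma \<phi>_lipschitz:
  assumes A: "finite A"
  shows "\<bar>\<phi> A - \<phi> (insert i A)\<bar> \<le> 1"
proof -
  have up: "card {p. (j, p) \<in> insert i A} \<le> card {p. (j, p) \<in> A} + 1" for j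
  proof -
    have "{p. (j, p) \<in> insert i A} \<subseteq> insert (snd i) {p. (j, p) \<in> A}" by auto
    then have "card {p. (j, p) \<in> insert i A} \<le> card (insert (snd i) {p. (j, p) \<in> A})"
      using finite_column[OF A] by (intro card_mono) auto
    also have "\<dots> \<le> card {p. (j, p) \<in> A} + 1" using finite_column[OF A] by (simp add: card_insert_if)
    finally show ?thesis .
  qed
  have lo: "card {p. (j, p) \<in> A} \<le> card {p. (j, p) \<in> insert i A}" for j
    using finite_column[of "insert i A"] A by (intro card_mono) auto
  have le: "card {p. (j, p) \<in> B} \<le> \<mu> B" if "j < \<kappa>" for j B
    unfolding \<mu>_def using that by (intro Max_ge) auto
  have "\<mu> (insert i A) \<le> \<mu> A + 1"
    unfolding \<mu>_def[of "insert i A"]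
    by (subst Max_le_iff) (use \<kappa> up le[of _ A] in \<open>auto intro: order_trans\<close>)
  moreover have "\<mu> A \<le> \<mu> (insert i A)"
    unfolding \<mu>_def[of A]
    by (subst Max_le_iff) (use \<kappa> lo le[of _ "insert i A"] in \<open>auto intro: order_trans\<close>)
  ultimately show ?thesis unfolding \<phi>_def by linarith
qed

text \<open>Adding a letter changes the weight of \<open>S\<close> by at most 1, for a total of at
  most \<open>C\<close>, unless the letter completes \<open>S\<close>; then the weight drops from
  \<open>\<phi> A\<close> to 0. If \<open>\<phi> A > 0\<close>, every column of \<open>A\<close> has
  fewer than \<open>m\<close> letters, so at most m^(\<kappa>-1) selections are completed, and with
  \<open>\<phi> A \<le> m\<close> they contribute at most m^(\<kappa>+1). This is the origin of
  assumption \<open>mC\<close>.\<close>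

lemma weight_jump:
  assumes A: "finite A"
  shows "(\<Sum>S\<in>sel. (weight S A - weight S (insert i A))\<^sup>2) \<le> 2 * C"
proof -
  define B where "B = {S \<in> sel. i \<in> gr S \<and> gr S - {i} \<subseteq> A}"
  have each: "(weight S A - weight S (insert i A))\<^sup>2 \<le> 1 + (if S \<in> B then (\<phi> A)\<^sup>2 else 0)" if "S \<in> sel" for S
  proof -
    consider "gr S \<subseteq> A" | "\<not> gr S \<subseteq> insert i A" | "\<not> gr S \<subseteq> A" "gr S \<subseteq> insert i A" by auto
    then show ?thesis
    proof cases
      case 1
      then show ?thesis by (auto simp: weight_def)
    next
      case 2
      then have "(weight S A - weight S (insert i A))\<^sup>2 = (\<phi> A - \<phi> (insert i A))\<^sup>2" by (auto simp: weight_def)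
      also have "\<dots> \<le> 1" using \<phi>_lipschitz[OF A] by (simp add: abs_square_le_1)
      finally show ?thesis by (rule order_trans) auto
    next
      case 3
      then have "S \<in> B" using that by (auto simp: B_def)
      then show ?thesis using 3 by (simp add: weight_def)
    qed
  qed
  have cB: "real (card B) * (\<phi> A)\<^sup>2 \<le> C"
  proof (cases "\<mu> A < m")
    case False
    then show ?thesis using pos(1) by (simp add: \<phi>_def)
  next
    case True
    have "card B \<le> m ^ (\<kappa> - 1)"
    proof (cases "B = {}")
      case False
      then have i: "fst i < \<kappa>" by (auto simp: B_def gr_def)
      define W where "W j = (if j = fst i then {snd i} else {p. (j, p) \<in> A})" for j
      have finW: "finite (W j)" for j using finite_column[OF A] by (simp add: W_def)
      have "B \<subseteq> PiE {..<\<kappa>} W"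
      proof
        fix S assume S: "S \<in> B"
        then have "S j \<in> W j" if "j < \<kappa>" for j
          using that by (auto simp: B_def gr_def W_def)
        moreover have "S \<in> extensional {..<\<kappa>}" using S by (auto simp: B_def sel_def PiE_def)
        ultimately show "S \<in> PiE {..<\<kappa>} W" by (auto simp: PiE_def)
      qed
      then have "card B \<le> card (PiE {..<\<kappa>} W)" using finW by (intro card_mono finite_PiE) auto
      also have "\<dots> = (\<Prod>j<\<kappa>. card (W j))" by (simp add: card_PiE)
      also have "\<dots> = card (W (fst i)) * (\<Prod>j\<in>{..<\<kappa>} - {fst i}. card (W j))"
        using i by (intro prod.remove) auto
      also have "\<dots> \<le> 1 * (\<Prod>j\<in>{..<\<kappa>} - {fst i}. m)"
      proof (intro mult_mono prod_mono)
        show "card (W (fst i)) \<le> 1" by (simp add: W_def)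
        fix j assume "j \<in> {..<\<kappa>} - {fst i}"
        then show "0 \<le> card (W j) \<and> card (W j) \<le> m" using \<mu>_lt[OF True, of j] by (simp add: W_def)
      qed auto
      also have "\<dots> = m ^ (\<kappa> - 1)" using i by simp
      finally show ?thesis .
    qed simp
    then have "real (card B) * (\<phi> A)\<^sup>2 \<le> real (m ^ (\<kappa> - 1)) * (real m)\<^sup>2"
      using \<phi>_bounds by (intro mult_mono power_mono) auto
    also have "\<dots> = real (m ^ (\<kappa> + 1))"
      using \<kappa> by (simp add: power_add[symmetric] flip: of_nat_power of_nat_mult)
    also have "\<dots> \<le> real (n ^ \<kappa>)" using mC of_nat_le_iff by blast
    finally show ?thesis by (simp add: C_def)
  qed
  have "(\<Sum>S\<in>sel. (weight S A - weight S (insert i A))\<^sup>2) \<le> (\<Sum>S\<in>sel. 1 + (if S \<in> B then (\<phi> A)\<^sup>2 else 0))"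
    by (rule sum_mono) (rule each)
  also have "\<dots> = C + real (card B) * (\<phi> A)\<^sup>2"
    using card_sel by (simp add: sum.distrib sum.If_cases B_def Int_def)
  finally show ?thesis using cB by simp
qed

definition \<alpha> :: "(nat \<Rightarrow> nat) \<Rightarrow> ((nat \<times> nat) \<times> nat) set \<Rightarrow> real" where
  "\<alpha> S a = weight S (fst ` a)"

text \<open>By \<open>ker_diff\<close>, the Fourier weights that remain of \<open>\<alpha> S\<close>
  under a query to the whole letter \<open>i\<close>.\<close>

definition \<gamma> :: "nat \<times> nat \<Rightarrow> (nat \<Rightarrow> nat) \<Rightarrow> ((nat \<times> nat) \<times> nat) set \<Rightarrow> real" where
  "\<gamma> i S a = \<alpha> S a - (\<Sum>c\<in>Pow (row i). \<alpha> S (sdiff a c)) / 2 ^ card (row i)"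

lemma support_sdiff:
  assumes "c \<subseteq> row i"
  shows "fst ` sdiff a c = fst ` a - {i} \<or> fst ` sdiff a c = insert i (fst ` a - {i})"
proof -
  have "fst ` sdiff a c - {i} = fst ` a - {i}"
  proof -
    have "e \<in> sdiff a c \<longleftrightarrow> e \<in> a" if "fst e \<noteq> i" for e
      using assms that by (auto simp: sdiff_def row_def)
    then show ?thesis by (auto simp: image_iff)
  qed
  then show ?thesis by blast
qed

lemma \<gamma>_eq:
  "\<gamma> i S a = (\<Sum>c\<in>Pow (row i). \<alpha> S a - \<alpha> S (sdiff a c)) / q"
proof -
  have "card (Pow (row i)) = 2 ^ b" by (simp add: card_Pow row_def)
  then have "(\<Sum>c\<in>Pow (row i). \<alpha> S a - \<alpha> S (sdiff a c)) = q * \<alpha> S a - (\<Sum>c\<in>Pow (row i). \<alpha> S (sdiff a c))"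
    by (simp add: sum_subtractf q_def)
  then show ?thesis using pos by (simp add: \<gamma>_def card_row q_def[symmetric] diff_divide_distrib)
qed

text \<open>Changing the bits of letter \<open>i\<close> alters the support at most at
  \<open>i\<close>, so each difference in the average is, up to sign, 0 or the jump of
  \<open>weight S\<close> at \<open>i\<close>.\<close>

lemma \<gamma>_bound:
  "\<bar>\<gamma> i S a\<bar> \<le> \<bar>weight S (fst ` a - {i}) - weight S (insert i (fst ` a - {i}))\<bar>"
proof -
  let ?d = "\<bar>weight S (fst ` a - {i}) - weight S (insert i (fst ` a - {i}))\<bar>"
  have "\<bar>\<Sum>c\<in>Pow (row i). \<alpha> S a - \<alpha> S (sdiff a c)\<bar> \<le> (\<Sum>c\<in>Pow (row i). ?d)"
  proof (rule order_trans[OF sum_abs sum_mono])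
    fix c assume "c \<in> Pow (row i)"
    then have "fst ` sdiff a c = fst ` a - {i} \<or> fst ` sdiff a c = insert i (fst ` a - {i})"
      by (intro support_sdiff) auto
    moreover have "fst ` a = fst ` a - {i} \<or> fst ` a = insert i (fst ` a - {i})" by blast
    ultimately show "\<bar>\<alpha> S a - \<alpha> S (sdiff a c)\<bar> \<le> ?d"
      unfolding \<alpha>_def by (elim disjE) (smt (verit))+
  qed
  also have "\<dots> = q * ?d" by (simp add: card_Pow card_row q_def row_def)
  finally show ?thesis using pos by (simp add: \<gamma>_eq field_simps)
qed

text \<open>All shifts inside letter \<open>i\<close> that keep \<open>i\<close> in the support give
  weight 0; only the shift that leaves letter \<open>i\<close> empty can contribute, one out of
  \<open>q\<close>.\<close>

lemma \<gamma>_full: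
  assumes "gr S \<subseteq> fst ` a"
  shows "\<bar>\<gamma> i S a\<bar> \<le> real m / q"
proof -
  have z: "\<alpha> S (sdiff a c) = 0" if c: "c \<in> Pow (row i)" "c \<noteq> a \<inter> row i" for c
  proof -
    have "sdiff a c \<inter> row i \<noteq> {}" using c by (auto simp: sdiff_def)
    then have "i \<in> fst ` sdiff a c" by (force simp: row_def)
    then have "fst ` a \<subseteq> fst ` sdiff a c" using support_sdiff[of c i a] c by auto
    then show ?thesis using assms by (auto simp: \<alpha>_def weight_def)
  qed
  have "\<alpha> S a = 0" using assms by (simp add: \<alpha>_def weight_def)
  then have "\<gamma> i S a = - (\<Sum>c\<in>Pow (row i). \<alpha> S (sdiff a c)) / q"
    by (simp add: \<gamma>_eq sum_negf)
  also have "(\<Sum>c\<in>Pow (row i). \<alpha> S (sdiff a c)) = (\<Sum>c\<in>Pow (row i). if c = a \<inter> row i then \<alpha> S (sdiff a c) else 0)"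
    by (intro sum.cong refl) (use z in auto)
  also have "\<dots> = \<alpha> S (sdiff a (a \<inter> row i))" by (simp add: row_def)
  finally show ?thesis
    using \<phi>_bounds pos by (auto simp: \<alpha>_def weight_def divide_right_mono)
qed

text \<open>The norm estimate for the masked matrix, with the selections kept apart. Characters that
  miss a letter of \<open>S\<close>, the set \<open>Z S\<close>, carry little mass of
  \<open>u S\<close> by \<open>U_off\<close> and moderate weights by \<open>weight_jump\<close>; on
  the remaining ones the weight itself is at most \<open>m / q\<close> by
  \<open>\<gamma>_full\<close>, which \<open>qm\<close> makes harmless.\<close>

lemma letter_bound:
  assumes i: "i \<in> letters"
  shows "sqrt q * (\<Sum>S\<in>sel. \<bar>\<Sum>x\<in>XS S. \<Sum>y\<in>Pow I. ker I (\<gamma> i S) x y * (u S x * v y)\<bar>)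
    \<le> sqrt C * (sqrt (2 * real \<kappa>) + 1) * (((\<Sum>S\<in>sel. \<Sum>x\<in>XS S. (u S x)\<^sup>2) + (\<Sum>y\<in>Pow I. (v y)\<^sup>2)) / 2)"
proof -
  define Us where "Us = (\<Sum>S\<in>sel. \<Sum>x\<in>XS S. (u S x)\<^sup>2)"
  define Vs where "Vs = (\<Sum>y\<in>Pow I. (v y)\<^sup>2)"
  define Z where "Z S = {a \<in> Pow I. \<not> gr S \<subseteq> fst ` a}" for S
  have ZI: "Z S \<subseteq> Pow I" for S by (auto simp: Z_def)
  have nn: "0 \<le> Us" "0 \<le> Vs" by (auto simp: Us_def Vs_def intro!: sum_nonneg)
  \<comment> \<open>Equalises the terms \<open>\<rho> * \<kappa> / q\<close> and
    \<open>2 * C / \<rho>\<close> that \<open>U_off\<close> and \<open>weight_jump\<close>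
    produce.\<close>
  define \<rho> where "\<rho> = sqrt (2 * C) * sqrt q / sqrt (real \<kappa>)"
  have k: "sqrt (real \<kappa>) > 0" "sqrt (2 * C) > 0" "sqrt q > 0" "sqrt C > 0" using \<kappa> pos by auto
  then have \<rho>: "\<rho> > 0" by (simp add: \<rho>_def)
  have each: "\<bar>\<Sum>a\<in>Pow I. \<gamma> i S a * (U S (u S) a * V v a)\<bar>
      \<le> (\<rho> * (\<Sum>a\<in>Z S. (U S (u S) a)\<^sup>2) + (\<Sum>a\<in>Pow I. (\<gamma> i S a)\<^sup>2 * (V v a)\<^sup>2) / \<rho>) / 2
        + real m / q * ((sqrt C * (\<Sum>a\<in>Pow I. (U S (u S) a)\<^sup>2) + (\<Sum>a\<in>Pow I. (V v a)\<^sup>2) / sqrt C) / 2)" for S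
  proof -
    have "\<bar>\<Sum>a\<in>Pow I. \<gamma> i S a * (U S (u S) a * V v a)\<bar>
        \<le> (\<Sum>a\<in>Pow I. (if a \<in> Z S then (\<rho> * (U S (u S) a)\<^sup>2 + (\<gamma> i S a)\<^sup>2 * (V v a)\<^sup>2 / \<rho>) / 2 else 0)
          + real m / q * ((sqrt C * (U S (u S) a)\<^sup>2 + (V v a)\<^sup>2 / sqrt C) / 2))"
    proof (rule order_trans[OF sum_abs sum_mono])
      fix a assume a: "a \<in> Pow I"
      have t: "0 \<le> real m / q * ((sqrt C * (U S (u S) a)\<^sup>2 + (V v a)\<^sup>2 / sqrt C) / 2)"
        using pos k by simp
      show "\<bar>\<gamma> i S a * (U S (u S) a * V v a)\<bar> \<le>
          (if a \<in> Z S then (\<rho> * (U S (u S) a)\<^sup>2 + (\<gamma> i S a)\<^sup>2 * (V v a)\<^sup>2 / \<rho>) / 2 else 0)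
          + real m / q * ((sqrt C * (U S (u S) a)\<^sup>2 + (V v a)\<^sup>2 / sqrt C) / 2)"
      proof (cases "a \<in> Z S")
        case True
        have "\<bar>\<gamma> i S a * (U S (u S) a * V v a)\<bar> = \<bar>U S (u S) a * (\<gamma> i S a * V v a)\<bar>" by (simp add: mult_ac)
        also have "\<dots> \<le> (\<rho> * (U S (u S) a)\<^sup>2 + (\<gamma> i S a * V v a)\<^sup>2 / \<rho>) / 2" by (rule young[OF \<rho>])
        finally show ?thesis using t unfolding if_P[OF True] power_mult_distrib by linarith
      next
        case False
        then have "\<bar>\<gamma> i S a\<bar> \<le> real m / q" using a by (intro \<gamma>_full) (auto simp: Z_def)
        moreover have "\<bar>U S (u S) a * V v a\<bar> \<le> (sqrt C * (U S (u S) a)\<^sup>2 + (V v a)\<^sup>2 / sqrt C) / 2"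
          by (rule young[OF k(4)])
        ultimately have "\<bar>\<gamma> i S a\<bar> * \<bar>U S (u S) a * V v a\<bar>
            \<le> real m / q * ((sqrt C * (U S (u S) a)\<^sup>2 + (V v a)\<^sup>2 / sqrt C) / 2)"
          using pos by (intro mult_mono) auto
        then show ?thesis using False by (simp add: abs_mult)
      qed
    qed
    also have "\<dots> = (\<Sum>a\<in>Z S. (\<rho> * (U S (u S) a)\<^sup>2 + (\<gamma> i S a)\<^sup>2 * (V v a)\<^sup>2 / \<rho>) / 2)
        + real m / q * ((sqrt C * (\<Sum>a\<in>Pow I. (U S (u S) a)\<^sup>2) + (\<Sum>a\<in>Pow I. (V v a)\<^sup>2) / sqrt C) / 2)"
    proof -
      have "(\<Sum>a\<in>Pow I. if a \<in> Z S then h a else 0) = (\<Sum>a\<in>Z S. h a)" for h :: "((nat \<times> nat) \<times> nat) set \<Rightarrow> real"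
        using ZI by (simp add: sum.If_cases Int_absorb1)
      then show ?thesis
        by (simp only: sum.distrib sum_distrib_left[symmetric] sum_divide_distrib[symmetric])
    qed
    also have "(\<Sum>a\<in>Z S. (\<rho> * (U S (u S) a)\<^sup>2 + (\<gamma> i S a)\<^sup>2 * (V v a)\<^sup>2 / \<rho>) / 2)
        = (\<rho> * (\<Sum>a\<in>Z S. (U S (u S) a)\<^sup>2) + (\<Sum>a\<in>Z S. (\<gamma> i S a)\<^sup>2 * (V v a)\<^sup>2) / \<rho>) / 2"
      by (simp only: sum.distrib sum_distrib_left[symmetric] sum_divide_distrib[symmetric])
    also have "(\<Sum>a\<in>Z S. (\<gamma> i S a)\<^sup>2 * (V v a)\<^sup>2) \<le> (\<Sum>a\<in>Pow I. (\<gamma> i S a)\<^sup>2 * (V v a)\<^sup>2)"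
      using ZI by (intro sum_mono2) auto
    finally show ?thesis using \<rho> by (simp add: divide_right_mono)
  qed
  have s1: "(\<Sum>S\<in>sel. \<Sum>a\<in>Z S. (U S (u S) a)\<^sup>2) \<le> real \<kappa> * NN / q * Us"
    unfolding Us_def sum_distrib_left[of _ _ sel] Z_def by (rule sum_mono) (rule U_off)
  have s2: "(\<Sum>S\<in>sel. \<Sum>a\<in>Pow I. (\<gamma> i S a)\<^sup>2 * (V v a)\<^sup>2) \<le> 2 * C * (NN * Vs)"
  proof -
    have "(\<Sum>S\<in>sel. \<Sum>a\<in>Pow I. (\<gamma> i S a)\<^sup>2 * (V v a)\<^sup>2) = (\<Sum>a\<in>Pow I. (\<Sum>S\<in>sel. (\<gamma> i S a)\<^sup>2) * (V v a)\<^sup>2)"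
      by (subst sum.swap) (simp add: sum_distrib_right)
    also have "\<dots> \<le> (\<Sum>a\<in>Pow I. 2 * C * (V v a)\<^sup>2)"
    proof (intro sum_mono mult_right_mono)
      fix a assume "a \<in> Pow I"
      then have "finite (fst ` a - {i})" using fin_sub by auto
      have "(\<Sum>S\<in>sel. (\<gamma> i S a)\<^sup>2) \<le> (\<Sum>S\<in>sel. (weight S (fst ` a - {i}) - weight S (insert i (fst ` a - {i})))\<^sup>2)"
        by (rule sum_mono) (use \<gamma>_bound in \<open>simp add: abs_le_square_iff\<close>)
      also have "\<dots> \<le> 2 * C" by (rule weight_jump) fact
      finally show "(\<Sum>S\<in>sel. (\<gamma> i S a)\<^sup>2) \<le> 2 * C" .
    qed simp
    also have "\<dots> = 2 * C * (NN * Vs)" by (simp add: sum_distrib_left[symmetric] V_parseval Vs_def)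
    finally show ?thesis .
  qed
  have s3: "(\<Sum>S\<in>sel. \<Sum>a\<in>Pow I. (U S (u S) a)\<^sup>2) = NN * Us"
    by (simp add: U_parseval Us_def sum_distrib_left)
  have s4: "(\<Sum>S\<in>sel. \<Sum>a\<in>Pow I. (V v a)\<^sup>2) = C * (NN * Vs)"
    by (simp add: V_parseval Vs_def card_sel)
  have "(\<Sum>S\<in>sel. \<bar>\<Sum>a\<in>Pow I. \<gamma> i S a * (U S (u S) a * V v a)\<bar>)
    \<le> (\<Sum>S\<in>sel. (\<rho> * (\<Sum>a\<in>Z S. (U S (u S) a)\<^sup>2) + (\<Sum>a\<in>Pow I. (\<gamma> i S a)\<^sup>2 * (V v a)\<^sup>2) / \<rho>) / 2
        + real m / q * ((sqrt C * (\<Sum>a\<in>Pow I. (U S (u S) a)\<^sup>2) + (\<Sum>a\<in>Pow I. (V v a)\<^sup>2) / sqrt C) / 2))"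
    by (rule sum_mono) (rule each)
  also have "\<dots> = (\<rho> * (\<Sum>S\<in>sel. \<Sum>a\<in>Z S. (U S (u S) a)\<^sup>2) + (\<Sum>S\<in>sel. \<Sum>a\<in>Pow I. (\<gamma> i S a)\<^sup>2 * (V v a)\<^sup>2) / \<rho>) / 2
        + real m / q * ((sqrt C * (\<Sum>S\<in>sel. \<Sum>a\<in>Pow I. (U S (u S) a)\<^sup>2) + (\<Sum>S\<in>sel. \<Sum>a\<in>Pow I. (V v a)\<^sup>2) / sqrt C) / 2)"
    unfolding sum.distrib sum_distrib_left[symmetric] sum_divide_distrib[symmetric] by (rule refl)
  also have "\<dots> \<le> (\<rho> * (real \<kappa> * NN / q * Us) + (2 * C * (NN * Vs)) / \<rho>) / 2
        + real m / q * ((sqrt C * (NN * Us) + (C * (NN * Vs)) / sqrt C) / 2)"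
    unfolding s3 s4 using s1 s2 \<rho>
    by (intro add_mono divide_right_mono mult_left_mono order_refl) auto
  finally have bound: "(\<Sum>S\<in>sel. \<bar>\<Sum>a\<in>Pow I. \<gamma> i S a * (U S (u S) a * V v a)\<bar>) \<le> \<dots>" .
  have "sqrt q * (\<Sum>S\<in>sel. \<bar>\<Sum>x\<in>XS S. \<Sum>y\<in>Pow I. ker I (\<gamma> i S) x y * (u S x * v y)\<bar>)
      = sqrt q / NN * (\<Sum>S\<in>sel. \<bar>\<Sum>a\<in>Pow I. \<gamma> i S a * (U S (u S) a * V v a)\<bar>)"
    using pos by (simp add: bilinear_ker sum_divide_distrib[symmetric])
  also have "\<dots> \<le> sqrt q / NN * ((\<rho> * (real \<kappa> * NN / q * Us) + (2 * C * (NN * Vs)) / \<rho>) / 2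
        + real m / q * ((sqrt C * (NN * Us) + (C * (NN * Vs)) / sqrt C) / 2))"
    using bound pos by (intro mult_left_mono) auto
  also have "\<dots> = ((sqrt q * \<rho> * real \<kappa> / q) * Us + (sqrt q * (2 * C) / \<rho>) * Vs) / 2
        + (sqrt q * real m / q) * ((sqrt C * Us + (C / sqrt C) * Vs) / 2)"
    using pos by (simp add: field_simps)
  also have "sqrt q * \<rho> * real \<kappa> / q = sqrt C * sqrt (2 * real \<kappa>)"
  proof -
    have "sqrt q * \<rho> * real \<kappa> / q = sqrt (2 * C) * (real \<kappa> / sqrt (real \<kappa>)) * ((sqrt q * sqrt q) / q)"
      by (simp add: \<rho>_def)
    then show ?thesis using pos \<kappa> by (simp add: real_div_sqrt real_sqrt_mult)
  qed
  also have "sqrt q * (2 * C) / \<rho> = sqrt C * sqrt (2 * real \<kappa>)"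
  proof -
    have "sqrt q * (2 * C) / \<rho> = (2 * C / sqrt (2 * C)) * sqrt (real \<kappa>)"
      using k by (simp add: \<rho>_def)
    also have "2 * C / sqrt (2 * C) = sqrt (2 * C)" using pos by (intro real_div_sqrt) simp
    finally show ?thesis by (simp add: real_sqrt_mult)
  qed
  also have "C / sqrt C = sqrt C" using pos by (simp add: real_div_sqrt)
  also have "(sqrt q * real m / q) * ((sqrt C * Us + sqrt C * Vs) / 2) \<le> 1 * ((sqrt C * Us + sqrt C * Vs) / 2)"
  proof (rule mult_right_mono)
    have "(real m)\<^sup>2 \<le> q" using qm unfolding q_def by (metis of_nat_le_iff of_nat_numeral of_nat_power)
    then have "real m \<le> sqrt q" by (rule real_le_rsqrt)
    then have "sqrt q * real m \<le> sqrt q * sqrt q" using pos by (intro mult_left_mono) auto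
    then show "sqrt q * real m / q \<le> 1" using pos by simp
  qed (use nn pos in simp)
  finally show ?thesis unfolding Us_def[symmetric] Vs_def[symmetric] by (simp add: field_simps)
qed

end

definition monotone_dnf :: "nat \<Rightarrow> nat \<Rightarrow> (bool list \<Rightarrow> bool) \<Rightarrow> bool" where
  "monotone_dnf N t g \<longleftrightarrow> (\<exists>\<T>. (\<forall>T\<in>\<T>. T \<subseteq> {..<N} \<and> card T \<le> t) \<and>
     (\<forall>z\<in>inputs N. g z \<longleftrightarrow> (\<exists>T\<in>\<T>. \<forall>i\<in>T. z ! i)))"

section \<open>The adversary matrix of the XOR search problem\<close>

context xor_search
begin

definition hit :: "((nat \<times> nat) \<times> nat) set \<Rightarrow> bool" where
  "hit x \<longleftrightarrow> (\<exists>S\<in>sel. x \<in> XS S)"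

definition num :: "((nat \<times> nat) \<times> nat) set \<Rightarrow> real" where
  "num x = real (card {S \<in> sel. x \<in> XS S})"

definition R :: real where
  "R = sqrt C * (sqrt (2 * real \<kappa>) + 1)"

text \<open>An accepting input \<open>y\<close> can lie in several \<open>XS S\<close>. Dividing by
  \<open>sqrt (num y)\<close> spreads its coordinate evenly over these \<open>S\<close> without
  changing the norm, by \<open>sum_num\<close>; so \<open>letter_bound\<close>, where the selections
  are separate, carries over. \<open>R\<close> is the norm bound found there.\<close>

definition Adv :: "((nat \<times> nat) \<times> nat) set \<Rightarrow> ((nat \<times> nat) \<times> nat) set \<Rightarrow> real" where
  "Adv x y = (\<Sum>S\<in>sel. if y \<in> XS S then sqrt q * ker I (\<alpha> S) y x / sqrt (num y) else 0) / R"

abbreviation (input) neg where "neg \<equiv> {x \<in> Pow I. \<not> hit x}"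
abbreviation (input) pos_in where "pos_in \<equiv> {x \<in> Pow I. hit x}"

lemma R_pos: "R > 0"
  using pos \<kappa> by (auto simp: R_def intro!: mult_pos_pos add_nonneg_pos)

lemma XS_pos: "S \<in> sel \<Longrightarrow> XS S \<subseteq> pos_in"
  by (auto simp: hit_def XS_def)

lemma num_pos: "x \<in> Pow I \<Longrightarrow> hit x \<Longrightarrow> num x > 0"
  by (auto simp: num_def hit_def card_gt_0_iff)

lemma swap_sel:
  "(\<Sum>y\<in>pos_in. \<Sum>S\<in>sel. if y \<in> XS S then h S y else 0) = (\<Sum>S\<in>sel. \<Sum>y\<in>XS S. h S y :: real)"
proof -
  have "(\<Sum>y\<in>pos_in. \<Sum>S\<in>sel. if y \<in> XS S then h S y else 0)
      = (\<Sum>S\<in>sel. \<Sum>y\<in>pos_in. if y \<in> XS S then h S y else 0)" by (rule sum.swap)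
  also have "\<dots> = (\<Sum>S\<in>sel. \<Sum>y\<in>XS S. h S y)"
  proof (rule sum.cong[OF refl])
    fix S assume "S \<in> sel"
    then have "pos_in \<inter> XS S = XS S" using XS_pos by blast
    then show "(\<Sum>y\<in>pos_in. if y \<in> XS S then h S y else 0) = (\<Sum>y\<in>XS S. h S y)"
      by (simp add: sum.inter_restrict[symmetric])
  qed
  finally show ?thesis .
qed

lemma sum_num: "(\<Sum>y\<in>pos_in. num y * h y) = (\<Sum>S\<in>sel. \<Sum>y\<in>XS S. h y)"
proof -
  have "num y * h y = (\<Sum>S\<in>sel. if y \<in> XS S then h y else 0)" for y
    by (simp add: num_def sum.inter_filter[symmetric])
  then show ?thesis by (simp only: swap_sel)
qed

text \<open>\<open>D\<close> is a mask that acts on each kernel by changing its Fourier weights. The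
  coordinates of \<open>a\<close> at accepting inputs are set to 0 so that the inner sum can run
  over all of \<open>Pow I\<close>, as \<open>bilinear_ker\<close> demands.\<close>

lemma form_Adv:
  assumes D: "\<And>S y x. S \<in> sel \<Longrightarrow> y \<in> XS S \<Longrightarrow> x \<in> Pow I \<Longrightarrow> ker I (\<alpha> S) y x * D x y = ker I (\<beta> S) y x"
  shows "form (Pow I) hit (\<lambda>x y. Adv x y * D x y) a c
    = sqrt q / R * (\<Sum>S\<in>sel. \<Sum>y\<in>XS S. \<Sum>x\<in>Pow I. ker I (\<beta> S) y x * ((c y / sqrt (num y)) * (if hit x then 0 else a x)))"
proof -
  have "form (Pow I) hit (\<lambda>x y. Adv x y * D x y) a c
      = (\<Sum>y\<in>pos_in. \<Sum>x\<in>neg. Adv x y * D x y * (a x * c y))"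
    unfolding form_def by (rule sum.swap)
  also have "\<dots> = (\<Sum>y\<in>pos_in. \<Sum>S\<in>sel. if y \<in> XS S then
      (\<Sum>x\<in>neg. sqrt q / R * (ker I (\<beta> S) y x * ((c y / sqrt (num y)) * a x))) else 0)"
  proof (rule sum.cong[OF refl])
    fix y assume y: "y \<in> pos_in"
    have "(\<Sum>x\<in>neg. Adv x y * D x y * (a x * c y))
        = (\<Sum>x\<in>neg. \<Sum>S\<in>sel. if y \<in> XS S then sqrt q / R * (ker I (\<beta> S) y x * ((c y / sqrt (num y)) * a x)) else 0)"
    proof (rule sum.cong[OF refl])
      fix x assume x: "x \<in> neg"
      show "Adv x y * D x y * (a x * c y)
          = (\<Sum>S\<in>sel. if y \<in> XS S then sqrt q / R * (ker I (\<beta> S) y x * ((c y / sqrt (num y)) * a x)) else 0)"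
        unfolding Adv_def sum_divide_distrib sum_distrib_right
      proof (rule sum.cong[OF refl])
        fix S assume S: "S \<in> sel"
        show "(if y \<in> XS S then sqrt q * ker I (\<alpha> S) y x / sqrt (num y) else 0) / R * D x y * (a x * c y)
          = (if y \<in> XS S then sqrt q / R * (ker I (\<beta> S) y x * ((c y / sqrt (num y)) * a x)) else 0)"
        proof (cases "y \<in> XS S")
          case True
          have "ker I (\<beta> S) y x = ker I (\<alpha> S) y x * D x y" using D[OF S True, of x] x by simp
          then show ?thesis using True by (simp add: mult_ac)
        qed simp
      qed
    qed
    also have "\<dots> = (\<Sum>S\<in>sel. \<Sum>x\<in>neg. if y \<in> XS S then sqrt q / R * (ker I (\<beta> S) y x * ((c y / sqrt (num y)) * a x)) else 0)"
      by (rule sum.swap)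
    also have "\<dots> = (\<Sum>S\<in>sel. if y \<in> XS S then (\<Sum>x\<in>neg. sqrt q / R * (ker I (\<beta> S) y x * ((c y / sqrt (num y)) * a x))) else 0)"
      by (rule sum.cong[OF refl]) simp
    finally show "(\<Sum>x\<in>neg. Adv x y * D x y * (a x * c y)) = \<dots>" .
  qed
  also have "\<dots> = (\<Sum>S\<in>sel. \<Sum>y\<in>XS S. \<Sum>x\<in>neg. sqrt q / R * (ker I (\<beta> S) y x * ((c y / sqrt (num y)) * a x)))"
    by (rule swap_sel)
  also have "\<dots> = (\<Sum>S\<in>sel. \<Sum>y\<in>XS S. \<Sum>x\<in>Pow I. sqrt q / R * (ker I (\<beta> S) y x * ((c y / sqrt (num y)) * (if hit x then 0 else a x))))"
    by (intro sum.cong[OF refl] sum.mono_neutral_cong_left) auto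
  finally show ?thesis by (simp only: sum_distrib_left)
qed

lemma contraction_letter:
  assumes i: "i \<in> letters"
  shows "\<bar>form (Pow I) hit (\<lambda>x y. Adv x y * (if x \<inter> row i \<noteq> y \<inter> row i then 1 else 0)) a c\<bar>
    \<le> (sqn neg a + sqn pos_in c) / 2"
proof -
  let ?v = "\<lambda>x. if hit x then 0 else a x"
  have "\<bar>form (Pow I) hit (\<lambda>x y. Adv x y * (if x \<inter> row i \<noteq> y \<inter> row i then 1 else 0)) a c\<bar>
      = sqrt q / R * \<bar>\<Sum>S\<in>sel. \<Sum>y\<in>XS S. \<Sum>x\<in>Pow I. ker I (\<gamma> i S) y x * ((c y / sqrt (num y)) * ?v x)\<bar>"
  proof (subst form_Adv[where \<beta> = "\<gamma> i"])
    fix S y x assume "S \<in> sel" "y \<in> XS S" "x \<in> Pow I"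
    then have "ker I (\<alpha> S) y x * (if y \<inter> row i \<noteq> x \<inter> row i then 1 else 0) = ker I (\<gamma> i S) y x"
      unfolding \<gamma>_def[abs_def] by (intro ker_diff[OF finI row_I[OF i]]) (auto dest: XS_sub)
    moreover have "x \<inter> row i \<noteq> y \<inter> row i \<longleftrightarrow> y \<inter> row i \<noteq> x \<inter> row i" by auto
    ultimately show "ker I (\<alpha> S) y x * (if x \<inter> row i \<noteq> y \<inter> row i then 1 else 0) = ker I (\<gamma> i S) y x"
      by (simp only:)
  qed (use pos R_pos in \<open>simp add: abs_mult\<close>)
  also have "\<dots> \<le> sqrt q / R * (\<Sum>S\<in>sel. \<bar>\<Sum>y\<in>XS S. \<Sum>x\<in>Pow I. ker I (\<gamma> i S) y x * ((c y / sqrt (num y)) * ?v x)\<bar>)"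
    using pos R_pos by (intro mult_left_mono sum_abs) auto
  also have "\<dots> = 1 / R * (sqrt q * (\<Sum>S\<in>sel. \<bar>\<Sum>y\<in>XS S. \<Sum>x\<in>Pow I. ker I (\<gamma> i S) y x * ((c y / sqrt (num y)) * ?v x)\<bar>))"
    by simp
  also have "\<dots> \<le> 1 / R * (R * (((\<Sum>S\<in>sel. \<Sum>y\<in>XS S. (c y / sqrt (num y))\<^sup>2) + (\<Sum>x\<in>Pow I. (?v x)\<^sup>2)) / 2))"
    using R_pos
    by (intro mult_left_mono letter_bound[OF i, of "\<lambda>S y. c y / sqrt (num y)" ?v, folded R_def]) auto
  also have "\<dots> = ((\<Sum>S\<in>sel. \<Sum>y\<in>XS S. (c y / sqrt (num y))\<^sup>2) + (\<Sum>x\<in>Pow I. (?v x)\<^sup>2)) / 2"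
    using R_pos by simp
  also have "(\<Sum>S\<in>sel. \<Sum>y\<in>XS S. (c y / sqrt (num y))\<^sup>2) = (\<Sum>y\<in>pos_in. num y * (c y / sqrt (num y))\<^sup>2)"
    by (rule sum_num[symmetric])
  also have "\<dots> = sqn pos_in c"
    unfolding sqn_def
  proof (rule sum.cong[OF refl])
    fix y assume "y \<in> pos_in"
    then have "num y > 0" using num_pos by auto
    then show "num y * (c y / sqrt (num y))\<^sup>2 = (c y)\<^sup>2" by (simp add: power_divide)
  qed
  also have "(\<Sum>x\<in>Pow I. (?v x)\<^sup>2) = sqn neg a"
    unfolding sqn_def by (intro sum.mono_neutral_cong_right) auto
  finally show ?thesis by (simp add: add.commute)
qed

text \<open>With signs \<open>s\<close> for the bit \<open>e\<close>, its mask is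
  \<open>(1 - s x * s y) / 2\<close>. So the matrix masked by the bit is half the difference of the
  matrix masked by the letter and a copy of it with rows and columns multiplied by signs, and both
  obey \<open>contraction_letter\<close>.\<close>

lemma contraction_bit:
  assumes e: "e \<in> I"
  shows "\<bar>form (Pow I) hit (\<lambda>x y. Adv x y * (if (e \<in> x) \<noteq> (e \<in> y) then 1 else 0)) a c\<bar>
    \<le> (sqn neg a + sqn pos_in c) / 2"
proof -
  define i where "i = fst e"
  have i: "i \<in> letters" and er: "e \<in> row i" using e by (auto simp: I_def i_def row_def)
  define B where "B x y = Adv x y * (if x \<inter> row i \<noteq> y \<inter> row i then 1 else 0)" for x y
  define s where "s x = (if e \<in> x then - 1 else 1 :: real)" for x
  have bit: "Adv x y * (if (e \<in> x) \<noteq> (e \<in> y) then 1 else 0) = (B x y - s x * s y * B x y) / 2" for x y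
    using er by (auto simp: B_def s_def)
  have "form (Pow I) hit (\<lambda>x y. Adv x y * (if (e \<in> x) \<noteq> (e \<in> y) then 1 else 0)) a c
      = (\<Sum>x\<in>neg. \<Sum>y\<in>pos_in. B x y * (a x * c y) / 2 - B x y * ((s x * a x) * (s y * c y)) / 2)"
    unfolding form_def bit by (intro sum.cong refl) (simp add: field_simps)
  also have "\<dots> = form (Pow I) hit B a c / 2 - form (Pow I) hit B (\<lambda>x. s x * a x) (\<lambda>y. s y * c y) / 2"
    by (simp only: form_def sum_subtractf sum_divide_distrib)
  finally have eq: "form (Pow I) hit (\<lambda>x y. Adv x y * (if (e \<in> x) \<noteq> (e \<in> y) then 1 else 0)) a c = \<dots>" .
  have sq: "sqn Y (\<lambda>x. s x * h x) = sqn Y h" for Y h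
    unfolding sqn_def by (intro sum.cong refl) (auto simp: s_def)
  have 1: "\<bar>form (Pow I) hit B a c\<bar> \<le> (sqn neg a + sqn pos_in c) / 2"
    and 2: "\<bar>form (Pow I) hit B (\<lambda>x. s x * a x) (\<lambda>y. s y * c y)\<bar> \<le> (sqn neg a + sqn pos_in c) / 2"
    using contraction_letter[OF i, of a c] contraction_letter[OF i, of "\<lambda>x. s x * a x" "\<lambda>y. s y * c y"]
    unfolding B_def[abs_def] sq by auto
  show ?thesis unfolding eq using 1 2 by linarith
qed

lemma card_pos_in: "real (card pos_in) \<le> C * (NN / q)"
proof -
  have "real (card pos_in) = (\<Sum>y\<in>pos_in. 1)" by simp
  also have "\<dots> \<le> (\<Sum>y\<in>pos_in. num y * 1)"
  proof (rule sum_mono)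
    fix y assume "y \<in> pos_in"
    then have "num y > 0" using num_pos by auto
    then show "1 \<le> num y * 1" by (simp add: num_def)
  qed
  also have "\<dots> = (\<Sum>S\<in>sel. real (card (XS S)))" unfolding sum_num by simp
  also have "\<dots> = (\<Sum>S\<in>sel. NN / q)" by (rule sum.cong[OF refl]) (rule card_XS)
  also have "\<dots> = C * (NN / q)" using card_sel by simp
  finally show ?thesis .
qed

lemma Cq: "4 * real \<kappa> * C \<le> q"
proof -
  have "real (4 * \<kappa> * n ^ \<kappa>) \<le> real (2 ^ b)" using qC of_nat_le_iff by blast
  then show ?thesis by (simp add: C_def q_def)
qed

lemma weight_empty: "\<alpha> S {} = real m"
proof -
  have "(\<lambda>j. card {p. (j, p) \<in> {}}) ` {..<\<kappa>} = {0}" using \<kappa> by auto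
  then have "\<mu> {} = 0" by (simp add: \<mu>_def)
  moreover have "\<not> gr S \<subseteq> {}" using \<kappa> by (auto simp: gr_def)
  ultimately show ?thesis by (simp add: \<alpha>_def weight_def \<phi>_def)
qed

text \<open>If \<open>x\<close> ran over all inputs, the constant function would pick out the
  trivial character, of weight \<open>m\<close>, for a value of \<open>m * (NN / q)\<close>. The
  accepting \<open>x\<close> take away at most half of it: their density is at most
  \<open>C / q\<close>, and the characters that the weight spares carry little mass of
  \<open>XS S\<close>.\<close>

lemma value_each:
  assumes S: "S \<in> sel"
  shows "(\<Sum>y\<in>XS S. \<Sum>x\<in>Pow I. ker I (\<alpha> S) y x * (1 * (if hit x then 0 else 1))) \<ge> real m * (NN / q) / 2"
proof -
  let ?one = "\<lambda>_. 1 :: real" and ?hit = "\<lambda>x. if hit x then 1 else 0 :: real"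
  have "(\<Sum>y\<in>XS S. \<Sum>x\<in>Pow I. ker I (\<alpha> S) y x * (?one y * ?one x)) = (\<Sum>a\<in>Pow I. \<alpha> S a * (U S ?one a * V ?one a)) / NN"
    by (rule bilinear_ker)
  also have "(\<Sum>a\<in>Pow I. \<alpha> S a * (U S ?one a * V ?one a)) = (\<Sum>a\<in>Pow I. if a = {} then real m * real (card (XS S)) * NN else 0)"
  proof (rule sum.cong[OF refl])
    fix a assume "a \<in> Pow I"
    then have V: "V ?one a = (if a = {} then NN else 0)"
      unfolding V_def NN_def by (simp add: chi_sum Int_absorb2)
    show "\<alpha> S a * (U S ?one a * V ?one a) = (if a = {} then real m * real (card (XS S)) * NN else 0)"
      unfolding V by (simp add: weight_empty U_def)
  qed
  also have "\<dots> = real m * (NN / q) * NN" using card_XS[OF S] by simp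
  finally have all: "(\<Sum>y\<in>XS S. \<Sum>x\<in>Pow I. ker I (\<alpha> S) y x * (?one y * ?one x)) = real m * (NN / q)"
    using pos by simp
  let ?Z = "{a \<in> Pow I. \<not> gr S \<subseteq> fst ` a}"
  \<comment> \<open>With the AM-GM weight \<open>2 * C\<close> the two error terms are
    \<open>\<kappa> * C / q\<close> and 1/4, relative to the full value; \<open>Cq\<close> bounds
    the first by 1/4 as well.\<close>
  have c: "2 * C > 0" using pos by simp
  have "\<bar>\<Sum>a\<in>Pow I. \<alpha> S a * (U S ?one a * V ?hit a)\<bar>
      \<le> (\<Sum>a\<in>Pow I. real m * ((2 * C * (if a \<in> ?Z then (U S ?one a)\<^sup>2 else 0) + (V ?hit a)\<^sup>2 / (2 * C)) / 2))"
  proof (rule order_trans[OF sum_abs sum_mono])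
    fix a assume a: "a \<in> Pow I"
    show "\<bar>\<alpha> S a * (U S ?one a * V ?hit a)\<bar>
      \<le> real m * ((2 * C * (if a \<in> ?Z then (U S ?one a)\<^sup>2 else 0) + (V ?hit a)\<^sup>2 / (2 * C)) / 2)"
    proof (cases "a \<in> ?Z")
      case True
      have "\<bar>\<alpha> S a\<bar> \<le> real m" using \<phi>_bounds by (simp add: \<alpha>_def weight_def)
      then have "\<bar>\<alpha> S a\<bar> * \<bar>U S ?one a * V ?hit a\<bar> \<le> real m * ((2 * C * (U S ?one a)\<^sup>2 + (V ?hit a)\<^sup>2 / (2 * C)) / 2)"
        using young[OF c, of "U S ?one a" "V ?hit a"] by (intro mult_mono) auto
      then show ?thesis using True by (simp add: abs_mult)
    next
      case False
      then have "\<alpha> S a = 0" using a by (simp add: \<alpha>_def weight_def)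
      then show ?thesis using False pos by simp
    qed
  qed
  also have "\<dots> = real m * ((2 * C * (\<Sum>a\<in>?Z. (U S ?one a)\<^sup>2) + (\<Sum>a\<in>Pow I. (V ?hit a)\<^sup>2) / (2 * C)) / 2)"
  proof -
    have "(\<Sum>a\<in>Pow I. if a \<in> ?Z then (U S ?one a)\<^sup>2 else 0) = (\<Sum>a\<in>?Z. (U S ?one a)\<^sup>2)"
      by (intro sum.mono_neutral_cong_right) auto
    then show ?thesis
      by (simp only: sum.distrib sum_distrib_left[symmetric] sum_divide_distrib[symmetric])
  qed
  also have "\<dots> \<le> real m * ((2 * C * (real \<kappa> * NN / q * (NN / q)) + (NN * (C * (NN / q))) / (2 * C)) / 2)"
  proof -
    have "(\<Sum>a\<in>?Z. (U S ?one a)\<^sup>2) \<le> real \<kappa> * NN / q * (NN / q)"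
      using U_off[OF S, of ?one] card_XS[OF S] by simp
    moreover have "(\<Sum>a\<in>Pow I. (V ?hit a)\<^sup>2) \<le> NN * (C * (NN / q))"
    proof -
      have "(\<Sum>y\<in>Pow I. (?hit y)\<^sup>2) = (\<Sum>y\<in>pos_in. 1)" by (intro sum.mono_neutral_cong_right) auto
      then have "(\<Sum>y\<in>Pow I. (?hit y)\<^sup>2) \<le> C * (NN / q)" using card_pos_in by simp
      then show ?thesis unfolding V_parseval using pos by (intro mult_left_mono) auto
    qed
    ultimately show ?thesis
      using pos by (intro mult_left_mono divide_right_mono add_mono) auto
  qed
  also have "\<dots> = NN * (real m * (NN / q) * (real \<kappa> * C / q + 1 / 4))"
    using pos by (simp add: field_simps)
  also have "\<dots> \<le> NN * (real m * (NN / q) * (1 / 2))"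
  proof -
    have "real \<kappa> * C / q \<le> 1 / 4" using Cq pos by (simp add: field_simps)
    then have "real \<kappa> * C / q + 1 / 4 \<le> 1 / 2" by linarith
    note h = mult_left_mono[OF mult_left_mono[OF this]]
    show ?thesis by (rule h) (use pos in auto)
  qed
  finally have "\<bar>\<Sum>a\<in>Pow I. \<alpha> S a * (U S ?one a * V ?hit a)\<bar> / NN \<le> real m * (NN / q) / 2"
    using pos by (simp add: field_simps)
  then have hit: "(\<Sum>y\<in>XS S. \<Sum>x\<in>Pow I. ker I (\<alpha> S) y x * (?one y * ?hit x)) \<le> real m * (NN / q) / 2"
    unfolding bilinear_ker by (rule order_trans[OF divide_right_mono[OF abs_ge_self less_imp_le[OF pos(3)]]])
  have "(\<Sum>y\<in>XS S. \<Sum>x\<in>Pow I. ker I (\<alpha> S) y x * (1 * (if hit x then 0 else 1)))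
      = (\<Sum>y\<in>XS S. \<Sum>x\<in>Pow I. ker I (\<alpha> S) y x * (?one y * ?one x) - ker I (\<alpha> S) y x * (?one y * ?hit x))"
    by (intro sum.cong refl) auto
  then show ?thesis using all hit unfolding sum_subtractf by linarith
qed

text \<open>The test vector is uniform on rejecting inputs and proportional to
  \<open>sqrt (num x)\<close> on accepting ones, which cancels the division in \<open>Adv\<close>
  and reduces the value to \<open>value_each\<close>. The outcome
  \<open>m / (2 * (sqrt (2 * \<kappa>) + 1))\<close> is simplified to
  \<open>m / (6 * \<kappa>)\<close>.\<close>

lemma adversary_hit: "adversary (Pow I) hit ((\<lambda>e x. e \<in> x) ` I) (real m / (6 * real \<kappa>))"
proof -
  have cn: "real (card neg) = NN - real (card pos_in)"
  proof -
    have "card (Pow I) = card neg + card pos_in"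
      by (subst card_Un_disjoint[symmetric]) (auto intro!: arg_cong[of _ _ card])
    moreover have "real (card (Pow I)) = NN" by (simp add: card_Pow NN_def)
    ultimately show ?thesis by simp
  qed
  have k1: "1 \<le> real \<kappa>" using \<kappa> by simp
  have lin: "2 * (s + 1) \<le> 6 * k" if "s \<le> 2 * k" "1 \<le> k" for s k :: real
    using that by (simp add: algebra_simps)
  have inverse_cancel: "0 < d \<Longrightarrow> d * (1 / d) = 1" for d :: real by simp
  have "C * (NN / q) \<le> NN / 4"
  proof -
    have "4 * 1 * C \<le> 4 * real \<kappa> * C" using k1 pos by (intro mult_mono) auto
    then have "4 * C \<le> q" using Cq by simp
    then show ?thesis using pos by (simp add: field_simps)
  qed
  then have "real (card pos_in) \<le> NN / 4" using card_pos_in by linarith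
  then have cneg: "real (card neg) > 0" "real (card neg) \<le> NN"
    using cn pos(3) by linarith+
  define P where "P = C * (NN / q)"
  have Ppos: "P > 0" using pos by (simp add: P_def)
  define u where "u x = (if hit x then sqrt (num x) / sqrt P else 1 / sqrt (real (card neg)))" for x
  show ?thesis
  proof (rule adversary_from_matrix[where A = Adv and u = u])
    show "real m / (6 * real \<kappa>) > 0" using m \<kappa> by simp
    show "sqn neg u = 1"
    proof -
      have "sqn neg u = (\<Sum>x\<in>neg. 1 / real (card neg))"
        unfolding sqn_def by (intro sum.cong refl) (auto simp: u_def power_divide)
      also have "\<dots> = real (card neg) * (1 / real (card neg))" by (rule sum_constant)
      also have "\<dots> = 1" using cneg(1) by (rule inverse_cancel)
      finally show ?thesis .
    qed
    show "sqn pos_in u = 1"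
    proof -
      have "sqn pos_in u = (\<Sum>x\<in>pos_in. num x * (1 / P))"
        unfolding sqn_def
      proof (rule sum.cong[OF refl])
        fix x assume "x \<in> pos_in"
        then show "(u x)\<^sup>2 = num x * (1 / P)"
          using Ppos num_pos[of x] by (auto simp: u_def power_divide)
      qed
      also have "\<dots> = (\<Sum>S\<in>sel. real (card (XS S)) / P)" unfolding sum_num by simp
      also have "\<dots> = (\<Sum>S\<in>sel. NN / q / P)" by (rule sum.cong[OF refl]) (simp add: card_XS)
      also have "\<dots> = C * (NN / q) / P" using card_sel by simp
      finally show ?thesis using pos by (simp add: P_def)
    qed
    show "real m / (6 * real \<kappa>) \<le> form (Pow I) hit Adv u u"
    proof -
      define V0 where "V0 = sqrt (real (card neg)) * sqrt P"
      have V0: "V0 > 0" using cneg(1) Ppos unfolding V0_def by (intro mult_pos_pos real_sqrt_gt_zero) auto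
      have "form (Pow I) hit (\<lambda>x y. Adv x y * 1) u u
        = sqrt q / R * (\<Sum>S\<in>sel. \<Sum>y\<in>XS S. \<Sum>x\<in>Pow I. ker I (\<alpha> S) y x * ((u y / sqrt (num y)) * (if hit x then 0 else u x)))"
        by (rule form_Adv) simp
      also have "\<dots> = sqrt q / R * (\<Sum>S\<in>sel. \<Sum>y\<in>XS S. \<Sum>x\<in>Pow I. ker I (\<alpha> S) y x * (1 * (if hit x then 0 else 1)) / V0)"
      proof (intro arg_cong2[of _ _ _ _ "(*)"] refl sum.cong)
        fix S y x assume S: "S \<in> sel" "y \<in> XS S" "x \<in> Pow I"
        then have y: "hit y" "num y > 0" using XS_pos[OF S(1)] num_pos[of y] by auto
        have "(u y / sqrt (num y)) * (if hit x then 0 else u x) = 1 * (if hit x then 0 else 1) / V0"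
          using y by (auto simp: u_def V0_def)
        then show "ker I (\<alpha> S) y x * ((u y / sqrt (num y)) * (if hit x then 0 else u x))
          = ker I (\<alpha> S) y x * (1 * (if hit x then 0 else 1)) / V0" by simp
      qed
      also have "\<dots> = sqrt q / (R * V0) * (\<Sum>S\<in>sel. \<Sum>y\<in>XS S. \<Sum>x\<in>Pow I. ker I (\<alpha> S) y x * (1 * (if hit x then 0 else 1)))"
        by (simp only: sum_divide_distrib[symmetric]) simp
      finally have eq: "form (Pow I) hit Adv u u = \<dots>" by simp
      have "(\<Sum>S\<in>sel. real m * (NN / q) / 2) \<le> (\<Sum>S\<in>sel. \<Sum>y\<in>XS S. \<Sum>x\<in>Pow I. ker I (\<alpha> S) y x * (1 * (if hit x then 0 else 1)))"
        by (rule sum_mono) (rule value_each)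
      then have T: "P * (real m / 2) \<le> (\<Sum>S\<in>sel. \<Sum>y\<in>XS S. \<Sum>x\<in>Pow I. ker I (\<alpha> S) y x * (1 * (if hit x then 0 else 1)))"
        using card_sel by (simp add: P_def mult_ac)
      have V0le: "V0 \<le> sqrt NN * sqrt P"
        unfolding V0_def using cneg Ppos by (intro mult_right_mono) auto
      have "sqrt q * (P * (real m / 2)) = (sqrt NN * sqrt P) * (sqrt C * (real m / 2))"
      proof -
        have "sqrt q * P = sqrt (q * P) * sqrt P" using pos Ppos by (simp add: real_sqrt_mult)
        also have "q * P = NN * C" using pos by (simp add: P_def)
        finally show ?thesis by (simp add: real_sqrt_mult)
      qed
      also have "\<dots> \<ge> V0 * (sqrt C * (real m / 2))"
        using V0le pos by (intro mult_right_mono) auto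
      finally have "V0 * (sqrt C * (real m / 2)) / (R * V0) \<le> sqrt q * (P * (real m / 2)) / (R * V0)"
        using R_pos V0 by (intro divide_right_mono) auto
      also have "\<dots> = sqrt q / (R * V0) * (P * (real m / 2))" by simp
      also have "\<dots> \<le> form (Pow I) hit Adv u u"
        unfolding eq using T R_pos V0 pos by (intro mult_left_mono) auto
      finally have "sqrt C * (real m / 2) / R \<le> form (Pow I) hit Adv u u" using V0 by simp
      moreover have "sqrt C * (real m / 2) / R = real m / (2 * (sqrt (2 * real \<kappa>) + 1))"
        using pos by (simp add: R_def)
      moreover have "real m / (6 * real \<kappa>) \<le> real m / (2 * (sqrt (2 * real \<kappa>) + 1))"
      proof (rule divide_left_mono)
        have "2 * real \<kappa> \<le> (2 * real \<kappa>)\<^sup>2" using k1 by (simp add: power2_eq_square)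
        then have "sqrt (2 * real \<kappa>) \<le> 2 * real \<kappa>" using k1 by (intro real_le_lsqrt) auto
        then show "2 * (sqrt (2 * real \<kappa>) + 1) \<le> 6 * real \<kappa>" by (rule lin[OF _ k1])
        have "0 < sqrt (2 * real \<kappa>) + 1" by (intro add_nonneg_pos) auto
        then show "0 < 6 * real \<kappa> * (2 * (sqrt (2 * real \<kappa>) + 1))" using k1 by simp
      qed simp
      ultimately show ?thesis by linarith
    qed
    fix \<beta> a c assume "\<beta> \<in> (\<lambda>e x. e \<in> x) ` I"
    then obtain e where "e \<in> I" "\<beta> = (\<lambda>x. e \<in> x)" by auto
    then show "\<bar>form (Pow I) hit (\<lambda>x y. Adv x y * (if \<beta> x \<noteq> \<beta> y then 1 else 0)) a c\<bar> \<le> (sqn neg a + sqn pos_in c) / 2"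
      using contraction_bit[of e a c] by simp
  qed simp
qed

lemma XS_cong:
  assumes "x \<in> XS S" "y \<subseteq> I" "y \<inter> (gr S \<times> {..<b}) = x \<inter> (gr S \<times> {..<b})"
  shows "y \<in> XS S"
proof -
  have "gr S \<times> {\<beta>} \<inter> y = gr S \<times> {\<beta>} \<inter> x" if "\<beta> < b" for \<beta>
    using assms(3) that by auto
  then show ?thesis using assms(1,2) by (auto simp: XS_def chi_def)
qed

text \<open>
  Each bit of the input is represented by the pair of itself and its negation: then every
  certificate can be verified by reading ones only.
\<close>

theorem adversary_dnf:
  "\<exists>g. monotone_dnf (2 * (\<kappa> * n * b)) (\<kappa> * b) g \<and>
     adversary (inputs (2 * (\<kappa> * n * b))) g (input_bits (2 * (\<kappa> * n * b))) (real m / (6 * real \<kappa>))"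
proof -
  define K where "K = \<kappa> * n * b"
  have "card I = K" by (simp add: I_def letters_def K_def card_cartesian_product)
  then obtain h where h: "bij_betw h {..<K} I"
    using ex_bij_betw_nat_finite[OF finI] by (auto simp: atLeast0LessThan)
  define h' where "h' = inv_into {..<K} h"
  have h': "h' e < K" "h (h' e) = e" if "e \<in> I" for e
    using that h unfolding h'_def by (auto simp: bij_betw_def inv_into_into f_inv_into_f)
      (metis inv_into_into lessThan_iff)
  have hI: "h k \<in> I" "h' (h k) = k" if "k < K" for k
    using that h unfolding h'_def by (auto simp: bij_betw_def)
  define rail where "rail x = map (\<lambda>r. if even r then h (r div 2) \<in> x else h (r div 2) \<notin> x) [0..<2 * K]" for x
  \<comment> \<open>The position that reads one exactly for the inputs agreeing with
    \<open>x\<close> at \<open>e\<close>.\<close>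
  define pos where "pos x e = 2 * h' e + (if e \<in> x then 0 else 1)" for x e
  define term_of where "term_of S x = pos x ` (gr S \<times> {..<b})" for S x
  define TT where "TT = {term_of S x | S x. S \<in> sel \<and> x \<in> XS S}"
  define g where "g z \<longleftrightarrow> (\<exists>T\<in>TT. \<forall>i\<in>T. z ! i)" for z
  have pos_lt: "pos x e < 2 * K" if "e \<in> I" for x e
    using h'(1)[OF that] by (auto simp: pos_def)
  have "T \<subseteq> {..<2 * K} \<and> card T \<le> \<kappa> * b" if T_in: "T \<in> TT" for T
  proof -
    obtain S x where T: "T = term_of S x" "S \<in> sel" using T_in unfolding TT_def by blast
    have "gr S \<times> {..<b} \<subseteq> I" using gr_I[OF T(2)] by simp
    then have "T \<subseteq> {..<2 * K}" unfolding T term_of_def using pos_lt by auto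
    moreover have "card T \<le> card (gr S \<times> {..<b})"
      unfolding T term_of_def by (rule card_image_le) (simp add: gr_def)
    moreover have "card (gr S) \<le> card {..<\<kappa>}" unfolding gr_def by (rule card_image_le) simp
    ultimately show ?thesis
      by (auto simp: card_cartesian_product intro: order_trans mult_le_mono1)
  qed
  then have dnf: "monotone_dnf (2 * K) (\<kappa> * b) g"
    unfolding monotone_dnf_def g_def by blast
  have rail_nth: "rail y ! pos x e \<longleftrightarrow> (e \<in> y \<longleftrightarrow> e \<in> x)" if "e \<in> I" for x y e
    using pos_lt[OF that, of x] h'(2)[OF that] by (auto simp: rail_def pos_def)
  have val: "g (rail y) = hit y" if y: "y \<in> Pow I" for y
  proof
    assume "g (rail y)"
    then obtain S x where S: "S \<in> sel" "x \<in> XS S" "\<forall>i\<in>term_of S x. rail y ! i"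
      by (auto simp: g_def TT_def)
    have sub: "gr S \<times> {..<b} \<subseteq> I" using gr_I[OF S(1)] by simp
    have "e \<in> y \<longleftrightarrow> e \<in> x" if "e \<in> gr S \<times> {..<b}" for e
      using S(3) rail_nth[of e y x] that sub by (auto simp: term_of_def)
    then have "y \<in> XS S" using y by (intro XS_cong[OF S(2)]) auto
    then show "hit y" using S(1) by (auto simp: hit_def)
  next
    assume "hit y"
    then obtain S where S: "S \<in> sel" "y \<in> XS S" by (auto simp: hit_def)
    have sub: "gr S \<times> {..<b} \<subseteq> I" using gr_I[OF S(1)] by simp
    have "\<forall>i\<in>term_of S y. rail y ! i"
      using rail_nth sub by (auto simp: term_of_def)
    then show "g (rail y)" using S by (auto simp: g_def TT_def)
  qed
  have "adversary (inputs (2 * K)) g (input_bits (2 * K)) (real m / (6 * real \<kappa>))"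
  proof (rule adversary_embed[OF adversary_hit, where \<phi> = rail])
    show "inj_on rail (Pow I)"
    proof (rule inj_onI)
      fix x y assume xy: "x \<in> Pow I" "y \<in> Pow I" "rail x = rail y"
      have "e \<in> x \<longleftrightarrow> e \<in> y" if "e \<in> I" for e
        using rail_nth[OF that, of x x] rail_nth[OF that, of y x] xy(3) by auto
      then show "x = y" using xy by auto
    qed
    fix \<gamma> assume "\<gamma> \<in> input_bits (2 * K)"
    then obtain r where r: "r < 2 * K" "\<gamma> = (\<lambda>z. z ! r)" by (auto simp: input_bits_def)
    let ?\<beta> = "\<lambda>x. h (r div 2) \<in> x"
    have mem: "?\<beta> \<in> (\<lambda>e x. e \<in> x) ` I" using hI(1)[of "r div 2"] r(1) by auto
    show "(\<exists>c. \<forall>x\<in>Pow I. \<gamma> (rail x) = c) \<or>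
      (\<exists>\<beta>\<in>(\<lambda>e x. e \<in> x) ` I. (\<forall>x\<in>Pow I. \<gamma> (rail x) = \<beta> x) \<or> (\<forall>x\<in>Pow I. \<gamma> (rail x) = (\<not> \<beta> x)))"
      by (rule disjI2, rule bexI[OF _ mem]) (use r in \<open>auto simp: rail_def\<close>)
  next
    show "\<And>x. x \<in> Pow I \<Longrightarrow> g (rail x) = hit x" by (rule val)
  qed (use finite_inputs in \<open>auto simp: rail_def inputs_def\<close>)
  then show ?thesis using dnf unfolding K_def by blast
qed

end

subsection \<open>Certificates\<close>

definition agree :: "nat set \<Rightarrow> bool list \<Rightarrow> bool list \<Rightarrow> bool" where
  "agree D x y \<longleftrightarrow> (\<forall>i\<in>D. x ! i = y ! i)"

definition restr :: "nat set \<Rightarrow> bool list \<Rightarrow> nat \<rightharpoonup> bool" where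
  "restr D x i = (if i \<in> D then Some (x ! i) else None)"

definition cert_le :: "nat \<Rightarrow> (bool list \<Rightarrow> bool) \<Rightarrow> bool \<Rightarrow> nat \<Rightarrow> bool" where
  "cert_le N f b c \<longleftrightarrow> (\<forall>x\<in>inputs N. f x = b \<longrightarrow>
     (\<exists>D\<subseteq>{..<N}. card D \<le> c \<and> (\<forall>y\<in>inputs N. agree D x y \<longrightarrow> f y = f x)))"

text \<open>Unambiguity is encoded in the choice \<open>D\<close> of positions: it is constant on
  the inputs that agree with \<open>x\<close> on \<open>D x\<close>, so two chosen certificates
  consistent with a common input coincide.\<close>

definition ucert_le :: "nat \<Rightarrow> (bool list \<Rightarrow> bool) \<Rightarrow> bool \<Rightarrow> nat \<Rightarrow> bool" where
  "ucert_le N f b w \<longleftrightarrow> (\<exists>D. \<forall>x\<in>inputs N. f x = b \<longrightarrow> D x \<subseteq> {..<N} \<and> card (D x) \<le> w \<and>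
     (\<forall>y\<in>inputs N. agree (D x) x y \<longrightarrow> f y = f x \<and> D y = D x))"

lemma dom_restr [simp]: "dom (restr D x) = D"
  by (auto simp: restr_def dom_def)

lemma consistent_restr: "consistent (restr D x) y \<longleftrightarrow> D \<subseteq> {..<length y} \<and> agree D x y"
  unfolding consistent_def dom_restr by (auto simp: restr_def agree_def)

lemma agree_Un: "agree (D \<union> E) x y \<longleftrightarrow> agree D x y \<and> agree E x y"
  by (auto simp: agree_def)

lemma agree_UN: "agree (\<Union>i\<in>A. D i) x y \<longleftrightarrow> (\<forall>i\<in>A. agree (D i) x y)"
  by (auto simp: agree_def)

lemma agree_refl: "agree D x x"
  by (simp add: agree_def)

lemma cert_le_mono: "cert_le N f b c \<Longrightarrow> c \<le> c' \<Longrightarrow> cert_le N f b c'"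
  unfolding cert_le_def using le_trans[of _ c c'] by blast

lemma ucert_obtain:
  assumes "ucert_le N f b w"
  obtains D where "\<And>x. x \<in> inputs N \<Longrightarrow> f x = b \<Longrightarrow> D x \<subseteq> {..<N} \<and> card (D x) \<le> w \<and>
     (\<forall>y\<in>inputs N. agree (D x) x y \<longrightarrow> f y = f x \<and> D y = D x)"
proof -
  obtain D where D: "\<forall>x\<in>inputs N. f x = b \<longrightarrow> D x \<subseteq> {..<N} \<and> card (D x) \<le> w \<and>
     (\<forall>y\<in>inputs N. agree (D x) x y \<longrightarrow> f y = f x \<and> D y = D x)"
    using assms unfolding ucert_le_def ..
  show thesis by (rule that) (rule D[rule_format])
qed

lemma ucert_obtain_True:
  assumes "ucert_le N f True w"
  obtains D where "\<And>x. x \<in> inputs N \<Longrightarrow> f x \<Longrightarrow> D x \<subseteq> {..<N} \<and> card (D x) \<le> w \<and>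
     (\<forall>y\<in>inputs N. agree (D x) x y \<longrightarrow> f y = f x \<and> D y = D x)"
proof -
  obtain D where D: "\<And>x. x \<in> inputs N \<Longrightarrow> f x = True \<Longrightarrow> D x \<subseteq> {..<N} \<and> card (D x) \<le> w \<and>
     (\<forall>y\<in>inputs N. agree (D x) x y \<longrightarrow> f y = f x \<and> D y = D x)"
    by (fact ucert_obtain[OF assms])
  show thesis
  proof (rule that)
    fix x assume x: "x \<in> inputs N" "f x"
    have "f x = True" using x(2) by blast
    from D[OF x(1) this] show "D x \<subseteq> {..<N} \<and> card (D x) \<le> w \<and>
     (\<forall>y\<in>inputs N. agree (D x) x y \<longrightarrow> f y = f x \<and> D y = D x)" .
  qed
qed

lemma ucert_obtain_False:
  assumes "ucert_le N f False w"
  obtains D where "\<And>x. x \<in> inputs N \<Longrightarrow> \<not> f x \<Longrightarrow> D x \<subseteq> {..<N} \<and> card (D x) \<le> w \<and>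
     (\<forall>y\<in>inputs N. agree (D x) x y \<longrightarrow> f y = f x \<and> D y = D x)"
proof -
  obtain D where D: "\<And>x. x \<in> inputs N \<Longrightarrow> f x = False \<Longrightarrow> D x \<subseteq> {..<N} \<and> card (D x) \<le> w \<and>
     (\<forall>y\<in>inputs N. agree (D x) x y \<longrightarrow> f y = f x \<and> D y = D x)"
    by (fact ucert_obtain[OF assms])
  show thesis
  proof (rule that)
    fix x assume x: "x \<in> inputs N" "\<not> f x"
    have "f x = False" using x(2) by blast
    from D[OF x(1) this] show "D x \<subseteq> {..<N} \<and> card (D x) \<le> w \<and>
     (\<forall>y\<in>inputs N. agree (D x) x y \<longrightarrow> f y = f x \<and> D y = D x)" .
  qed
qed

lemma ucert_le_mono:
  assumes "ucert_le N f b c" "c \<le> c'"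
  shows "ucert_le N f b c'"
proof -
  obtain D where D: "\<And>x. x \<in> inputs N \<Longrightarrow> f x = b \<Longrightarrow> D x \<subseteq> {..<N} \<and> card (D x) \<le> c \<and>
     (\<forall>y\<in>inputs N. agree (D x) x y \<longrightarrow> f y = f x \<and> D y = D x)"
    by (fact ucert_obtain[OF assms(1)])
  show ?thesis unfolding ucert_le_def
  proof (intro exI[of _ D] ballI impI conjI)
    fix x assume "x \<in> inputs N" "f x = b"
    note Dx = D[OF this]
    show "D x \<subseteq> {..<N}" "card (D x) \<le> c'" using Dx assms(2) by simp_all
    show "f y = f x" "D y = D x" if "y \<in> inputs N" "agree (D x) x y" for y
      using Dx that by blast+
  qed
qed

lemma ucert_two_sided:
  assumes "ucert_le N f True w" "ucert_le N f False w"
  obtains D where "\<And>x. x \<in> inputs N \<Longrightarrow> D x \<subseteq> {..<N} \<and> card (D x) \<le> w \<and>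
    (\<forall>y\<in>inputs N. agree (D x) x y \<longrightarrow> f y = f x \<and> D y = D x)"
proof -
  obtain D1 where D1: "\<And>x. x \<in> inputs N \<Longrightarrow> f x \<Longrightarrow> D1 x \<subseteq> {..<N} \<and> card (D1 x) \<le> w \<and>
     (\<forall>y\<in>inputs N. agree (D1 x) x y \<longrightarrow> f y = f x \<and> D1 y = D1 x)"
    by (fact ucert_obtain_True[OF assms(1)])
  obtain D0 where D0: "\<And>x. x \<in> inputs N \<Longrightarrow> \<not> f x \<Longrightarrow> D0 x \<subseteq> {..<N} \<and> card (D0 x) \<le> w \<and>
     (\<forall>y\<in>inputs N. agree (D0 x) x y \<longrightarrow> f y = f x \<and> D0 y = D0 x)"
    by (fact ucert_obtain_False[OF assms(2)])
  show thesis
  proof (rule that[of "\<lambda>x. if f x then D1 x else D0 x"])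
    fix x assume x: "x \<in> inputs N"
    show "(if f x then D1 x else D0 x) \<subseteq> {..<N} \<and> card (if f x then D1 x else D0 x) \<le> w \<and>
      (\<forall>y\<in>inputs N. agree (if f x then D1 x else D0 x) x y \<longrightarrow> f y = f x \<and>
        (if f y then D1 y else D0 y) = (if f x then D1 x else D0 x))"
    proof (cases "f x")
      case True
      have "f y = f x \<and> (if f y then D1 y else D0 y) = D1 x" if "y \<in> inputs N" "agree (D1 x) x y" for y
        using D1[OF x True] that True by metis
      then show ?thesis using D1[OF x True] unfolding if_P[OF True] by blast
    next
      case False
      have "f y = f x \<and> (if f y then D1 y else D0 y) = D0 x" if "y \<in> inputs N" "agree (D0 x) x y" for y
        using D0[OF x False] that False by metis
      then show ?thesis using D0[OF x False] unfolding if_not_P[OF False] by blast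
    qed
  qed
qed

lemma cert_obtain:
  assumes "cert_le N f (f x) c" "x \<in> inputs N"
  obtains D where "D \<subseteq> {..<N}" "card D \<le> c" "\<And>y. y \<in> inputs N \<Longrightarrow> agree D x y \<Longrightarrow> f y = f x"
proof -
  have "\<exists>D\<subseteq>{..<N}. card D \<le> c \<and> (\<forall>y\<in>inputs N. agree D x y \<longrightarrow> f y = f x)"
    using assms(1)[unfolded cert_le_def, THEN bspec, OF assms(2)] by (rule mp) (rule refl)
  then obtain D where D: "D \<subseteq> {..<N} \<and> card D \<le> c \<and> (\<forall>y\<in>inputs N. agree D x y \<longrightarrow> f y = f x)" ..
  show thesis by (rule that[of D]) (use D in blast)+
qed

lemma ucert_family:
  assumes "ucert_le N f b w"
  shows "\<exists>S. (\<forall>p\<in>S. b_certificate N f b p \<and> card (dom p) \<le> w) \<and>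
    (\<forall>x\<in>inputs N. f x = b \<longrightarrow> (\<exists>!p. p \<in> S \<and> consistent p x))"
proof -
  obtain D where D: "\<And>x. x \<in> inputs N \<Longrightarrow> f x = b \<Longrightarrow> D x \<subseteq> {..<N} \<and> card (D x) \<le> w \<and>
     (\<forall>y\<in>inputs N. agree (D x) x y \<longrightarrow> f y = f x \<and> D y = D x)"
    by (fact ucert_obtain[OF assms])
  define S where "S = (\<lambda>x. restr (D x) x) ` {x \<in> inputs N. f x = b}"
  have con: "consistent (restr (D x) x) y \<longleftrightarrow> agree (D x) x y" if "x \<in> inputs N" "f x = b" "y \<in> inputs N" for x y
    using D[OF that(1,2)] that(3) by (auto simp: consistent_restr inputs_def)
  have "b_certificate N f b p \<and> card (dom p) \<le> w" if pS: "p \<in> S" for p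
  proof -
    obtain x where x: "x \<in> inputs N" "f x = b" "p = restr (D x) x" using pS by (auto simp: S_def)
    have "certificate N f x p"
      unfolding certificate_def x(3) using con[OF x(1,2)] D[OF x(1,2)] x(1) agree_refl by blast
    then show ?thesis using x D[OF x(1,2)] by (auto simp: b_certificate_def)
  qed
  moreover have "\<exists>!p. p \<in> S \<and> consistent p x" if x: "x \<in> inputs N" "f x = b" for x
  proof (rule ex1I[of _ "restr (D x) x"])
    show "restr (D x) x \<in> S \<and> consistent (restr (D x) x) x"
      using con[OF x x(1)] x agree_refl[of "D x" x] by (auto simp: S_def)
    fix p assume p: "p \<in> S \<and> consistent p x"
    then obtain y where y: "y \<in> inputs N" "f y = b" "p = restr (D y) y" by (auto simp: S_def)
    then have ag: "agree (D y) y x" using con[OF y(1,2) x(1)] p by simp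
    then have "D x = D y" using D[OF y(1,2)] x(1) by auto
    then show "p = restr (D x) x" using y(3) ag by (auto simp: restr_def agree_def)
  qed
  ultimately show ?thesis by (intro exI[of _ S] conjI) blast+
qed

lemma UC_b_le: "ucert_le N f b w \<Longrightarrow> UC_b N f b \<le> w"
  unfolding UC_b_def by (intro Least_le ucert_family)

section \<open>Certificates under block composition\<close>

lemma shift_blocks:
  fixes n M i :: nat
  assumes "D \<subseteq> {..<M}" "i < n"
  shows "(\<lambda>q. i * M + q) ` D \<subseteq> {..<n * M}" "card ((\<lambda>q. i * M + q) ` D) = card D"
proof -
  show "(\<lambda>q. i * M + q) ` D \<subseteq> {..<n * M}"
    using assms block_bound[OF assms(2), of M] by auto
  show "card ((\<lambda>q. i * M + q) ` D) = card D" by (rule card_image) (auto simp: inj_on_def)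
qed

lemma agree_shift:
  assumes "length x \<ge> i * M + M" "length y \<ge> i * M + M" "D \<subseteq> {..<M}"
  shows "agree ((\<lambda>q. i * M + q) ` D) x y \<longleftrightarrow> agree D (blk M i x) (blk M i y)"
  using assms by (auto simp: agree_def blk_nth subset_iff)

lemma agree_shift_inputs:
  assumes "x \<in> inputs (n * M)" "y \<in> inputs (n * M)" "i < n" "D \<subseteq> {..<M}"
  shows "agree ((\<lambda>q. i * M + q) ` D) x y \<longleftrightarrow> agree D (blk M i x) (blk M i y)"
  using assms block_bound[of i n M] by (intro agree_shift) (auto simp: inputs_def)

lemma card_UN_blocks_le:
  assumes "finite A" "\<And>i. i \<in> A \<Longrightarrow> card (D i) \<le> c" "card A \<le> k"
  shows "card (\<Union>i\<in>A. D i) \<le> k * (c :: nat)"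
proof -
  have "card (\<Union>i\<in>A. D i) \<le> (\<Sum>i\<in>A. card (D i))" by (rule card_UN_le[OF assms(1)])
  also have "\<dots> \<le> (\<Sum>i\<in>A. c)" by (rule sum_mono) (rule assms(2))
  also have "\<dots> \<le> k * c" using assms(3) by simp
  finally show ?thesis .
qed

lemma blocks_union_subset:
  fixes n M :: nat
  assumes "\<And>i. i \<in> A \<Longrightarrow> i < n" "\<And>i. i \<in> A \<Longrightarrow> D i \<subseteq> {..<M}"
  shows "(\<Union>i\<in>A. (\<lambda>q. i * M + q) ` D i) \<subseteq> {..<n * M}"
  by (rule UN_least) (rule shift_blocks(1)[OF assms(2,1)])

lemma blocks_union_card:
  fixes M :: nat
  assumes "finite A" "card A \<le> k" "\<And>i. i \<in> A \<Longrightarrow> D i \<subseteq> {..<M}" "\<And>i. i \<in> A \<Longrightarrow> card (D i) \<le> c"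
  shows "card (\<Union>i\<in>A. (\<lambda>q. i * M + q) ` D i) \<le> k * c"
proof (rule card_UN_blocks_le[OF assms(1) _ assms(2)])
  fix i assume i: "i \<in> A"
  have "card ((\<lambda>q. i * M + q) ` D i) \<le> card (D i)"
    by (rule card_image_le) (rule finite_subset[OF assms(3)[OF i]], simp)
  then show "card ((\<lambda>q. i * M + q) ` D i) \<le> c" using assms(4)[OF i] by simp
qed

lemma monotone_dnf_term:
  assumes "monotone_dnf N t g" "x \<in> inputs N" "g x"
  shows "\<exists>T\<subseteq>{..<N}. card T \<le> t \<and> (\<forall>i\<in>T. x ! i) \<and> (\<forall>y\<in>inputs N. (\<forall>i\<in>T. y ! i) \<longrightarrow> g y)"
proof -
  obtain \<T> where \<T>: "(\<forall>T\<in>\<T>. T \<subseteq> {..<N} \<and> card T \<le> t) \<and>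
      (\<forall>z\<in>inputs N. g z \<longleftrightarrow> (\<exists>T\<in>\<T>. \<forall>i\<in>T. z ! i))"
    using assms(1) unfolding monotone_dnf_def ..
  have g: "g z \<longleftrightarrow> (\<exists>T\<in>\<T>. \<forall>i\<in>T. z ! i)" if "z \<in> inputs N" for z
    using \<T> that by (elim conjE) (rule bspec)
  have "\<exists>T\<in>\<T>. \<forall>i\<in>T. x ! i" using g[OF assms(2)] assms(3) by (rule iffD1)
  then obtain T where T: "T \<in> \<T>" "\<forall>i\<in>T. x ! i" ..
  have "g y" if y: "y \<in> inputs N" "\<forall>i\<in>T. y ! i" for y
    by (rule iffD2[OF g[OF y(1)]], rule bexI[of _ T], rule y(2), rule T(1))
  moreover have "T \<subseteq> {..<N} \<and> card T \<le> t" using \<T> T(1) by (elim conjE) (rule bspec)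
  ultimately show ?thesis using T(2) by (intro exI[of _ T]) simp
qed

lemma cert_dnf:
  assumes "monotone_dnf N t g"
  shows "cert_le N g True t"
  unfolding cert_le_def
proof (intro ballI impI)
  fix x assume x: "x \<in> inputs N" "g x = True"
  then obtain T where "T \<subseteq> {..<N}" "card T \<le> t" "\<forall>i\<in>T. x ! i"
    and "\<And>y. y \<in> inputs N \<Longrightarrow> \<forall>i\<in>T. y ! i \<Longrightarrow> g y"
    using monotone_dnf_term[OF assms x(1)] x(2) by auto
  then show "\<exists>D\<subseteq>{..<N}. card D \<le> t \<and> (\<forall>y\<in>inputs N. agree D x y \<longrightarrow> g y = g x)"
    using x(2) by (intro exI[of _ T]) (auto simp: agree_def)
qed

text \<open>A satisfied term asks for a 1-certificate of each of its at most \<open>t\<close>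
  blocks; since the terms are monotone, no 0-certificate is involved.\<close>

lemma cert_dnf_compose:
  assumes dnf: "monotone_dnf n t g" and c1: "cert_le M f True c1"
  shows "cert_le (n * M) (\<lambda>x. g (block_map n M f x)) True (t * c1)"
  unfolding cert_le_def
proof (intro ballI impI)
  fix x assume x: "x \<in> inputs (n * M)" "g (block_map n M f x) = True"
  then obtain T where T: "T \<subseteq> {..<n}" "card T \<le> t" "\<And>i. i \<in> T \<Longrightarrow> block_map n M f x ! i"
    and gT: "\<And>y. y \<in> inputs n \<Longrightarrow> \<forall>i\<in>T. y ! i \<Longrightarrow> g y"
    using monotone_dnf_term[OF dnf block_map_inputs] x(2) by metis
  have finT: "finite T" using T(1) finite_subset by blast
  have "\<exists>D\<subseteq>{..<M}. card D \<le> c1 \<and> (\<forall>y\<in>inputs M. agree D (blk M i x) y \<longrightarrow> f y = f (blk M i x))" if "i \<in> T" for i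
    using c1 blk_in_inputs[OF x(1), of i] T(3)[OF that] T(1) that unfolding cert_le_def by auto
  then obtain D where D: "\<And>i. i \<in> T \<Longrightarrow> D i \<subseteq> {..<M} \<and> card (D i) \<le> c1 \<and>
      (\<forall>y\<in>inputs M. agree (D i) (blk M i x) y \<longrightarrow> f y = f (blk M i x))" by metis
  let ?D = "\<Union>i\<in>T. (\<lambda>q. i * M + q) ` D i"
  show "\<exists>D\<subseteq>{..<n * M}. card D \<le> t * c1 \<and>
      (\<forall>y\<in>inputs (n * M). agree D x y \<longrightarrow> g (block_map n M f y) = g (block_map n M f x))"
  proof (intro exI[of _ ?D] conjI ballI impI)
    show "?D \<subseteq> {..<n * M}" by (rule blocks_union_subset) (use T(1) in blast, use D in blast)
    show "card ?D \<le> t * c1" by (rule blocks_union_card[OF finT T(2)]) (use D in blast, use D in blast)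
    fix y assume y: "y \<in> inputs (n * M)" "agree ?D x y"
    have "block_map n M f y ! i" if i: "i \<in> T" for i
    proof -
      have "i < n" using T(1) i by auto
      moreover have "agree (D i) (blk M i x) (blk M i y)"
        using y(2) i D[OF i] agree_shift_inputs[OF x(1) y(1) \<open>i < n\<close>] by (auto simp: agree_UN)
      ultimately show ?thesis using D[OF i] T(3)[OF i] blk_in_inputs[OF y(1)] by simp
    qed
    then show "g (block_map n M f y) = g (block_map n M f x)" using gT x(2) by simp
  qed
qed

text \<open>By monotonicity the value stays false as long as no zero block turns into a one, so the
  certificate consists of 0-certificates of the zero blocks.\<close>

lemma cert_dnf_compose_False:
  assumes dnf: "monotone_dnf n t g" and c0: "cert_le M f False c0"
  shows "cert_le (n * M) (\<lambda>x. g (block_map n M f x)) False (n * c0)"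
  unfolding cert_le_def
proof (intro ballI impI)
  fix x assume x: "x \<in> inputs (n * M)" "g (block_map n M f x) = False"
  define Z where "Z = {i. i < n \<and> \<not> f (blk M i x)}"
  have finZ: "finite Z" and cZ: "card Z \<le> n"
    using card_mono[of "{..<n}" Z] by (auto simp: Z_def)
  have "\<exists>D\<subseteq>{..<M}. card D \<le> c0 \<and> (\<forall>y\<in>inputs M. agree D (blk M i x) y \<longrightarrow> f y = f (blk M i x))" if "i \<in> Z" for i
    using c0 blk_in_inputs[OF x(1), of i] that unfolding cert_le_def Z_def by auto
  then obtain D where D: "\<And>i. i \<in> Z \<Longrightarrow> D i \<subseteq> {..<M} \<and> card (D i) \<le> c0 \<and>
      (\<forall>y\<in>inputs M. agree (D i) (blk M i x) y \<longrightarrow> f y = f (blk M i x))" by metis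
  let ?D = "\<Union>i\<in>Z. (\<lambda>q. i * M + q) ` D i"
  show "\<exists>D\<subseteq>{..<n * M}. card D \<le> n * c0 \<and>
      (\<forall>y\<in>inputs (n * M). agree D x y \<longrightarrow> g (block_map n M f y) = g (block_map n M f x))"
  proof (intro exI[of _ ?D] conjI ballI impI)
    show "?D \<subseteq> {..<n * M}" by (rule blocks_union_subset) (simp add: Z_def, use D in blast)
    show "card ?D \<le> n * c0" by (rule blocks_union_card[OF finZ cZ]) (use D in blast, use D in blast)
    fix y assume y: "y \<in> inputs (n * M)" "agree ?D x y"
    have le: "f (blk M i x)" if i: "i < n" "f (blk M i y)" for i
    proof (rule ccontr)
      assume "\<not> f (blk M i x)"
      then have iZ: "i \<in> Z" using i by (simp add: Z_def)
      then have "agree (D i) (blk M i x) (blk M i y)"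
        using y(2) D[OF iZ] agree_shift_inputs[OF x(1) y(1) i(1)] by (auto simp: agree_UN)
      then show False using D[OF iZ] blk_in_inputs[OF y(1) i(1)] i \<open>\<not> f (blk M i x)\<close> by auto
    qed
    have "\<not> g (block_map n M f y)"
    proof
      assume "g (block_map n M f y)"
      then obtain T where T: "T \<subseteq> {..<n}" "\<And>i. i \<in> T \<Longrightarrow> block_map n M f y ! i"
        and gT: "\<And>z. z \<in> inputs n \<Longrightarrow> \<forall>i\<in>T. z ! i \<Longrightarrow> g z"
        using monotone_dnf_term[OF dnf block_map_inputs] by metis
      have "\<forall>i\<in>T. block_map n M f x ! i"
      proof
        fix i assume "i \<in> T"
        moreover from this have "i < n" using T(1) by auto
        ultimately show "block_map n M f x ! i" using le[of i] T(2)[of i] by simp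
      qed
      then show False using gT[OF block_map_inputs] x(2) by simp
    qed
    then show "g (block_map n M f y) = g (block_map n M f x)" using x(2) by simp
  qed
qed

lemma ucert_compose:
  assumes "ucert_le M f True w" "ucert_le M f False w"
  shows "ucert_le (n * M) (\<lambda>x. g (block_map n M f x)) b (n * w)"
proof -
  obtain D where D: "\<And>x. x \<in> inputs M \<Longrightarrow> D x \<subseteq> {..<M} \<and> card (D x) \<le> w \<and>
    (\<forall>y\<in>inputs M. agree (D x) x y \<longrightarrow> f y = f x \<and> D y = D x)"
    by (fact ucert_two_sided[OF assms])
  define E where "E x = (\<Union>i<n. (\<lambda>q. i * M + q) ` D (blk M i x))" for x
  show ?thesis
    unfolding ucert_le_def
  proof (intro exI[of _ E] ballI impI conjI)
    fix x assume x: "x \<in> inputs (n * M)"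
    note Dx = D[OF blk_in_inputs[OF x]]
    show "E x \<subseteq> {..<n * M}" unfolding E_def by (rule blocks_union_subset) (simp, use Dx in blast)
    show "card (E x) \<le> n * w" unfolding E_def by (rule blocks_union_card) (simp, simp, use Dx in blast, use Dx in blast)
    fix y assume y: "y \<in> inputs (n * M)" "agree (E x) x y"
    have "agree (D (blk M i x)) (blk M i x) (blk M i y)" if "i < n" for i
      using y(2) that Dx[OF that] agree_shift_inputs[OF x y(1) that] by (auto simp: E_def agree_UN)
    then have *: "f (blk M i y) = f (blk M i x) \<and> D (blk M i y) = D (blk M i x)" if "i < n" for i
      using Dx[OF that] blk_in_inputs[OF y(1) that] that by blast
    show "g (block_map n M f y) = g (block_map n M f x)"
      using * by (intro arg_cong[of _ _ g]) (simp add: block_map_def)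
    show "E y = E x" unfolding E_def using * by (intro SUP_cong refl) auto
  qed
qed

lemma ucert_trivial: "ucert_le N f b N"
  unfolding ucert_le_def
proof (intro exI[of _ "\<lambda>_. {..<N}"] ballI impI conjI)
  fix x y assume "x \<in> inputs N" "y \<in> inputs N" "agree {..<N} x y"
  then have "y = x" by (auto simp: agree_def inputs_def list_eq_iff_nth_eq)
  then show "f y = f x" by simp
qed auto

lemma cert_trivial: "cert_le N f b N"
  unfolding cert_le_def
proof (intro ballI impI exI[of _ "{..<N}"] conjI)
  fix x y assume "x \<in> inputs N" "y \<in> inputs N" "agree {..<N} x y"
  then have "y = x" by (auto simp: agree_def inputs_def list_eq_iff_nth_eq)
  then show "f y = f x" by simp
qed auto

lemma cert_not: "cert_le N (\<lambda>x. \<not> f x) b c = cert_le N f (\<not> b) c"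
  unfolding cert_le_def by auto

section \<open>Conjunctions of blocks\<close>

definition and_blocks :: "nat \<Rightarrow> nat \<Rightarrow> (bool list \<Rightarrow> bool) \<Rightarrow> bool list \<Rightarrow> bool" where
  "and_blocks n M h x \<longleftrightarrow> (\<forall>i<n. h (blk M i x))"

lemma cert_and_True:
  assumes "cert_le M h True c"
  shows "cert_le (n * M) (and_blocks n M h) True (n * c)"
  unfolding cert_le_def
proof (intro ballI impI)
  fix x assume x: "x \<in> inputs (n * M)" "and_blocks n M h x = True"
  have "\<exists>D\<subseteq>{..<M}. card D \<le> c \<and> (\<forall>y\<in>inputs M. agree D (blk M i x) y \<longrightarrow> h y = h (blk M i x))" if "i < n" for i
    using assms blk_in_inputs[OF x(1) that] x(2) that unfolding cert_le_def and_blocks_def by auto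
  then obtain D where D: "\<And>i. i < n \<Longrightarrow> D i \<subseteq> {..<M} \<and> card (D i) \<le> c \<and>
      (\<forall>y\<in>inputs M. agree (D i) (blk M i x) y \<longrightarrow> h y = h (blk M i x))" by metis
  let ?D = "\<Union>i<n. (\<lambda>q. i * M + q) ` D i"
  show "\<exists>D\<subseteq>{..<n * M}. card D \<le> n * c \<and> (\<forall>y\<in>inputs (n * M). agree D x y \<longrightarrow> and_blocks n M h y = and_blocks n M h x)"
  proof (intro exI[of _ ?D] conjI ballI impI)
    show "?D \<subseteq> {..<n * M}" by (rule blocks_union_subset) (simp, use D in blast)
    show "card ?D \<le> n * c" by (rule blocks_union_card) (simp, simp, use D in blast, use D in blast)
    fix y assume y: "y \<in> inputs (n * M)" "agree ?D x y"
    have "agree (D i) (blk M i x) (blk M i y)" if "i < n" for i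
      using y(2) that D[OF that] agree_shift_inputs[OF x(1) y(1) that] by (auto simp: agree_UN)
    then have "h (blk M i y) = h (blk M i x)" if "i < n" for i
      using D[OF that] blk_in_inputs[OF y(1) that] that by blast
    then show "and_blocks n M h y = and_blocks n M h x" by (simp add: and_blocks_def)
  qed
qed

lemma cert_and_False:
  assumes "cert_le M h False c"
  shows "cert_le (n * M) (and_blocks n M h) False c"
  unfolding cert_le_def
proof (intro ballI impI)
  fix x assume x: "x \<in> inputs (n * M)" "and_blocks n M h x = False"
  then obtain i where i: "i < n" "\<not> h (blk M i x)" by (auto simp: and_blocks_def)
  obtain D where D: "D \<subseteq> {..<M}" "card D \<le> c" "\<And>y. y \<in> inputs M \<Longrightarrow> agree D (blk M i x) y \<Longrightarrow> h y = h (blk M i x)"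
    using assms blk_in_inputs[OF x(1) i(1)] i(2) unfolding cert_le_def by auto
  show "\<exists>D\<subseteq>{..<n * M}. card D \<le> c \<and> (\<forall>y\<in>inputs (n * M). agree D x y \<longrightarrow> and_blocks n M h y = and_blocks n M h x)"
  proof (intro exI[of _ "(\<lambda>q. i * M + q) ` D"] conjI ballI impI)
    fix y assume y: "y \<in> inputs (n * M)" "agree ((\<lambda>q. i * M + q) ` D) x y"
    then have "agree D (blk M i x) (blk M i y)" using agree_shift_inputs[OF x(1) y(1) i(1) D(1)] by simp
    then have "\<not> h (blk M i y)" using D(3) blk_in_inputs[OF y(1) i(1)] i(2) by simp
    then show "and_blocks n M h y = and_blocks n M h x" using i x(2) by (auto simp: and_blocks_def)
  qed (use shift_blocks[OF D(1) i(1)] D(2) in auto)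
qed

lemma ucert_and_True:
  assumes "ucert_le M h True w"
  shows "ucert_le (n * M) (and_blocks n M h) True (n * w)"
proof -
  obtain D where D: "\<And>x. x \<in> inputs M \<Longrightarrow> h x \<Longrightarrow> D x \<subseteq> {..<M} \<and> card (D x) \<le> w \<and>
    (\<forall>y\<in>inputs M. agree (D x) x y \<longrightarrow> h y = h x \<and> D y = D x)"
    by (fact ucert_obtain_True[OF assms])
  define E where "E x = (\<Union>i<n. (\<lambda>q. i * M + q) ` D (blk M i x))" for x
  show ?thesis
    unfolding ucert_le_def
  proof (intro exI[of _ E] ballI impI conjI)
    fix x assume x: "x \<in> inputs (n * M)" "and_blocks n M h x = True"
    have Dx: "D (blk M i x) \<subseteq> {..<M} \<and> card (D (blk M i x)) \<le> w \<and>
      (\<forall>y\<in>inputs M. agree (D (blk M i x)) (blk M i x) y \<longrightarrow> h y = h (blk M i x) \<and> D y = D (blk M i x))" if "i < n" for i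
      using D[OF blk_in_inputs[OF x(1) that]] x(2) that by (simp add: and_blocks_def)
    show "E x \<subseteq> {..<n * M}" unfolding E_def by (rule blocks_union_subset) (simp, use Dx in blast)
    show "card (E x) \<le> n * w" unfolding E_def by (rule blocks_union_card) (simp, simp, use Dx in blast, use Dx in blast)
    fix y assume y: "y \<in> inputs (n * M)" "agree (E x) x y"
    have "agree (D (blk M i x)) (blk M i x) (blk M i y)" if "i < n" for i
      using y(2) that Dx[OF that] agree_shift_inputs[OF x(1) y(1) that] by (auto simp: E_def agree_UN)
    then have *: "h (blk M i y) = h (blk M i x) \<and> D (blk M i y) = D (blk M i x)" if "i < n" for i
      using Dx[OF that] blk_in_inputs[OF y(1) that] that by blast
    show "and_blocks n M h y = and_blocks n M h x" using * by (simp add: and_blocks_def)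
    show "E y = E x" unfolding E_def using * by (intro SUP_cong refl) auto
  qed
qed

text \<open>
  A rejecting input of the conjunction is certified by its first rejecting block, whose position
  is made unambiguous by accepting certificates of all earlier blocks.
\<close>

lemma ucert_and_False:
  assumes w1: "ucert_le M h True w1" and w: "ucert_le M h False w0"
  shows "ucert_le (n * M) (and_blocks n M h) False (n * w1 + w0)"
proof -
  obtain D1 where D1: "\<And>x. x \<in> inputs M \<Longrightarrow> h x \<Longrightarrow> D1 x \<subseteq> {..<M} \<and> card (D1 x) \<le> w1 \<and>
    (\<forall>y\<in>inputs M. agree (D1 x) x y \<longrightarrow> h y = h x \<and> D1 y = D1 x)"
    by (fact ucert_obtain_True[OF w1])
  obtain D0 where D0: "\<And>x. x \<in> inputs M \<Longrightarrow> \<not> h x \<Longrightarrow> D0 x \<subseteq> {..<M} \<and> card (D0 x) \<le> w0 \<and>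
    (\<forall>y\<in>inputs M. agree (D0 x) x y \<longrightarrow> h y = h x \<and> D0 y = D0 x)"
    by (fact ucert_obtain_False[OF w])
  define first where "first x = (LEAST i. \<not> h (blk M i x))" for x
  define E where "E x = (\<Union>i<first x. (\<lambda>q. i * M + q) ` D1 (blk M i x)) \<union> (\<lambda>q. first x * M + q) ` D0 (blk M (first x) x)" for x
  show ?thesis
    unfolding ucert_le_def
  proof (intro exI[of _ E] ballI impI)
    fix x assume x: "x \<in> inputs (n * M)" "and_blocks n M h x = False"
    then obtain i where i: "i < n" "\<not> h (blk M i x)" by (auto simp: and_blocks_def)
    define j where "j = first x"
    have j: "\<not> h (blk M j x)" "j \<le> i"
      unfolding j_def first_def
      by (rule LeastI[of "\<lambda>i. \<not> h (blk M i x)", OF i(2)], rule Least_le[of "\<lambda>i. \<not> h (blk M i x)", OF i(2)])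
    have jn: "j < n" using j i by simp
    have before: "h (blk M i' x)" if "i' < j" for i' using not_less_Least[of i'] that unfolding j_def first_def by auto
    have Ex: "E x = (\<Union>i<j. (\<lambda>q. i * M + q) ` D1 (blk M i x)) \<union> (\<lambda>q. j * M + q) ` D0 (blk M j x)"
      by (simp add: E_def j_def)
    note Dj = D0[OF blk_in_inputs[OF x(1) jn] j(1)]
    have Di: "D1 (blk M i x) \<subseteq> {..<M} \<and> card (D1 (blk M i x)) \<le> w1 \<and>
      (\<forall>y\<in>inputs M. agree (D1 (blk M i x)) (blk M i x) y \<longrightarrow> h y = h (blk M i x) \<and> D1 y = D1 (blk M i x))" if "i < j" for i
      using D1[OF blk_in_inputs[OF x(1)] before[OF that]] that jn by simp
    show "E x \<subseteq> {..<n * M} \<and> card (E x) \<le> n * w1 + w0 \<and>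
      (\<forall>y\<in>inputs (n * M). agree (E x) x y \<longrightarrow> and_blocks n M h y = and_blocks n M h x \<and> E y = E x)"
    proof (intro conjI ballI impI)
      show "E x \<subseteq> {..<n * M}"
        unfolding Ex
      proof (rule Un_least)
        show "(\<Union>i<j. (\<lambda>q. i * M + q) ` D1 (blk M i x)) \<subseteq> {..<n * M}"
          by (rule blocks_union_subset) (use jn in simp, use Di in blast)
        show "(\<lambda>q. j * M + q) ` D0 (blk M j x) \<subseteq> {..<n * M}"
          using Dj by (intro shift_blocks(1)[OF _ jn]) blast
      qed
      have "card (\<Union>i<j. (\<lambda>q. i * M + q) ` D1 (blk M i x)) \<le> n * w1"
        by (rule blocks_union_card) (simp, use jn in simp, use Di in blast, use Di in blast)
      moreover have "card ((\<lambda>q. j * M + q) ` D0 (blk M j x)) \<le> w0"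
        using Dj shift_blocks(2)[OF _ jn, of "D0 (blk M j x)" M] by simp
      ultimately show "card (E x) \<le> n * w1 + w0" unfolding Ex by (meson add_mono card_Un_le order_trans)
      fix y assume y: "y \<in> inputs (n * M)" "agree (E x) x y"
      have "agree (D1 (blk M i x)) (blk M i x) (blk M i y)" if "i < j" for i
        using y(2) that Di[OF that] agree_shift_inputs[OF x(1) y(1), of i] jn by (auto simp: Ex agree_UN agree_Un)
      then have *: "h (blk M i y) = h (blk M i x) \<and> D1 (blk M i y) = D1 (blk M i x)" if "i < j" for i
        using Di[OF that] blk_in_inputs[OF y(1), of i] that jn by auto
      have "agree (D0 (blk M j x)) (blk M j x) (blk M j y)"
        using y(2) Dj agree_shift_inputs[OF x(1) y(1) jn] by (auto simp: Ex agree_Un)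
      then have **: "h (blk M j y) = h (blk M j x) \<and> D0 (blk M j y) = D0 (blk M j x)"
        using Dj blk_in_inputs[OF y(1) jn] by auto
      then show "and_blocks n M h y = and_blocks n M h x"
        using x(2) jn j by (auto simp: and_blocks_def)
      have "first y = j"
        unfolding first_def
      proof (rule Least_equality)
        show "\<not> h (blk M j y)" using ** j by simp
        show "j \<le> i'" if "\<not> h (blk M i' y)" for i'
          using that * before by (meson not_le)
      qed
      then show "E y = E x" unfolding Ex using * ** by (simp add: E_def)
    qed
  qed
qed

text \<open>A certificate missing block \<open>j\<close> would remain consistent after replacing
  that block by the rejected \<open>v\<close>; so the certificate of the all-\<open>u\<close> input
  meets every block. This makes UC unbounded along the final sequence. The assumption
  \<open>uc\<close> ensures that the \<open>LEAST\<close> in \<open>UC_b\<close> is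
  attained.\<close>

lemma UC_and_lower:
  assumes uc: "ucert_le (n * M) (and_blocks n M h) True w"
    and u: "u \<in> inputs M" "h u" and v: "v \<in> inputs M" "\<not> h v"
  shows "n \<le> UC_b (n * M) (and_blocks n M h) True"
proof -
  let ?f = "and_blocks n M h" and ?N = "n * M"
  let ?P = "\<lambda>w. \<exists>S. (\<forall>p\<in>S. b_certificate ?N ?f True p \<and> card (dom p) \<le> w) \<and>
                   (\<forall>x\<in>inputs ?N. ?f x = True \<longrightarrow> (\<exists>!p. p \<in> S \<and> consistent p x))"
  have ex: "\<exists>w. ?P w" using ucert_family[OF uc] by blast
  have "?P (UC_b ?N ?f True)" unfolding UC_b_def using ex by (rule LeastI_ex)
  then obtain S where "(\<forall>p\<in>S. b_certificate ?N ?f True p \<and> card (dom p) \<le> UC_b ?N ?f True) \<and>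
      (\<forall>x\<in>inputs ?N. ?f x = True \<longrightarrow> (\<exists>!p. p \<in> S \<and> consistent p x))" ..
  then have S: "\<And>p. p \<in> S \<Longrightarrow> b_certificate ?N ?f True p \<and> card (dom p) \<le> UC_b ?N ?f True"
    "\<And>x. x \<in> inputs ?N \<Longrightarrow> ?f x = True \<Longrightarrow> \<exists>!p. p \<in> S \<and> consistent p x" by blast+
  \<comment> \<open>The blocks are numbered below \<open>n\<close>, so \<open>z n\<close> has none
    of them replaced.\<close>
  define z where "z j = concat (map (\<lambda>i. if i = j then v else u) [0..<n])" for j
  have len: "length u = M" "length v = M" using u v by (simp_all add: inputs_def)
  have z_in: "z j \<in> inputs ?N" for j
    using length_concat_blocks[of n "\<lambda>i. if i = j then v else u" M] len by (simp add: z_def inputs_def)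
  have z_blk: "blk M i (z j) = (if i = j then v else u)" if "i < n" for i j
    using blk_concat[of n "\<lambda>i. if i = j then v else u" M i "[]"] len that by (simp add: z_def)
  have "?f (z n) = True" using z_blk u(2) by (simp add: and_blocks_def)
  then obtain p where p: "p \<in> S" "consistent p (z n)" using S(2)[OF z_in] by blast
  have dom: "dom p \<subseteq> {..<?N}" using p(2) z_in[of n] by (auto simp: consistent_def inputs_def)
  have "{..<n} \<subseteq> (\<lambda>k. k div M) ` dom p"
  proof
    fix j assume "j \<in> {..<n}"
    then have j: "j < n" by simp
    show "j \<in> (\<lambda>k. k div M) ` dom p"
    proof (rule ccontr)
      assume no: "j \<notin> (\<lambda>k. k div M) ` dom p"
      have "consistent p (z j)"
        unfolding consistent_def
      proof (intro ballI conjI)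
        fix k assume k: "k \<in> dom p"
        then have kN: "k < ?N" using dom by auto
        note d = div_mod_block[OF kN]
        show "k < length (z j)" using kN z_in[of j] by (simp add: inputs_def)
        have "k div M \<noteq> j" using no k by auto
        then have "blk M (k div M) (z j) = blk M (k div M) (z n)" using z_blk[OF d(1)] d(1) by simp
        then have "z j ! k = z n ! k"
          using blk_nth_inputs[OF z_in d(1,2), of j] blk_nth_inputs[OF z_in d(1,2), of n] d(3) by simp
        then show "p k = Some (z j ! k)" using p(2) k by (simp add: consistent_def)
      qed
      moreover have "\<not> ?f (z j)" using z_blk[OF j, of j] j v(2) by (auto simp: and_blocks_def)
      moreover have "b_certificate ?N ?f True p" using S(1)[OF p(1)] by simp
      ultimately show False using z_in[of j] by (auto simp: b_certificate_def certificate_def)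
    qed
  qed
  moreover have fin: "finite (dom p)" using dom finite_subset by blast
  ultimately have "card {..<n} \<le> card (dom p)" by (meson card_image_le card_mono finite_imageI order_trans)
  then show ?thesis using S(1)[OF p(1)] by simp
qed

section \<open>Naming certificates by bit strings\<close>

text \<open>A partial assignment of size at most \<open>c\<close> is written as \<open>c\<close>
  entries of \<open>e\<close> bits, each entry empty or a pair of an index and a bit. The index
  \<open>M\<close>, beyond inputs of length \<open>M\<close>, is included as room for the blank of
  \<open>certificate_codes\<close>.\<close>

lemma partial_assignment_codes:
  fixes M c e :: nat
  assumes "2 * (M + 1) + 1 \<le> 2 ^ e"
  defines "P \<equiv> {p :: nat \<rightharpoonup> bool. dom p \<subseteq> {..M} \<and> card (dom p) \<le> c}"
  shows "\<exists>\<iota>. inj_on \<iota> P \<and> \<iota> ` P \<subseteq> inputs (c * e)"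
proof -
  define E where "E = insert None (Some ` ({..M} \<times> (UNIV :: bool set)))"
  define Ls where "Ls = {l. set l \<subseteq> E \<and> length l = c}"
  have finE: "finite E" by (simp add: E_def)
  have cE: "card E \<le> 2 ^ e"
  proof -
    have "card E \<le> Suc (card (Some ` ({..M} \<times> (UNIV :: bool set))))" unfolding E_def by (rule card_insert_le_m1) auto
    also have "card (Some ` ({..M} \<times> (UNIV :: bool set))) \<le> card ({..M} \<times> (UNIV :: bool set))" by (rule card_image_le) simp
    also have "\<dots> = 2 * (M + 1)" by (simp add: card_cartesian_product)
    finally show ?thesis using assms(1) by simp
  qed
  have finL: "finite Ls" unfolding Ls_def by (rule finite_lists_length_eq[OF finE])
  have "card Ls = card E ^ c" unfolding Ls_def by (rule card_lists_length_eq[OF finE])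
  also have "\<dots> \<le> (2 ^ e) ^ c" by (rule power_mono[OF cE]) simp
  finally have cL: "card Ls \<le> card (inputs (c * e))" by (simp add: card_inputs power_mult[symmetric] mult.commute)
  define dec where "dec l = map_of (concat (map (\<lambda>r. case r of None \<Rightarrow> [] | Some iv \<Rightarrow> [iv]) l))" for l :: "(nat \<times> bool) option list"
  have "P \<subseteq> dec ` Ls"
  proof
    fix p assume "p \<in> P"
    then have p: "dom p \<subseteq> {..M}" "card (dom p) \<le> c" by (auto simp: P_def)
    have fin: "finite (dom p)" using p(1) finite_subset by blast
    define ks where "ks = sorted_list_of_set (dom p)"
    have "length ks = card (dom p)" "set ks = dom p" using fin by (simp_all add: ks_def)
    define l where "l = map (\<lambda>i. Some (i, the (p i))) ks @ replicate (c - length ks) None"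
    have "l \<in> Ls" using p \<open>length ks = _\<close> \<open>set ks = _\<close> by (auto simp: Ls_def l_def E_def)
    moreover have "dec l = map_of (map (\<lambda>i. (i, the (p i))) ks)"
    proof -
      have "concat (map (\<lambda>r. case r of None \<Rightarrow> [] | Some iv \<Rightarrow> [iv]) (map (\<lambda>i. Some (i, the (p i))) ks))
          = map (\<lambda>i. (i, the (p i))) ks" by (induction ks) auto
      moreover have "concat (map (\<lambda>r. case r of None \<Rightarrow> [] | Some iv \<Rightarrow> [iv]) (replicate k (None :: (nat \<times> bool) option))) = []" for k
        by (induction k) auto
      ultimately show ?thesis unfolding dec_def l_def map_append concat_append by simp
    qed
    moreover have "map_of (map (\<lambda>i. (i, the (p i))) ks) = p"
    proof
      fix i show "map_of (map (\<lambda>i. (i, the (p i))) ks) i = p i"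
        using \<open>set ks = _\<close> by (cases "i \<in> dom p") (auto simp: map_of_map_keys map_of_map_restrict restrict_map_def)
    qed
    ultimately show "p \<in> dec ` Ls" by (intro image_eqI[of _ _ l]) simp_all
  qed
  then have "card P \<le> card (inputs (c * e))" "finite P"
    using surj_card_le[OF finL] cL finL finite_subset[of P "dec ` Ls"] by fastforce+
  then show ?thesis using card_le_inj[of P "inputs (c * e)"] by auto
qed

lemma certificate_codes:
  assumes c1: "cert_le M F True c" and c0: "cert_le M F False c" and c: "c \<ge> 1"
    and e: "2 * (M + 1) + 1 \<le> 2 ^ e"
  shows "\<exists>dec enc blank. (\<forall>x\<in>inputs M. enc x \<in> inputs (c * e) \<and> certificate M F x (dec (enc x)))
    \<and> blank \<in> inputs (c * e) \<and> (\<forall>x\<in>inputs M. \<not> certificate M F x (dec blank))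
    \<and> (\<forall>r. finite (dom (dec r)) \<and> card (dom (dec r)) \<le> c)"
proof -
  define P where "P = {p :: nat \<rightharpoonup> bool. dom p \<subseteq> {..M} \<and> card (dom p) \<le> c}"
  obtain \<iota> where \<iota>: "inj_on \<iota> P" "\<iota> ` P \<subseteq> inputs (c * e)"
    using partial_assignment_codes[OF e, of c] unfolding P_def by blast
  \<comment> \<open>Words that name nothing decode to the empty assignment, so the size bound holds
    for arbitrary content of a sheet.\<close>
  define dec where "dec r = (if r \<in> \<iota> ` P then the_inv_into P \<iota> r else Map.empty)" for r
  have dec: "dec (\<iota> p) = p" if "p \<in> P" for p
    using that \<iota>(1) by (simp add: dec_def the_inv_into_f_f)
  \<comment> \<open>An assignment to the nonexistent variable \<open>M\<close> is consistent with no
    input; it serves as the blank.\<close>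
  have bad: "[M \<mapsto> True] \<in> P" using c by (simp add: P_def)
  have "\<exists>p\<in>P. certificate M F x p" if x: "x \<in> inputs M" for x
  proof -
    have cF: "cert_le M F (F x) c" using c1 c0 by (cases "F x") auto
    obtain D where D: "D \<subseteq> {..<M}" "card D \<le> c" "\<And>y. y \<in> inputs M \<Longrightarrow> agree D x y \<Longrightarrow> F y = F x"
      by (fact cert_obtain[OF cF x])
    have "restr D x \<in> P"
      using D(1,2) unfolding P_def dom_restr mem_Collect_eq by (intro conjI) auto
    moreover have "certificate M F x (restr D x)"
      unfolding certificate_def consistent_restr
    proof (intro conjI ballI impI)
      show "D \<subseteq> {..<length x}" using D(1) x by (simp add: inputs_def)
      show "agree D x x" by (rule agree_refl)
      show "F y = F x" if "y \<in> inputs M" "D \<subseteq> {..<length y} \<and> agree D x y" for y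
        by (rule D(3)[OF that(1) conjunct2[OF that(2)]])
    qed
    ultimately show ?thesis by blast
  qed
  then obtain p where p: "\<And>x. x \<in> inputs M \<Longrightarrow> p x \<in> P \<and> certificate M F x (p x)" by metis
  show ?thesis
  proof (intro exI[of _ dec] exI[of _ "\<lambda>x. \<iota> (p x)"] exI[of _ "\<iota> [M \<mapsto> True]"] conjI ballI allI)
    show "\<iota> (p x) \<in> inputs (c * e)" "certificate M F x (dec (\<iota> (p x)))" if "x \<in> inputs M" for x
      using p[OF that] \<iota>(2) dec by auto
    show "\<iota> [M \<mapsto> True] \<in> inputs (c * e)" using bad \<iota>(2) by auto
    show "\<not> certificate M F x (dec (\<iota> [M \<mapsto> True]))" if "x \<in> inputs M" for x
      using that unfolding dec[OF bad] by (auto simp: certificate_def consistent_def inputs_def)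
    have "dec r \<in> P" for r
      using the_inv_into_into[OF \<iota>(1), of r P] by (auto simp: dec_def P_def)
    then show "finite (dom (dec r))" "card (dom (dec r)) \<le> c" for r
      using finite_subset[of "dom (dec r)" "{..M}"] by (auto simp: P_def)
  qed
qed

section \<open>Certificates of a cheat sheet\<close>

context
  fixes l M s c :: nat and addr :: "bool list \<Rightarrow> nat" and dec :: "bool list \<Rightarrow> nat \<rightharpoonup> bool" and F :: "bool list \<Rightarrow> bool"
  assumes addr: "\<And>v. v \<in> inputs l \<Longrightarrow> addr v < 2 ^ l"
    and dec: "\<And>r. finite (dom (dec r)) \<and> card (dom (dec r)) \<le> c"
begin

definition cell :: "bool list \<Rightarrow> nat set" where
  "cell z = (\<lambda>r. l * M + (addr (block_map l M F z) * l * s + r)) ` {..<l * s}"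

text \<open>The cut to \<open>{..<M}\<close> drops indices that name no variable, such as the one in
  the blank.\<close>

definition pointed :: "bool list \<Rightarrow> nat set" where
  "pointed z = (\<Union>j<l. (\<lambda>q. j * M + q) ` (dom (dec (cheat_entry l M s z (addr (block_map l M F z)) j)) \<inter> {..<M}))"

lemma blk_in_cheat:
  assumes "z \<in> inputs (cheat_len l M s)" "j < l"
  shows "blk M j z \<in> inputs M" "j * M + M \<le> length z"
  using assms block_bound[of j l M] by (auto simp: cheat_len_def inputs_def intro!: blk_inputs[unfolded inputs_def, simplified])

lemma cell_sub: "z \<in> inputs (cheat_len l M s) \<Longrightarrow> cell z \<subseteq> {..<cheat_len l M s}"
proof
  fix k assume "k \<in> cell z"
  then obtain r where r: "r < l * s" "k = l * M + (addr (block_map l M F z) * l * s + r)" by (auto simp: cell_def)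
  have "addr (block_map l M F z) * (l * s) + l * s \<le> 2 ^ l * (l * s)"
    by (rule block_bound) (rule addr, simp)
  then show "k \<in> {..<cheat_len l M s}" using r by (simp add: cheat_len_def mult.assoc)
qed

lemma cell_card: "card (cell z) \<le> l * s"
  unfolding cell_def by (rule order_trans[OF card_image_le]) auto

lemma pointed_sub: "pointed z \<subseteq> {..<cheat_len l M s}"
proof -
  have "pointed z \<subseteq> {..<l * M}"
    unfolding pointed_def by (rule blocks_union_subset) auto
  then show ?thesis by (auto simp: cheat_len_def)
qed

lemma pointed_card: "card (pointed z) \<le> l * c"
  unfolding pointed_def
proof (rule card_UN_blocks_le)
  fix j
  let ?d = "dom (dec (cheat_entry l M s z (addr (block_map l M F z)) j))"
  have "card ((\<lambda>q. j * M + q) ` (?d \<inter> {..<M})) \<le> card (?d \<inter> {..<M})" by (rule card_image_le) simp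
  also have "\<dots> \<le> card ?d" using dec by (intro card_mono) auto
  finally show "card ((\<lambda>q. j * M + q) ` (?d \<inter> {..<M})) \<le> c" using dec order_trans by blast
qed auto

lemma entry_cong:
  assumes z: "z \<in> inputs (cheat_len l M s)" "y \<in> inputs (cheat_len l M s)" "agree (cell z) z y" and j: "j < l"
  shows "cheat_entry l M s y (addr (block_map l M F z)) j = cheat_entry l M s z (addr (block_map l M F z)) j"
proof -
  let ?a = "addr (block_map l M F z)"
  have a: "?a < 2 ^ l" by (rule addr) simp
  have al: "?a * l + j < 2 ^ l * l" using block_bound[OF a, of l] j by simp
  have len: "(?a * l + j) * s + s \<le> length (drop (l * M) z)" "(?a * l + j) * s + s \<le> length (drop (l * M) y)"
    using block_bound[OF al, of s] z by (auto simp: cheat_len_def inputs_def)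
  show ?thesis
    unfolding cheat_entry_def
  proof (rule nth_equalityI)
    show l: "length (blk s (?a * l + j) (drop (l * M) y)) = length (blk s (?a * l + j) (drop (l * M) z))"
      using blk_inputs[OF len(1)] blk_inputs[OF len(2)] by (simp add: inputs_def)
    fix q assume "q < length (blk s (?a * l + j) (drop (l * M) y))"
    then have q: "q < s" using blk_inputs[OF len(2)] by (simp add: inputs_def)
    have "j * s + q < l * s" using block_bound[OF j, of s] q by simp
    then have "l * M + (?a * l * s + (j * s + q)) \<in> cell z" by (auto simp: cell_def)
    then have "z ! (l * M + (?a * l * s + (j * s + q))) = y ! (l * M + (?a * l * s + (j * s + q)))"
      using z(3) by (auto simp: agree_def)
    moreover have "?a * l * s + (j * s + q) = (?a * l + j) * s + q" by (simp add: algebra_simps)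
    moreover have "l * M \<le> length z" "l * M \<le> length y" using z by (auto simp: cheat_len_def inputs_def)
    ultimately show "blk s (?a * l + j) (drop (l * M) y) ! q = blk s (?a * l + j) (drop (l * M) z) ! q"
      using blk_nth[OF len(1) q] blk_nth[OF len(2) q] by (simp add: nth_drop)
  qed
qed

lemma consistent_cong:
  assumes "x \<in> inputs M" "y \<in> inputs M" "agree (dom p \<inter> {..<M}) x y"
  shows "consistent p x = consistent p y"
proof -
  have "(i < length x \<and> p i = Some (x ! i)) = (i < length y \<and> p i = Some (y ! i))" if "i \<in> dom p" for i
    using assms that by (auto simp: agree_def inputs_def)
  then show ?thesis by (simp add: consistent_def)
qed

lemma pointed_agree:
  assumes "z \<in> inputs (cheat_len l M s)" "y \<in> inputs (cheat_len l M s)" "agree (pointed z) z y" "j < l"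
  shows "consistent (dec (cheat_entry l M s z (addr (block_map l M F z)) j)) (blk M j y)
    = consistent (dec (cheat_entry l M s z (addr (block_map l M F z)) j)) (blk M j z)"
proof (rule consistent_cong[symmetric])
  show "blk M j z \<in> inputs M" "blk M j y \<in> inputs M" using blk_in_cheat assms by auto
  show "agree (dom (dec (cheat_entry l M s z (addr (block_map l M F z)) j)) \<inter> {..<M}) (blk M j z) (blk M j y)"
    using assms(3,4) blk_in_cheat(2)[OF assms(1,4)] blk_in_cheat(2)[OF assms(2,4)]
    by (subst agree_shift[symmetric]) (auto simp: pointed_def agree_UN)
qed

text \<open>Equal values of \<open>F\<close> mean the same address, so agreement on that one cell
  and on what it points to settles the function value.\<close>

lemma cheat_cong:
  assumes z: "z \<in> inputs (cheat_len l M s)" and y: "y \<in> inputs (cheat_len l M s)"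
    and ag: "agree (cell z) z y" "agree (pointed z) z y"
    and vals: "\<And>j. j < l \<Longrightarrow> F (blk M j y) = F (blk M j z)"
  shows "cheat_sheet l M s addr dec F y = cheat_sheet l M s addr dec F z" "cell y = cell z" "pointed y = pointed z"
proof -
  have bm: "block_map l M F y = block_map l M F z" using vals by (simp add: block_map_def)
  note en = entry_cong[OF z y ag(1)]
  show "cell y = cell z" by (simp add: cell_def bm)
  show "pointed y = pointed z" unfolding pointed_def bm using en by (intro SUP_cong refl) auto
  have "certificate M F (blk M j y) p = certificate M F (blk M j z) p"
    if "j < l" "p = dec (cheat_entry l M s z (addr (block_map l M F z)) j)" for j p
    using pointed_agree[OF z y ag(2) that(1)] vals[OF that(1)] that(2) by (simp add: certificate_def)
  then show "cheat_sheet l M s addr dec F y = cheat_sheet l M s addr dec F z"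
    unfolding cheat_sheet_def bm using en by auto
qed

text \<open>The assignments in the addressed cell certify all \<open>l\<close> values of
  \<open>F\<close>, hence the address itself. Any input agreeing on the cell and on what it points
  to therefore has the same cell with the same content, which makes the certificate unambiguous,
  whatever the unambiguous complexity of \<open>F\<close>.\<close>

lemma ucert_cheat_True: "ucert_le (cheat_len l M s) (cheat_sheet l M s addr dec F) True (l * s + l * c)"
  unfolding ucert_le_def
proof (intro exI[of _ "\<lambda>z. cell z \<union> pointed z"] ballI impI)
  fix z assume z: "z \<in> inputs (cheat_len l M s)" "cheat_sheet l M s addr dec F z = True"
  show "cell z \<union> pointed z \<subseteq> {..<cheat_len l M s} \<and> card (cell z \<union> pointed z) \<le> l * s + l * c \<and>
    (\<forall>y\<in>inputs (cheat_len l M s). agree (cell z \<union> pointed z) z y \<longrightarrow>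
       cheat_sheet l M s addr dec F y = cheat_sheet l M s addr dec F z \<and> cell y \<union> pointed y = cell z \<union> pointed z)"
  proof (intro conjI ballI impI)
    show "cell z \<union> pointed z \<subseteq> {..<cheat_len l M s}" using cell_sub[OF z(1)] pointed_sub by blast
    show "card (cell z \<union> pointed z) \<le> l * s + l * c"
      using cell_card pointed_card by (meson add_mono card_Un_le order_trans)
    fix y assume y: "y \<in> inputs (cheat_len l M s)" "agree (cell z \<union> pointed z) z y"
    then have ag: "agree (cell z) z y" "agree (pointed z) z y" by (auto simp: agree_Un)
    have "F (blk M j y) = F (blk M j z)" if j: "j < l" for j
    proof -
      have "certificate M F (blk M j z) (dec (cheat_entry l M s z (addr (block_map l M F z)) j))"
        using z(2) j by (simp add: cheat_sheet_def)
      then show ?thesis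
        using pointed_agree[OF z(1) y(1) ag(2) j] blk_in_cheat(1)[OF y(1) j] by (auto simp: certificate_def)
    qed
    then show "cheat_sheet l M s addr dec F y = cheat_sheet l M s addr dec F z" "cell y \<union> pointed y = cell z \<union> pointed z"
      using cheat_cong[OF z(1) y(1) ag] by auto
  qed
qed

text \<open>A rejecting sheet may contain garbage, so the address has to be fixed from outside: by
  unambiguous certificates of the \<open>l\<close> values of \<open>F\<close>, to which the cell and
  what it points to are added.\<close>

lemma ucert_cheat:
  assumes "ucert_le M F True w" "ucert_le M F False w"
  shows "ucert_le (cheat_len l M s) (cheat_sheet l M s addr dec F) b (l * w + (l * s + l * c))"
proof -
  obtain D where D: "\<And>x. x \<in> inputs M \<Longrightarrow> D x \<subseteq> {..<M} \<and> card (D x) \<le> w \<and>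
    (\<forall>y\<in>inputs M. agree (D x) x y \<longrightarrow> F y = F x \<and> D y = D x)"
    by (fact ucert_two_sided[OF assms])
  define E where "E z = (\<Union>j<l. (\<lambda>q. j * M + q) ` D (blk M j z))" for z
  show ?thesis
    unfolding ucert_le_def
  proof (intro exI[of _ "\<lambda>z. E z \<union> (cell z \<union> pointed z)"] ballI impI)
    fix z assume z: "z \<in> inputs (cheat_len l M s)"
    note Dz = D[OF blk_in_cheat(1)[OF z]]
    show "E z \<union> (cell z \<union> pointed z) \<subseteq> {..<cheat_len l M s} \<and> card (E z \<union> (cell z \<union> pointed z)) \<le> l * w + (l * s + l * c) \<and>
      (\<forall>y\<in>inputs (cheat_len l M s). agree (E z \<union> (cell z \<union> pointed z)) z y \<longrightarrow>
        cheat_sheet l M s addr dec F y = cheat_sheet l M s addr dec F z \<and>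
        E y \<union> (cell y \<union> pointed y) = E z \<union> (cell z \<union> pointed z))"
    proof (intro conjI ballI impI)
      have "E z \<subseteq> {..<l * M}" unfolding E_def by (rule blocks_union_subset) (simp, use Dz in blast)
      then show "E z \<union> (cell z \<union> pointed z) \<subseteq> {..<cheat_len l M s}"
        using cell_sub[OF z] pointed_sub by (auto simp: cheat_len_def)
      have "card (E z) \<le> l * w"
        unfolding E_def by (rule blocks_union_card) (simp, simp, use Dz in blast, use Dz in blast)
      moreover have "card (cell z \<union> pointed z) \<le> l * s + l * c"
        using cell_card pointed_card by (meson add_mono card_Un_le order_trans)
      ultimately show "card (E z \<union> (cell z \<union> pointed z)) \<le> l * w + (l * s + l * c)"
        by (meson add_mono card_Un_le order_trans)
      fix y assume y: "y \<in> inputs (cheat_len l M s)" "agree (E z \<union> (cell z \<union> pointed z)) z y"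
      then have ag: "agree (E z) z y" "agree (cell z) z y" "agree (pointed z) z y" by (auto simp: agree_Un)
      have "agree (D (blk M j z)) (blk M j z) (blk M j y)" if "j < l" for j
        using ag(1) that Dz[OF that] agree_shift[OF blk_in_cheat(2)[OF z that] blk_in_cheat(2)[OF y(1) that]]
        by (auto simp: E_def agree_UN)
      then have *: "F (blk M j y) = F (blk M j z) \<and> D (blk M j y) = D (blk M j z)" if "j < l" for j
        using Dz[OF that] blk_in_cheat(1)[OF y(1) that] that by blast
      then have "E y = E z" unfolding E_def by (intro SUP_cong refl) auto
      with cheat_cong[OF z y(1) ag(2,3)] * show
        "cheat_sheet l M s addr dec F y = cheat_sheet l M s addr dec F z"
        "E y \<union> (cell y \<union> pointed y) = E z \<union> (cell z \<union> pointed z)" by auto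
    qed
  qed
qed

text \<open>As in \<open>ucert_cheat\<close>, but with ordinary certificates of the values of
  \<open>F\<close>, which are much smaller.\<close>

lemma cert_cheat:
  assumes "cert_le M F True c'" "cert_le M F False c'"
  shows "cert_le (cheat_len l M s) (cheat_sheet l M s addr dec F) b (l * c' + (l * s + l * c))"
  unfolding cert_le_def
proof (intro ballI impI)
  fix z assume z: "z \<in> inputs (cheat_len l M s)"
  have "\<exists>D\<subseteq>{..<M}. card D \<le> c' \<and> (\<forall>y\<in>inputs M. agree D (blk M j z) y \<longrightarrow> F y = F (blk M j z))" if j: "j < l" for j
  proof -
    have cF: "cert_le M F (F (blk M j z)) c'" using assms by (cases "F (blk M j z)") auto
    obtain D where "D \<subseteq> {..<M}" "card D \<le> c'" "\<And>y. y \<in> inputs M \<Longrightarrow> agree D (blk M j z) y \<Longrightarrow> F y = F (blk M j z)"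
      by (fact cert_obtain[OF cF blk_in_cheat(1)[OF z j]])
    then show ?thesis by (intro exI[of _ D]) simp
  qed
  then obtain D where D: "\<And>j. j < l \<Longrightarrow> D j \<subseteq> {..<M} \<and> card (D j) \<le> c' \<and>
      (\<forall>y\<in>inputs M. agree (D j) (blk M j z) y \<longrightarrow> F y = F (blk M j z))" by metis
  let ?E = "\<Union>j<l. (\<lambda>q. j * M + q) ` D j"
  show "\<exists>D\<subseteq>{..<cheat_len l M s}. card D \<le> l * c' + (l * s + l * c) \<and>
    (\<forall>y\<in>inputs (cheat_len l M s). agree D z y \<longrightarrow> cheat_sheet l M s addr dec F y = cheat_sheet l M s addr dec F z)"
  proof (intro exI[of _ "?E \<union> (cell z \<union> pointed z)"] conjI ballI impI)
    have "?E \<subseteq> {..<l * M}" by (rule blocks_union_subset) (simp, use D in blast)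
    also have "{..<l * M} \<subseteq> {..<cheat_len l M s}" by (auto simp: cheat_len_def)
    finally show "?E \<union> (cell z \<union> pointed z) \<subseteq> {..<cheat_len l M s}"
      using cell_sub[OF z] pointed_sub by blast
    have "card ?E \<le> l * c'" by (rule blocks_union_card) (simp, simp, use D in blast, use D in blast)
    moreover have "card (cell z \<union> pointed z) \<le> l * s + l * c"
      using cell_card pointed_card by (meson add_mono card_Un_le order_trans)
    ultimately show "card (?E \<union> (cell z \<union> pointed z)) \<le> l * c' + (l * s + l * c)"
      by (meson add_mono card_Un_le order_trans)
    fix y assume y: "y \<in> inputs (cheat_len l M s)" "agree (?E \<union> (cell z \<union> pointed z)) z y"
    then have ag: "agree ?E z y" "agree (cell z) z y" "agree (pointed z) z y" by (auto simp: agree_Un)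
    have "agree (D j) (blk M j z) (blk M j y)" if "j < l" for j
      using ag(1) that D[OF that] agree_shift[OF blk_in_cheat(2)[OF z that] blk_in_cheat(2)[OF y(1) that]]
      by (auto simp: agree_UN)
    then have "F (blk M j y) = F (blk M j z)" if "j < l" for j
      using D[OF that] blk_in_cheat(1)[OF y(1) that] that by blast
    then show "cheat_sheet l M s addr dec F y = cheat_sheet l M s addr dec F z"
      using cheat_cong(1)[OF z y(1) ag(2,3)] by blast
  qed
qed

end

subsection \<open>Iterating the construction\<close>

definition level :: "nat \<Rightarrow> (bool list \<Rightarrow> bool) \<Rightarrow> nat \<Rightarrow> nat \<Rightarrow> nat \<Rightarrow> real \<Rightarrow> bool" where
  "level N f c0 c1 w \<Lambda> \<longleftrightarrow> cert_le N f False c0 \<and> cert_le N f True c1 \<and>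
     ucert_le N f True w \<and> ucert_le N f False w \<and> adversary (inputs N) f (input_bits N) \<Lambda>"

lemma level_mono:
  assumes "level N f c0 c1 w \<Lambda>" "c0 \<le> c0'" "c1 \<le> c1'" "w \<le> w'" "0 \<le> \<Lambda>'" "\<Lambda>' \<le> \<Lambda>"
  shows "level N f c0' c1' w' \<Lambda>'"
  using assms cert_le_mono ucert_le_mono adversary_mono[OF finite_inputs _ assms(5,6)]
  unfolding level_def by blast

text \<open>Negation puts the short certificates of the DNF on the value \<open>False\<close>, where
  the next round multiplies them by the number of blocks.\<close>

lemma level_dnf:
  assumes "monotone_dnf L t g" "adversary (inputs L) g (input_bits L) \<Lambda>"
  shows "level L (\<lambda>x. \<not> g x) t L L \<Lambda>"
  unfolding level_def cert_not
  using cert_dnf[OF assms(1)] cert_trivial ucert_trivial adversary_not[OF assms(2)] by simp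

lemma level_UC: "level N f c0 c1 w \<Lambda> \<Longrightarrow> UC N f \<le> w"
  unfolding level_def UC_def using UC_b_le by auto

lemma and_blocks_eq: "and_blocks n M h = (\<lambda>x. \<forall>i<n. block_map n M h x ! i)"
  by (auto simp: and_blocks_def fun_eq_iff)

text \<open>One round of the iteration. \<open>c\<close> bounds the certificates of the composition
  of \<open>g\<close> with \<open>f\<close> for both values, an entry of the sheet takes
  \<open>e\<close> bits per fixed variable, and \<open>cH\<close> adds up the certificates of
  \<open>l\<close> values, the cell of \<open>l\<close> entries and the positions it points to. The
  expensive term \<open>l * (L * w)\<close> enters once, for the first rejecting block, and is not
  multiplied by \<open>n\<close>.\<close>

theorem level_step:
  assumes lev: "level N\<^sub>0 f c0 c1 w \<Lambda>\<^sub>0"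
    and dnf: "monotone_dnf L t g" and advg: "adversary (inputs L) g (input_bits L) \<Lambda>g"
    and pos: "n > 0" "l > 0" "c \<ge> 1"
    and c: "t * c1 \<le> c" "L * c0 \<le> c" and e: "2 * (L * N\<^sub>0 + 1) + 1 \<le> 2 ^ e"
    and \<Lambda>': "0 \<le> \<Lambda>'" "\<Lambda>' \<le> 2 * (\<Lambda>g * \<Lambda>\<^sub>0)" "\<Lambda>' \<le> sqrt 2 ^ l"
    and cH: "cH = l * c + (l * (c * e) + l * c)"
    and N: "N = n * cheat_len l (L * N\<^sub>0) (c * e)"
  shows "\<exists>f'. level N f' cH (n * cH) (n * cH + (l * (L * w) + cH)) (sqrt (real n) * \<Lambda>') \<and> n \<le> UC_b N f' True"
proof -
  define M where "M = L * N\<^sub>0"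
  define F where "F = (\<lambda>x. g (block_map L N\<^sub>0 f x))"
  define s where "s = c * e"
  define NH where "NH = cheat_len l M s"
  have cert1: "cert_le M F True c" unfolding M_def F_def
    using cert_le_mono[OF cert_dnf_compose[OF dnf] c(1)] lev by (simp add: level_def)
  have cert0: "cert_le M F False c" unfolding M_def F_def
    using cert_le_mono[OF cert_dnf_compose_False[OF dnf] c(2)] lev by (simp add: level_def)
  have uF: "ucert_le M F b (L * w)" for b unfolding M_def F_def
    using ucert_compose lev by (simp add: level_def)
  have advF: "adversary (inputs M) F (input_bits M) (\<Lambda>g * \<Lambda>\<^sub>0)" unfolding M_def F_def
    using adversary_compose[OF advg] lev by (simp add: level_def)
  obtain dec enc blank where
    enc: "\<And>x. x \<in> inputs M \<Longrightarrow> enc x \<in> inputs s \<and> certificate M F x (dec (enc x))"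
    and blank: "blank \<in> inputs s" "\<And>x. x \<in> inputs M \<Longrightarrow> \<not> certificate M F x (dec blank)"
    and dec: "\<And>r. finite (dom (dec r)) \<and> card (dom (dec r)) \<le> c"
    using certificate_codes[OF cert1 cert0 pos(3) e[folded M_def]] unfolding s_def by blast
  obtain addr where "bij_betw addr (inputs l) {0..<card (inputs l)}"
    using ex_bij_betw_finite_nat[OF finite_inputs] by blast
  then have addr: "inj_on addr (inputs l)" "\<And>v. v \<in> inputs l \<Longrightarrow> addr v < 2 ^ l"
    by (auto simp: bij_betw_def card_inputs)
  define H where "H = cheat_sheet l M s addr dec F"
  have advH: "adversary (inputs NH) H (input_bits NH) \<Lambda>'"
    unfolding NH_def H_def
    by (rule adversary_cheat_sheet[OF advF \<Lambda>' pos(2) addr enc blank])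
  have ls: "l * s + l * c \<le> cH" "l * c + (l * s + l * c) = cH" by (simp_all add: cH s_def)
  note sheet = ucert_cheat_True[where addr = addr and dec = dec, OF addr(2) dec]
    ucert_cheat[where addr = addr and dec = dec, OF addr(2) dec uF uF]
    cert_cheat[where addr = addr and dec = dec, OF addr(2) dec cert1 cert0]
  have uH1: "ucert_le NH H True cH"
    unfolding NH_def H_def by (rule ucert_le_mono[OF sheet(1) ls(1)])
  have uH0: "ucert_le NH H False (l * (L * w) + cH)"
    unfolding NH_def H_def by (rule ucert_le_mono[OF sheet(2) add_left_mono[OF ls(1)]])
  have cHb: "cert_le NH H b cH" for b
    using sheet(3)[of s b] unfolding NH_def H_def ls(2) .
  define f' where "f' = and_blocks n NH H"
  have "adversary (inputs (n * NH)) f' (input_bits (n * NH)) (sqrt (real n) * \<Lambda>')"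
    unfolding f'_def and_blocks_eq by (rule adversary_compose[OF adversary_and[OF pos(1)] advH])
  moreover have u1: "ucert_le (n * NH) f' True (n * cH)"
    unfolding f'_def by (rule ucert_and_True[OF uH1])
  moreover have "ucert_le (n * NH) f' True (n * cH + (l * (L * w) + cH))"
    by (rule ucert_le_mono[OF u1]) simp
  moreover have "ucert_le (n * NH) f' False (n * cH + (l * (L * w) + cH))"
    unfolding f'_def by (rule ucert_and_False[OF uH1 uH0])
  moreover have "cert_le (n * NH) f' True (n * cH)" "cert_le (n * NH) f' False cH"
    unfolding f'_def by (rule cert_and_True[OF cHb], rule cert_and_False[OF cHb])
  moreover have "n \<le> UC_b (n * NH) f' True"
  proof -
    obtain u v where uv: "u \<in> inputs NH" "H u" "v \<in> inputs NH" "\<not> H v"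
      using adversary_nonconstant[OF advH, of True] adversary_nonconstant[OF advH, of False] by auto
    show ?thesis unfolding f'_def by (rule UC_and_lower[OF u1[unfolded f'_def] uv])
  qed
  ultimately show ?thesis unfolding level_def N NH_def M_def s_def by blast
qed

section \<open>Parameters and polylogarithmic bookkeeping\<close>

definition clog :: "nat \<Rightarrow> nat" where
  "clog n = nat \<lceil>log 2 (real n)\<rceil>"

lemma clog_bounds:
  assumes "n \<ge> 2"
  shows "1 \<le> clog n" "n \<le> 2 ^ clog n" "real (clog n) \<le> 4 * ln (real n)"
proof -
  have l: "log 2 (real n) \<ge> 1" using assms by (simp add: le_log_iff)
  then show 1: "1 \<le> clog n" unfolding clog_def by linarith
  have "real n = 2 powr log 2 (real n)" using assms by simp
  also have "\<dots> \<le> 2 powr real (clog n)" unfolding clog_def by (intro powr_mono) linarith+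
  also have "\<dots> = real (2 ^ clog n)" by (simp add: powr_realpow)
  finally show "n \<le> 2 ^ clog n" using of_nat_le_iff by blast
  \<comment> \<open>Yields \<open>1 / 2 \<le> ln 2\<close>; this and the rounding up cost a factor 2
    each.\<close>
  have "exp (1 / 2 :: real) \<le> 2"
    using exp_bound[of "1 / 2"] by (simp add: power2_eq_square)
  then have ln2: "1 / 2 \<le> ln (2 :: real)" by (subst ln_ge_iff) simp_all
  have "real (clog n) \<le> log 2 (real n) + 1" using l unfolding clog_def by linarith
  also have "\<dots> \<le> 2 * log 2 (real n)" using l by simp
  also have "\<dots> \<le> 4 * ln (real n)"
  proof -
    have "ln (real n) * 1 \<le> ln (real n) * (2 * ln 2)" using ln2 assms by (intro mult_left_mono) auto
    then show ?thesis using ln2 by (simp add: log_def field_simps)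
  qed
  finally show "real (clog n) \<le> 4 * ln (real n)" .
qed

text \<open>Halving \<open>n\<close> gains a factor 2^(K+1) in the condition \<open>mC\<close>,
  enough to pay for the surplus factor \<open>n \<le> 2 ^ K\<close>. The three summands of the
  letter length cover the factors 4, \<open>K\<close> and \<open>n ^ K\<close> of
  \<open>qC\<close>.\<close>

lemma xor_search_params:
  assumes "1 \<le> K" "n \<le> 2 ^ K" "n \<ge> 2"
  shows "xor_search K n (2 + K + K\<^sup>2) (n div 2)"
proof
  show "0 < K" "0 < n div 2" using assms by auto
  have "2 ^ (K + 1) * (n div 2) ^ (K + 1) = (2 * (n div 2)) ^ (K + 1)" by (simp only: power_mult_distrib)
  also have "\<dots> \<le> n ^ (K + 1)" by (rule power_mono) auto
  also have "\<dots> \<le> 2 ^ K * n ^ K" using assms(2) by simp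
  also have "\<dots> \<le> 2 ^ (K + 1) * n ^ K" by simp
  finally show "(n div 2) ^ (K + 1) \<le> n ^ K" by simp
  have K2: "K \<le> 2 ^ K" by (simp add: less_imp_le)
  have "n ^ K \<le> 2 ^ (K\<^sup>2)"
    using power_mono[OF assms(2), of K] by (simp add: power_mult[symmetric] power2_eq_square)
  then have "4 * K * n ^ K \<le> 2\<^sup>2 * 2 ^ K * 2 ^ (K\<^sup>2)" using K2 by (intro mult_mono) auto
  then show "4 * K * n ^ K \<le> 2 ^ (2 + K + K\<^sup>2)" by (simp only: power_add)
  have "(n div 2)\<^sup>2 \<le> n\<^sup>2" by (rule power_mono) auto
  also have "\<dots> \<le> (2 ^ K)\<^sup>2" by (rule power_mono[OF assms(2)]) simp
  also have "\<dots> = 2 ^ (2 * K)" by (simp add: power_mult[symmetric] mult.commute)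
  also have "\<dots> \<le> 2 ^ (2 + K + K\<^sup>2)"
  proof (rule power_increasing)
    have "K * 1 \<le> K * K" using assms(1) by (intro mult_left_mono) auto
    then show "2 * K \<le> 2 + K + K\<^sup>2" unfolding power2_eq_square by linarith
  qed simp
  finally show "(n div 2)\<^sup>2 \<le> 2 ^ (2 + K + K\<^sup>2)" .
qed

text \<open>The constant is 18 = 6 * 3, where 6 comes from \<open>adversary_dnf\<close> and 3 from
  \<open>n \<le> 3 * (n div 2)\<close>; the cubes come from \<kappa> = \<open>K\<close> columns with
  letters of at most 4 K^2 bits.\<close>

lemma hard_dnf:
  assumes n: "n \<ge> 2" and K: "1 \<le> K" "n \<le> 2 ^ K"
  shows "\<exists>L t g. L \<le> 8 * K ^ 3 * n \<and> t \<le> 4 * K ^ 3 \<and> monotone_dnf L t g \<and>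
    adversary (inputs L) g (input_bits L) (real n / (18 * real K))"
proof -
  let ?b = "2 + K + K\<^sup>2"
  interpret xor_search K n ?b "n div 2" by (rule xor_search_params[OF K n])
  obtain g where g: "monotone_dnf (2 * (K * n * ?b)) (K * ?b) g"
    "adversary (inputs (2 * (K * n * ?b))) g (input_bits (2 * (K * n * ?b))) (real (n div 2) / (6 * real K))"
    using adversary_dnf by blast
  have K2: "1 \<le> K\<^sup>2" "K \<le> K\<^sup>2" using K(1) by (auto simp: power2_eq_square)
  then have b: "?b \<le> 4 * K\<^sup>2" by linarith
  have "K * ?b \<le> K * (4 * K\<^sup>2)" by (rule mult_left_mono[OF b]) simp
  then have t: "K * ?b \<le> 4 * K ^ 3" by (simp add: power3_eq_cube power2_eq_square)
  have "2 * (K * n * ?b) = 2 * n * (K * ?b)" by (simp only: mult_ac)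
  also have "\<dots> \<le> 2 * n * (4 * K ^ 3)" by (rule mult_left_mono[OF t]) simp
  finally have L: "2 * (K * n * ?b) \<le> 8 * K ^ 3 * n" by (simp only: mult_ac)
  have "n \<le> 3 * (n div 2)" using n by presburger
  then have "real n \<le> 3 * real (n div 2)" by linarith
  then have "real n / (18 * real K) \<le> real (n div 2) / (6 * real K)" using K(1) by (simp add: field_simps)
  from adversary_mono[OF finite_inputs g(2) _ this] K(1) show ?thesis using g(1) L t by auto
qed

text \<open>
  The bound on \<open>N\<close> keeps the names of certificates inside a cheat sheet polylogarithmically long.
\<close>

definition growth :: "nat \<Rightarrow> nat \<Rightarrow> nat \<Rightarrow> nat \<Rightarrow> nat \<Rightarrow> (bool list \<Rightarrow> bool) \<Rightarrow> bool" where
  "growth k C d n N f \<longleftrightarrow> N \<le> 2 ^ (C * clog n ^ d) \<and>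
     level N f (C * clog n ^ d * n ^ k) (C * clog n ^ d * n ^ (k + 1)) (C * clog n ^ d * n ^ (k + 1))
       (real n powr (3 / 2 * real k + 1) / real (C * clog n ^ d)) \<and>
     (k \<ge> 1 \<longrightarrow> n \<le> UC N f)"

lemma pow_le_pow2: "x \<le> (2 :: nat) ^ x"
  by (simp add: less_imp_le)

lemma growth_0: "\<exists>C d. 1 \<le> C \<and> (\<forall>n\<ge>2. \<exists>N f. growth 0 C d n N f)"
\<comment> \<open>18 is the constant of the adversary bound in \<open>hard_dnf\<close> and dominates
  the constants 8 and 4 of the sizes; 3 is the exponent of \<open>K\<close> there.\<close>
proof (rule exI[of _ 18], rule exI[of _ 3], intro conjI allI impI)
  fix n :: nat assume n: "n \<ge> 2"
  define K where "K = clog n"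
  have K: "1 \<le> K" "n \<le> 2 ^ K" using clog_bounds[OF n] by (auto simp: K_def)
  obtain L t g where g: "L \<le> 8 * K ^ 3 * n" "t \<le> 4 * K ^ 3" "monotone_dnf L t g"
    "adversary (inputs L) g (input_bits L) (real n / (18 * real K))"
    using hard_dnf[OF n K] by blast
  have K3: "K \<le> K ^ 3" using self_le_power[OF K(1), of 3] by simp
  have "growth 0 18 3 n L (\<lambda>x. \<not> g x)"
    unfolding growth_def K_def[symmetric]
  proof (intro conjI)
    have "L \<le> 2 ^ 3 * (2 ^ K) ^ 3 * 2 ^ K"
      using g(1) by (rule order_trans) (use K(2) pow_le_pow2[of K] in \<open>intro mult_mono power_mono; simp\<close>)
    also have "\<dots> = 2 ^ (3 + 3 * K + K)" by (simp only: power_add power_mult[symmetric] mult.commute)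
    also have "\<dots> \<le> 2 ^ (18 * K ^ 3)" by (rule power_increasing) (use K(1) K3 in linarith, simp)
    finally show "L \<le> 2 ^ (18 * K ^ 3)" .
    show "level L (\<lambda>x. \<not> g x) (18 * K ^ 3 * n ^ 0) (18 * K ^ 3 * n ^ (0 + 1)) (18 * K ^ 3 * n ^ (0 + 1))
       (real n powr (3 / 2 * real 0 + 1) / real (18 * K ^ 3))"
    proof (rule level_mono[OF level_dnf[OF g(3,4)]])
      have "8 * K ^ 3 * n \<le> 18 * K ^ 3 * n" by simp
      then show "L \<le> 18 * K ^ 3 * n ^ (0 + 1)" using g(1) by simp
      then show "L \<le> 18 * K ^ 3 * n ^ (0 + 1)" .
      have "real K \<le> real K ^ 3" using K3 of_nat_mono[of K "K ^ 3"] by simp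
      then have "real n / (18 * real K ^ 3) \<le> real n / (18 * real K)" using K(1) by (intro divide_left_mono) auto
      then show "real n powr (3 / 2 * real 0 + 1) / real (18 * K ^ 3) \<le> real n / (18 * real K)"
        using n by simp
    qed (use g(2) in auto)
  qed simp
  then show "\<exists>N f. growth 0 18 3 n N f" by blast
qed simp

lemma growth_Suc:
  assumes "\<exists>C d. 1 \<le> C \<and> (\<forall>n\<ge>2. \<exists>N f. growth k C d n N f)"
  shows "\<exists>C d. 1 \<le> C \<and> (\<forall>n\<ge>2. \<exists>N f. growth (Suc k) C d n N f)"
proof -
  obtain C d :: nat where C: "1 \<le> C" and IH: "\<And>n. n \<ge> 2 \<Longrightarrow> \<exists>N f. growth k C d n N f"
    using assms by blast
  \<comment> \<open>\<open>C1\<close> is the constant in the bound on \<open>cH\<close>, and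
    \<open>C2\<close> collects the exponents in the bound on the arity.
    \<open>d' = 1 + 3 + d + (d + 1)\<close> adds the powers of \<open>K\<close> in \<open>l\<close>,
    in the DNF, in \<open>B\<close> and in \<open>e\<close>. Within \<open>C'\<close>,
    \<open>3 * C1\<close> serves the three parts of the unambiguous bound and \<open>18 * C\<close>
    the adversary bound.\<close>
  define C1 where "C1 = (4 * k + 6) * (8 * C * (C + 12))"
  define C2 where "C2 = 1 + 3 * (4 * k + 6) + 7 + C + 8 * C * (C + 10) + (2 * d + 4) + (k + 1) + 1"
  define C' where "C' = 3 * C1 + 18 * C + C2"
  define d' where "d' = 2 * d + 5"
  have "\<exists>N f. growth (Suc k) C' d' n N f" if n: "n \<ge> 2" for n
  proof -
    define K where "K = clog n"
    have K: "1 \<le> K" "n \<le> 2 ^ K" using clog_bounds[OF n] by (auto simp: K_def)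
    define B where "B = C * K ^ d"
    obtain N\<^sub>0 f where f: "N\<^sub>0 \<le> 2 ^ B" "level N\<^sub>0 f (B * n ^ k) (B * n ^ (k + 1)) (B * n ^ (k + 1))
        (real n powr (3 / 2 * real k + 1) / real B)"
      using IH[OF n] unfolding growth_def K_def B_def by blast
    obtain L t g where g: "L \<le> 8 * K ^ 3 * n" "t \<le> 4 * K ^ 3" "monotone_dnf L t g"
      "adversary (inputs L) g (input_bits L) (real n / (18 * real K))"
      using hard_dnf[OF n K] by blast
    have Kp: "K ^ i \<le> K ^ j" if "i \<le> j" for i j using K(1) that by (rule power_increasing[rotated])
    have B1: "1 \<le> B" using C K(1) by (simp add: B_def)
    \<comment> \<open>Dominates both \<open>t * c1\<close> and \<open>L * c0\<close>, which are of
      order n^(k+1) up to powers of \<open>K\<close>.\<close>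
    define c where "c = 8 * K ^ 3 * B * n ^ (k + 1)"
    \<comment> \<open>Indices up to \<open>L * N\<^sub>0 \<le> 2 ^ (7 * K + B)\<close>, each with a
      bit, and the empty entry fit into \<open>3 + (7 * K + B)\<close> bits.\<close>
    define e where "e = (C + 10) * K ^ (d + 1)"
    \<comment> \<open>Makes \<open>sqrt 2 ^ l\<close> equal to 2^((2 k + 3) K), hence at least n^(2
      k + 3), which is at least \<open>\<Lambda>'\<close>; so hiding the filled cell costs nothing,
      although its address has only logarithmic length.\<close>
    define l where "l = (4 * k + 6) * K"
    define cH where "cH = l * c + (l * (c * e) + l * c)"
    define N where "N = n * cheat_len l (L * N\<^sub>0) (c * e)"
    \<comment> \<open>The product of the adversary bounds of \<open>g\<close> and of
      \<open>f\<close>; the cheat sheet is to keep this value.\<close>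
    define \<Lambda>' where "\<Lambda>' = real n powr (3 / 2 * real k + 2) / (18 * real C * real K ^ (d + 1))"
    have L2: "L \<le> 2 ^ (7 * K)"
    proof -
      have "L \<le> 2 ^ 3 * (2 ^ K) ^ 3 * 2 ^ K"
        using g(1) by (rule order_trans) (use K(2) pow_le_pow2[of K] in \<open>intro mult_mono power_mono; simp\<close>)
      also have "\<dots> = 2 ^ (3 + 3 * K + K)" by (simp only: power_add power_mult[symmetric] mult.commute)
      also have "\<dots> \<le> 2 ^ (7 * K)" by (rule power_increasing) (use K(1) in linarith, simp)
      finally show ?thesis .
    qed
    have LN: "L * N\<^sub>0 \<le> 2 ^ (7 * K + B)"
      unfolding power_add by (rule mult_mono[OF L2 f(1)]) auto
    have e: "2 * (L * N\<^sub>0 + 1) + 1 \<le> 2 ^ e"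
    proof -
      have gen: "2 * (a + 1) + 1 \<le> 2 ^ 3 * b" if "a \<le> b" "1 \<le> b" for a b :: nat using that by simp
      have "2 * (L * N\<^sub>0 + 1) + 1 \<le> 2 ^ 3 * 2 ^ (7 * K + B)" by (rule gen[OF LN]) simp
      also have "\<dots> = 2 ^ (3 + (7 * K + B))" by (simp only: power_add)
      also have "\<dots> \<le> 2 ^ e"
      proof (rule power_increasing)
        have "10 * K + B \<le> 10 * K ^ (d + 1) + C * K ^ (d + 1)"
          unfolding B_def using Kp[of 1 "d + 1"] Kp[of d "d + 1"] by (intro add_mono mult_left_mono) auto
        then show "3 + (7 * K + B) \<le> e" unfolding e_def distrib_right using K(1) by linarith
      qed simp
      finally show ?thesis .
    qed
    have "\<exists>f'. level N f' cH (n * cH) (n * cH + (l * (L * (B * n ^ (k + 1))) + cH)) (sqrt (real n) * \<Lambda>')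
        \<and> n \<le> UC_b N f' True"
    proof (rule level_step[OF f(2) g(3,4) _ _ _ _ _ e _ _ _ cH_def N_def])
      show "n > 0" "l > 0" using n K(1) by (auto simp: l_def)
      show "1 \<le> c" using K(1) B1 n by (simp add: c_def)
      have "t * (B * n ^ (k + 1)) \<le> 8 * K ^ 3 * (B * n ^ (k + 1))" using g(2) by (intro mult_right_mono) auto
      then show "t * (B * n ^ (k + 1)) \<le> c" by (simp add: c_def mult_ac)
      have "L * (B * n ^ k) \<le> 8 * K ^ 3 * n * (B * n ^ k)" using g(1) by (rule mult_right_mono) simp
      then show "L * (B * n ^ k) \<le> c" by (simp add: c_def mult_ac)
      show "0 \<le> \<Lambda>'" by (simp add: \<Lambda>'_def)
      have "real n * real n powr (3 / 2 * real k + 1) = real n powr (3 / 2 * real k + 2)"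
        using n powr_add[of "real n" 1 "3 / 2 * real k + 1"] by (simp add: add.commute)
      then have eq: "real n / (18 * real K) * (real n powr (3 / 2 * real k + 1) / real B) = \<Lambda>'"
        unfolding \<Lambda>'_def B_def by (simp add: mult_ac)
      show "\<Lambda>' \<le> 2 * (real n / (18 * real K) * (real n powr (3 / 2 * real k + 1) / real B))"
        unfolding eq using \<open>0 \<le> \<Lambda>'\<close> by simp
      have "1 * 1 \<le> (18 * real C) * real K ^ (d + 1)" using C K(1) by (intro mult_mono one_le_power) auto
      then have "\<Lambda>' \<le> real n powr (3 / 2 * real k + 2) / 1" unfolding \<Lambda>'_def by (intro divide_left_mono) auto
      also have "\<dots> \<le> real n powr real (2 * k + 3)" using n by (simp add: powr_mono)
      also have "\<dots> = real n ^ (2 * k + 3)" using n by (intro powr_realpow) simp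
      also have "\<dots> \<le> (2 ^ K) ^ (2 * k + 3)"
        using K(2) by (intro power_mono) (metis of_nat_le_iff of_nat_numeral of_nat_power, simp)
      also have "\<dots> = (sqrt 2 ^ 2) ^ (K * (2 * k + 3))" by (simp add: power_mult)
      also have "\<dots> = sqrt 2 ^ l" unfolding power_mult[symmetric] l_def by (simp add: algebra_simps)
      finally show "\<Lambda>' \<le> sqrt 2 ^ l" .
    qed
    then obtain f' where f': "level N f' cH (n * cH) (n * cH + (l * (L * (B * n ^ (k + 1))) + cH)) (sqrt (real n) * \<Lambda>')"
      "n \<le> UC_b N f' True" by blast
    have cHb: "cH \<le> C1 * K ^ d' * n ^ (k + 1)"
    proof -
      have "e + 2 \<le> (C + 12) * K ^ (d + 1)"
        using Kp[of 0 "d + 1"] unfolding e_def by (simp add: distrib_right)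
      then have "l * c * (e + 2) \<le> l * c * ((C + 12) * K ^ (d + 1))" by (rule mult_left_mono) simp
      also have "\<dots> = C1 * K ^ (1 + 3 + d + (d + 1)) * n ^ (k + 1)"
        unfolding l_def c_def B_def C1_def power_add by (simp only: mult_ac power_one_right)
      also have "1 + 3 + d + (d + 1) = d'" by (simp add: d'_def)
      finally show ?thesis unfolding cH_def by (simp add: algebra_simps)
    qed
    have wb: "l * (L * (B * n ^ (k + 1))) \<le> C1 * K ^ d' * n ^ (k + 2)"
    proof -
      have "l * (L * (B * n ^ (k + 1))) \<le> l * (8 * K ^ 3 * n * (B * n ^ (k + 1)))"
        using g(1) by (intro mult_left_mono mult_right_mono) auto
      also have "\<dots> = ((4 * k + 6) * (8 * C * 1)) * K ^ (1 + 3 + d) * n ^ (k + 2)"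
        unfolding l_def B_def power_add by (simp add: mult_ac power2_eq_square)
      also have "\<dots> \<le> C1 * K ^ d' * n ^ (k + 2)"
        unfolding C1_def d'_def by (intro mult_mono Kp) auto
      finally show ?thesis .
    qed
    have Nb: "N \<le> 2 ^ (C2 * K ^ d')"
    proof -
      have s: "c * e \<le> 2 ^ (8 * C * (C + 10) + K * (2 * d + 4) + K * (k + 1))"
      proof -
        have ex: "2 * d + 4 = 3 + d + (d + 1)" by simp
        have "c * e = (8 * C * (C + 10)) * K ^ (2 * d + 4) * n ^ (k + 1)"
          unfolding c_def e_def B_def ex power_add[of K] by (simp only: mult_ac)
        also have "\<dots> \<le> 2 ^ (8 * C * (C + 10)) * (2 ^ K) ^ (2 * d + 4) * (2 ^ K) ^ (k + 1)"
          using K(2) pow_le_pow2 by (intro mult_mono power_mono) auto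
        also have "\<dots> = 2 ^ (8 * C * (C + 10) + K * (2 * d + 4) + K * (k + 1))"
          by (simp only: power_add power_mult)
        finally show ?thesis .
      qed
      define X where "X = l + (7 * K + B)"
      define Y where "Y = l + l + (8 * C * (C + 10) + K * (2 * d + 4) + K * (k + 1))"
      have "l * (L * N\<^sub>0) \<le> 2 ^ X" unfolding X_def power_add[of _ l] by (intro mult_mono pow_le_pow2 LN) auto
      moreover have "2 ^ l * l * (c * e) \<le> 2 ^ Y"
        unfolding Y_def power_add[of _ "l + l"] power_add[of _ l l] by (intro mult_mono pow_le_pow2 s order_refl) auto
      moreover have "(2 :: nat) ^ X \<le> 2 ^ (X + Y)" "(2 :: nat) ^ Y \<le> 2 ^ (X + Y)" by (intro power_increasing; simp)+
      ultimately have "cheat_len l (L * N\<^sub>0) (c * e) \<le> 2 ^ (X + Y) + 2 ^ (X + Y)"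
        unfolding cheat_len_def by (meson add_mono order_trans)
      then have "cheat_len l (L * N\<^sub>0) (c * e) \<le> 2 ^ (X + Y + 1)" by simp
      then have "N \<le> 2 ^ K * 2 ^ (X + Y + 1)" unfolding N_def using K(2) by (intro mult_mono) auto
      also have "\<dots> = 2 ^ (K + (X + Y + 1))" by (simp only: power_add)
      also have "\<dots> \<le> 2 ^ (C2 * K ^ d')"
      proof (rule power_increasing)
        have k1: "K \<le> K ^ d'" "1 \<le> K ^ d'" "K ^ d \<le> K ^ d'"
          using Kp[of 1 d'] Kp[of 0 d'] Kp[of d d'] by (simp_all add: d'_def)
        have "K + (X + Y + 1) = 1 * K + 3 * (4 * k + 6) * K + 7 * K + C * K ^ d + 8 * C * (C + 10) * 1
            + (2 * d + 4) * K + (k + 1) * K + 1 * 1"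
          unfolding X_def Y_def l_def B_def by (simp add: algebra_simps)
        also have "\<dots> \<le> 1 * K ^ d' + 3 * (4 * k + 6) * K ^ d' + 7 * K ^ d' + C * K ^ d' + 8 * C * (C + 10) * K ^ d'
            + (2 * d + 4) * K ^ d' + (k + 1) * K ^ d' + 1 * K ^ d'"
          using k1 by (intro add_mono mult_left_mono) auto
        also have "\<dots> = C2 * K ^ d'" unfolding C2_def by (simp only: distrib_right)
        finally show "K + (X + Y + 1) \<le> C2 * K ^ d'" .
      qed simp
      finally show ?thesis .
    qed
    have "growth (Suc k) C' d' n N f'"
      unfolding growth_def K_def[symmetric]
    proof (intro conjI impI)
      have "C2 * K ^ d' \<le> C' * K ^ d'" unfolding C'_def by (intro mult_right_mono) auto
      then show "N \<le> 2 ^ (C' * K ^ d')" using Nb power_increasing[of _ _ "2 :: nat"] order_trans by (metis one_le_numeral)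
      have C1': "C1 * K ^ d' * x \<le> C' * K ^ d' * x" for x unfolding C'_def by (intro mult_right_mono) auto
      have nH: "n * cH \<le> C1 * K ^ d' * n ^ (k + 2)"
      proof -
        have "n * cH \<le> n * (C1 * K ^ d' * n ^ (k + 1))" by (rule mult_left_mono[OF cHb]) simp
        then show ?thesis by (simp add: mult_ac)
      qed
      have cHn: "cH \<le> n * cH" using n by simp
      show "level N f' (C' * K ^ d' * n ^ Suc k) (C' * K ^ d' * n ^ (Suc k + 1)) (C' * K ^ d' * n ^ (Suc k + 1))
         (real n powr (3 / 2 * real (Suc k) + 1) / real (C' * K ^ d'))"
      proof (rule level_mono[OF f'(1)])
        show "cH \<le> C' * K ^ d' * n ^ Suc k" 
          using order_trans[OF cHb C1'] by simp
        show "n * cH \<le> C' * K ^ d' * n ^ (Suc k + 1)" 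
          using order_trans[OF nH C1'] by simp
        have "n * cH + (l * (L * (B * n ^ (k + 1))) + cH) \<le> 3 * (C1 * K ^ d' * n ^ (k + 2))"
          using nH wb cHn by linarith
        also have "\<dots> = 3 * C1 * (K ^ d' * n ^ (k + 2))" by simp
        also have "\<dots> \<le> C' * (K ^ d' * n ^ (k + 2))" unfolding C'_def by (intro mult_right_mono) auto
        finally show "n * cH + (l * (L * (B * n ^ (k + 1))) + cH) \<le> C' * K ^ d' * n ^ (Suc k + 1)" by (simp add: mult.assoc)
        have "3 / 2 * real (Suc k) + 1 = 1 / 2 + (3 / 2 * real k + 2)" by (simp add: field_simps)
        then have "sqrt (real n) * real n powr (3 / 2 * real k + 2) = real n powr (3 / 2 * real (Suc k) + 1)"
          by (simp only: powr_add powr_half_sqrt of_nat_0_le_iff)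
        then have eq: "sqrt (real n) * \<Lambda>' = real n powr (3 / 2 * real (Suc k) + 1) / real (18 * C * K ^ (d + 1))"
          by (simp add: \<Lambda>'_def)
        have "18 * C * K ^ (d + 1) \<le> C' * K ^ d'" unfolding C'_def by (intro mult_mono Kp) (auto simp: d'_def)
        then have le: "real (18 * C * K ^ (d + 1)) \<le> real (C' * K ^ d')" using of_nat_le_iff by blast
        have pos: "0 < real (18 * C * K ^ (d + 1))" using C K(1) by simp
        show "real n powr (3 / 2 * real (Suc k) + 1) / real (C' * K ^ d') \<le> sqrt (real n) * \<Lambda>'"
          unfolding eq by (rule divide_left_mono[OF le _ mult_pos_pos[OF less_le_trans[OF pos le] pos]]) simp
      qed simp
      show "n \<le> UC N f'" using f'(2) by (simp add: UC_def)
    qed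
    then show ?thesis by blast
  qed
  moreover have "1 \<le> C'" using C by (simp add: C'_def)
  ultimately show ?thesis by blast
qed

lemma growth_exists: "\<exists>C d. 1 \<le> C \<and> (\<forall>n\<ge>2. \<exists>N f. growth k C d n N f)"
  by (induction k) (rule growth_0, rule growth_Suc)

section \<open>From the invariant to the asymptotic statements\<close>

lemma growth_bounds:
  assumes g: "growth k C d n N f" and C: "1 \<le> C" and n: "n \<ge> 2"
  shows "real (UC N f) \<le> real C * 4 ^ d * (real n ^ (k + 1) * ln (real n) ^ d)"
    and "real n powr (3 / 2 * real k + 1) / ln (real n) ^ d \<le> 36 * (real C * 4 ^ d) * real (Q N f)"
proof -
  define K where "K = clog n"
  have K: "1 \<le> K" "real K \<le> 4 * ln (real n)" using clog_bounds[OF n] by (auto simp: K_def)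
  have ln: "ln (real n) > 0" using n by simp
  have Kd: "real K ^ d \<le> 4 ^ d * ln (real n) ^ d"
    using power_mono[OF K(2), of d] by (simp add: power_mult_distrib)
  have lev: "level N f (C * K ^ d * n ^ k) (C * K ^ d * n ^ (k + 1)) (C * K ^ d * n ^ (k + 1))
       (real n powr (3 / 2 * real k + 1) / real (C * K ^ d))"
    using g unfolding growth_def K_def by blast
  have "real (UC N f) \<le> real (C * K ^ d * n ^ (k + 1))" using level_UC[OF lev] of_nat_le_iff by blast
  also have "\<dots> = real C * real K ^ d * real n ^ (k + 1)" by simp
  also have "\<dots> \<le> real C * (4 ^ d * ln (real n) ^ d) * real n ^ (k + 1)"
    by (intro mult_right_mono mult_left_mono Kd) auto
  finally show "real (UC N f) \<le> real C * 4 ^ d * (real n ^ (k + 1) * ln (real n) ^ d)" by (simp add: mult_ac)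
  have "real n powr (3 / 2 * real k + 1) / real (C * K ^ d) / 36 \<le> real (Q N f)"
    using lev unfolding level_def by (intro Q_ge_adversary) auto
  moreover have CK: "0 < real (C * K ^ d)" using C K(1) by simp
  ultimately have "real n powr (3 / 2 * real k + 1) \<le> 36 * real (C * K ^ d) * real (Q N f)"
    by (simp add: field_simps)
  also have "\<dots> \<le> 36 * (real C * (4 ^ d * ln (real n) ^ d)) * real (Q N f)"
    using Kd by (intro mult_right_mono mult_left_mono) (auto intro!: mult_left_mono)
  finally show "real n powr (3 / 2 * real k + 1) / ln (real n) ^ d \<le> 36 * (real C * 4 ^ d) * real (Q N f)"
    using ln by (simp add: field_simps)
qed

text \<open>Lets one fixed round absorb its constants and logarithms into a single factor
  \<open>n\<close>, with \<open>n\<close> as large as desired.\<close>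

lemma polylog_le_linear:
  fixes A :: real
  shows "\<exists>n\<ge>2. n \<ge> j \<and> A * ln (real n) ^ d \<le> real n"
proof -
  have "((\<lambda>n. ln (real n) ^ d / exp (ln (real n))) \<longlongrightarrow> 0) sequentially"
    by (rule filterlim_compose[OF tendsto_power_div_exp_0
          filterlim_compose[OF ln_at_top filterlim_real_sequentially]])
  then have "((\<lambda>n. A * (ln (real n) ^ d / exp (ln (real n)))) \<longlongrightarrow> A * 0) sequentially"
    by (intro tendsto_mult tendsto_const)
  then have "eventually (\<lambda>n. A * (ln (real n) ^ d / exp (ln (real n))) < 1) sequentially"
    by (intro order_tendstoD(2)) auto
  moreover have "eventually (\<lambda>n. n \<ge> max 2 j) sequentially" by (rule eventually_ge_at_top)
  ultimately have "eventually (\<lambda>n. n \<ge> max 2 j \<and> A * (ln (real n) ^ d / exp (ln (real n))) < 1) sequentially"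
    by eventually_elim simp
  then obtain n where n: "n \<ge> max 2 j" "A * (ln (real n) ^ d / exp (ln (real n))) < 1"
    using eventually_happens'[OF sequentially_bot] by blast
  then have "A * ln (real n) ^ d \<le> real n" by (simp add: field_simps)
  then show ?thesis using n(1) by auto
qed

theorem theorem7:
  shows "(\<forall>k::nat. \<exists>(N :: nat \<Rightarrow> nat) (f :: nat \<Rightarrow> bool list \<Rightarrow> bool).
            (\<lambda>n. real (Q (N n) (f n))) \<in> soft_bigomega (\<lambda>n. real n powr (3/2 * real k + 1)) \<and>
            (\<lambda>n. real (UC (N n) (f n))) \<in> soft_bigo (\<lambda>n. real n ^ (k + 1)))
       \<and> (\<exists>(M :: nat \<Rightarrow> nat) (g :: nat \<Rightarrow> bool list \<Rightarrow> bool) (\<epsilon> :: nat \<Rightarrow> real).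
            filterlim (\<lambda>j. UC (M j) (g j)) at_top sequentially \<and>
            \<epsilon> \<longlonglongrightarrow> 0 \<and>
            (\<forall>j. real (Q (M j) (g j)) \<ge> real (UC (M j) (g j)) powr (3/2 - \<epsilon> j)))"
proof (intro conjI allI)
  fix k :: nat
  obtain C d :: nat where C: "1 \<le> C" and ex: "\<forall>n\<ge>2. \<exists>N f. growth k C d n N f"
    using growth_exists by blast
  obtain N f where g: "\<And>n. n \<ge> 2 \<Longrightarrow> growth k C d n (N n) (f n)"
    using ex by metis
  have ev: "eventually (\<lambda>n::nat. n \<ge> 2) sequentially" by (rule eventually_ge_at_top)
  have "(\<lambda>n. real (Q (N n) (f n))) \<in> \<Omega>(\<lambda>n. real n powr (3/2 * real k + 1) / ln (real n) ^ d)"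
  proof (rule landau_omega.bigI[of "1 / (36 * (real C * 4 ^ d))"])
    show "0 < 1 / (36 * (real C * 4 ^ d))" using C by simp
    show "eventually (\<lambda>n. norm (real (Q (N n) (f n))) \<ge> 1 / (36 * (real C * 4 ^ d)) *
        norm (real n powr (3/2 * real k + 1) / ln (real n) ^ d)) sequentially"
      using ev
    proof eventually_elim
      case (elim n)
      have "ln (real n) > 0" using elim by simp
      then have eq: "norm (real n powr (3/2 * real k + 1) / ln (real n) ^ d) = real n powr (3/2 * real k + 1) / ln (real n) ^ d"
        by simp
      have gen: "1 / A * X \<le> norm Y" if "X \<le> A * Y" "A > 0" "Y \<ge> 0" for A X Y :: real
        using that by (simp add: field_simps)
      show ?case
        unfolding eq by (rule gen[OF growth_bounds(2)[OF g[OF elim] C elim]]) (use C in simp_all)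
    qed
  qed
  moreover have "(\<lambda>n. real (UC (N n) (f n))) \<in> O(\<lambda>n. real n ^ (k + 1) * ln (real n) ^ d)"
  proof (rule landau_o.bigI[of "real C * 4 ^ d"])
    show "0 < real C * 4 ^ d" using C by simp
    show "eventually (\<lambda>n. norm (real (UC (N n) (f n))) \<le> real C * 4 ^ d *
        norm (real n ^ (k + 1) * ln (real n) ^ d)) sequentially"
      using ev
    proof eventually_elim
      case (elim n)
      have "ln (real n) > 0" using elim by simp
      then have "norm (real n ^ (k + 1) * ln (real n) ^ d) = real n ^ (k + 1) * ln (real n) ^ d" by simp
      then show ?case using growth_bounds(1)[OF g[OF elim] C elim] by simp
    qed
  qed
  ultimately show "\<exists>N f. (\<lambda>n. real (Q (N n) (f n))) \<in> soft_bigomega (\<lambda>n. real n powr (3/2 * real k + 1)) \<and>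
            (\<lambda>n. real (UC (N n) (f n))) \<in> soft_bigo (\<lambda>n. real n ^ (k + 1))"
    unfolding soft_bigomega_def soft_bigo_def by blast
next
  have "\<exists>M f. j \<le> UC M f \<and> real (UC M f) powr (3 / 2 - 3 / (real j + 3)) \<le> real (Q M f)" for j :: nat
  proof -
    \<comment> \<open>Round \<open>k\<close> with a suitable \<open>n\<close> gives UC at most
      n^(k+2) and Q at least n^(1.5 k), one factor n being spent on the polylogarithm each time. The
      ratio of the exponents is 1.5 k / (k + 2) = 3/2 - 3 / (k + 2), and
      \<open>k + 2 = j + 3\<close>. The offset makes \<open>k\<close> positive, as
      \<open>growth\<close> bounds UC from below only after at least one round.\<close>
    define k where "k = j + 1"
    obtain C d :: nat where C: "1 \<le> C" and ex: "\<forall>n\<ge>2. \<exists>N f. growth k C d n N f"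
      using growth_exists by blast
    obtain n :: nat where n: "n \<ge> 2" "n \<ge> j" "36 * (real C * 4 ^ d) * ln (real n) ^ d \<le> real n"
      using polylog_le_linear by blast
    obtain N f where g: "growth k C d n N f" using ex n(1) by blast
    note b = growth_bounds[OF g C n(1)]
    have ln: "ln (real n) > 0" and n0: "real n > 0" using n(1) by auto
    have nUC: "n \<le> UC N f" using g unfolding growth_def k_def by auto
    have "real C * 4 ^ d * (real n ^ (k + 1) * ln (real n) ^ d) = (real C * 4 ^ d * ln (real n) ^ d) * real n ^ (k + 1)"
      by simp
    also have "\<dots> \<le> real n * real n ^ (k + 1)"
    proof (rule mult_right_mono)
      have "1 * (real C * 4 ^ d * ln (real n) ^ d) \<le> 36 * (real C * 4 ^ d * ln (real n) ^ d)"
        using ln by (intro mult_right_mono) auto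
      then show "real C * 4 ^ d * ln (real n) ^ d \<le> real n" using n(3) by simp
    qed simp
    also have "\<dots> = real n powr (real k + 2)"
      using powr_realpow[OF n0, of "k + 2"] by (simp add: add.commute)
    finally have UCle: "real (UC N f) \<le> real n powr (real k + 2)" by (rule order_trans[OF b(1)])
    have "real n powr (3 / 2 * real k + 1) \<le> 36 * (real C * 4 ^ d) * real (Q N f) * ln (real n) ^ d"
      using b(2) ln by (simp add: field_simps)
    also have "\<dots> = 36 * (real C * 4 ^ d) * ln (real n) ^ d * real (Q N f)" by simp
    also have "\<dots> \<le> real n * real (Q N f)" by (rule mult_right_mono[OF n(3)]) simp
    finally have Qge: "real n powr (3 / 2 * real k) \<le> real (Q N f)"
      using n0 by (simp add: powr_add)
    have "real (UC N f) powr (3 / 2 - 3 / (real j + 3)) \<le> (real n powr (real k + 2)) powr (3 / 2 - 3 / (real j + 3))"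
    proof (rule powr_mono2[OF _ _ UCle])
      show "0 \<le> 3 / 2 - 3 / (real j + 3)" by (simp add: field_simps)
    qed simp
    also have "\<dots> = real n powr ((real k + 2) * (3 / 2 - 3 / (real j + 3)))" by (rule powr_powr)
    also have "(real k + 2) * (3 / 2 - 3 / (real j + 3)) = 3 / 2 * real k"
      by (simp add: k_def field_simps)
    finally show ?thesis using nUC n(2) Qge by (intro exI[of _ N] exI[of _ f]) auto
  qed
  then obtain M g where Mg: "\<And>j. j \<le> UC (M j) (g j)"
    "\<And>j. real (UC (M j) (g j)) powr (3 / 2 - 3 / (real j + 3)) \<le> real (Q (M j) (g j))"
    by metis
  show "\<exists>(M :: nat \<Rightarrow> nat) (g :: nat \<Rightarrow> bool list \<Rightarrow> bool) (\<epsilon> :: nat \<Rightarrow> real).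
            filterlim (\<lambda>j. UC (M j) (g j)) at_top sequentially \<and>
            \<epsilon> \<longlonglongrightarrow> 0 \<and>
            (\<forall>j. real (Q (M j) (g j)) \<ge> real (UC (M j) (g j)) powr (3/2 - \<epsilon> j))"
  proof (intro exI[of _ M] exI[of _ g] exI[of _ "\<lambda>j. 3 / (real j + 3)"] conjI allI)
    show "filterlim (\<lambda>j. UC (M j) (g j)) at_top sequentially"
      by (rule filterlim_at_top_mono[OF filterlim_ident]) (use Mg(1) in auto)
    show "(\<lambda>j. 3 / (real j + 3)) \<longlonglongrightarrow> 0"
      using LIMSEQ_ignore_initial_segment[OF lim_const_over_n[of "3 :: real"], of 3] by simp
    show "real (UC (M j) (g j)) powr (3 / 2 - 3 / (real j + 3)) \<le> real (Q (M j) (g j))" for j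
      by (rule Mg(2))
  qed
qed

end
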